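(* If $\mathrm{char}\,K\neq2,3$, then $\mathrm{Ext}^1_{KW_r}(k,S'(\lambda))=0$ for every bi-partition $\lambda$ of $r$, where $k$ denotes the trivial $KW_r$-module.
   Context: $K$ is an algebraically closed field, $r\ge1$, and modules are finite-dimensional right modules. $W_r$ is the hyperoctahedral group: permutations $\sigma$ of $\{\pm1,\dots,\pm r\}$ with $\sigma(-i)=-\sigma(i)$ (acting on the right on symbols); $KW_r$ is its group algebra. Each $\sigma\in W_r$ is uniquely a product of sign changes $\xi_i$ (swapping $i$ and $-i$, fixing the other symbols) times some $\pi\in\mathfrak S_r$; put $\mathrm{sgn}\,\sigma=(-1)^{x}\mathrm{sgn}\,\pi$ with $x$ the number of sign changes. A bi-partition $\lambda=(\lambda^1,\lambda^2)$ of $r$ is a pair of (possibly empty) partitions with $|\lambda^1|+|\lambda^2|=r$. A $\lambda$-bi-tableau $t=(t^1,t^2)$ is a filling of the boxes of the Young diagrams of $\lambda^1,\lambda^2$ by elements of $\{\pm1,\dots,\pm r\}$ in which every absolute value $1,\dots,r$ occurs exactly once; $W_r$ acts on bi-tableaux on the right through the entries. $R_t\le W_r$ is the group of elements permuting the entries within each row of $t$, possibly changing signs of entries of $t^2$ (but not of $t^1$); $C_t\le W_r$ is the group of elements permuting the entries within each column of $t$, possibly changing signs of entries of $t^1$ (but not of $t^2$). Put $t_1\sim t_2$ if $t_2=t_1\sigma$ for some $\sigma\in R_{t_1}$; the class of $t$ is the bi-tabloid $\{t\}$. The permutation module $M(\lambda)$ is the $K$-space with basis the $\lambda$-bi-tabloids,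 with action $\{t\}\sigma=\{t\sigma\}$. Put $k_t=\sum_{\sigma\in C_t}(\mathrm{sgn}\,\sigma)\sigma$ and $e_t=\{t\}k_t$. The Specht module $S(\lambda)\subseteq M(\lambda)$ is the span of all $e_t$; the dual Specht module is $S'(\lambda)=S(\lambda)^*$ (contragredient dual). *)

theory Defs
  imports
    "HOL-Algebra.Algebra"
    "HOL-Computational_Algebra.Polynomial"
    "HOL-Combinatorics.Permutations"
begin

section \<open>Right modules over a ring and the first extension group\<close>

text \<open>
  The record \<^type>\<open>module\<close> of HOL-Algebra is used for right modules over a not necessarily
  commutative ring \<open>R\<close>: the element \<open>a \<odot>\<^bsub>M\<^esub> x\<close> is the product usually written \<open>x a\<close>, so the
  associativity law reads \<open>(a \<otimes> b) \<odot> x = b \<odot> (a \<odot> x)\<close>. The ring multiplication and unit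
  contained in the record have no meaning for a module and are left undefined.
\<close>

definition mod_hom ::
  "('a, 'r) ring_scheme \<Rightarrow> ('a, 'm, 's) module_scheme \<Rightarrow> ('a, 'n, 't) module_scheme \<Rightarrow> ('m \<Rightarrow> 'n) set"
  where "mod_hom R M N = {f \<in> carrier M \<rightarrow>\<^sub>E carrier N.
    (\<forall>x\<in>carrier M. \<forall>y\<in>carrier M. f (x \<oplus>\<^bsub>M\<^esub> y) = f x \<oplus>\<^bsub>N\<^esub> f y) \<and>
    (\<forall>a\<in>carrier R. \<forall>x\<in>carrier M. f (a \<odot>\<^bsub>M\<^esub> x) = a \<odot>\<^bsub>N\<^esub> f x)}"

definition Hom ::
  "('a, 'r) ring_scheme \<Rightarrow> ('a, 'm, 's) module_scheme \<Rightarrow> ('a, 'n, 't) module_scheme \<Rightarrow> ('m \<Rightarrow> 'n) monoid"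
  where "Hom R M N =
    \<lparr>carrier = mod_hom R M N,
     monoid.mult = (\<lambda>f g. \<lambda>x\<in>carrier M. f x \<oplus>\<^bsub>N\<^esub> g x),
     one = (\<lambda>x\<in>carrier M. \<zero>\<^bsub>N\<^esub>)\<rparr>"

text \<open>The free right \<open>R\<close>-module on a set \<open>B\<close>: finitely supported functions \<open>B \<rightarrow> R\<close>.\<close>

definition free_mod :: "('a, 'r) ring_scheme \<Rightarrow> 'x set \<Rightarrow> ('a, 'x \<Rightarrow> 'a) module"
  where "free_mod R B =
    \<lparr>carrier = {u. (\<forall>x. u x \<in> carrier R) \<and> {x. u x \<noteq> \<zero>\<^bsub>R\<^esub>} \<subseteq> B \<and>
                   finite {x. u x \<noteq> \<zero>\<^bsub>R\<^esub>}},
     monoid.mult = undefined, one = undefined,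
     ring.zero = (\<lambda>x. \<zero>\<^bsub>R\<^esub>),
     add = (\<lambda>u v x. u x \<oplus>\<^bsub>R\<^esub> v x),
     module.smult = (\<lambda>a u x. u x \<otimes>\<^bsub>R\<^esub> a)\<rparr>"

text \<open>For \<open>B \<subseteq> M\<close>, the homomorphism from the free module on \<open>B\<close> to \<open>M\<close> that extends the
  inclusion of \<open>B\<close>, and its kernel.\<close>

definition lin_comb :: "('a, 'r) ring_scheme \<Rightarrow> ('a, 'm, 's) module_scheme \<Rightarrow> ('m \<Rightarrow> 'a) \<Rightarrow> 'm"
  where "lin_comb R M u = (\<Oplus>\<^bsub>M\<^esub>x\<in>{x. u x \<noteq> \<zero>\<^bsub>R\<^esub>}. u x \<odot>\<^bsub>M\<^esub> x)"

definition relations ::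
  "('a, 'r) ring_scheme \<Rightarrow> ('a, 'm, 's) module_scheme \<Rightarrow> 'm set \<Rightarrow> ('m \<Rightarrow> 'a) set"
  where "relations R M B = {u \<in> carrier (free_mod R B). lin_comb R M u = \<zero>\<^bsub>M\<^esub>}"

text \<open>
  The beginning of the canonical free resolution
  \<open>P\<^sub>2 \<rightarrow> P\<^sub>1 \<rightarrow> P\<^sub>0 \<rightarrow> N \<rightarrow> 0\<close> of \<open>N\<close>: \<open>P\<^sub>0\<close> is free on the set \<open>N\<close>, and each further term is free
  on the kernel of the preceding map. All maps are given by \<^const>\<open>lin_comb\<close>.
\<close>

definition res0 :: "('a, 'r) ring_scheme \<Rightarrow> ('a, 'm, 's) module_scheme \<Rightarrow> ('a, 'm \<Rightarrow> 'a) module"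
  where "res0 R N = free_mod R (carrier N)"

definition res1 ::
  "('a, 'r) ring_scheme \<Rightarrow> ('a, 'm, 's) module_scheme \<Rightarrow> ('a, ('m \<Rightarrow> 'a) \<Rightarrow> 'a) module"
  where "res1 R N = free_mod R (relations R N (carrier N))"

definition res2 ::
  "('a, 'r) ring_scheme \<Rightarrow> ('a, 'm, 's) module_scheme \<Rightarrow> ('a, (('m \<Rightarrow> 'a) \<Rightarrow> 'a) \<Rightarrow> 'a) module"
  where "res2 R N = free_mod R (relations R (res0 R N) (relations R N (carrier N)))"

text \<open>\<open>Ext\<^sup>1(N, M)\<close> is the first cohomology group of \<open>Hom(P\<^sub>\<bullet>, M)\<close>, as a group written
  multiplicatively.\<close>

definition ext1_cocycles ::
  "('a, 'r) ring_scheme \<Rightarrow> ('a, 'n, 's) module_scheme \<Rightarrow> ('a, 'm, 't) module_scheme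
    \<Rightarrow> ((('n \<Rightarrow> 'a) \<Rightarrow> 'a) \<Rightarrow> 'm) set"
  where "ext1_cocycles R N M =
    {f \<in> mod_hom R (res1 R N) M.
      \<forall>w\<in>carrier (res2 R N). f (lin_comb R (res1 R N) w) = \<zero>\<^bsub>M\<^esub>}"

definition ext1_coboundaries ::
  "('a, 'r) ring_scheme \<Rightarrow> ('a, 'n, 's) module_scheme \<Rightarrow> ('a, 'm, 't) module_scheme
    \<Rightarrow> ((('n \<Rightarrow> 'a) \<Rightarrow> 'a) \<Rightarrow> 'm) set"
  where "ext1_coboundaries R N M =
    (\<lambda>g. \<lambda>w\<in>carrier (res1 R N). g (lin_comb R (res0 R N) w)) ` mod_hom R (res0 R N) M"

definition Ext1 ::
  "('a, 'r) ring_scheme \<Rightarrow> ('a, 'n, 's) module_scheme \<Rightarrow> ('a, 'm, 't) module_scheme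
    \<Rightarrow> ((('n \<Rightarrow> 'a) \<Rightarrow> 'a) \<Rightarrow> 'm) set monoid"
  where "Ext1 R N M =
    (Hom R (res1 R N) M)\<lparr>carrier := ext1_cocycles R N M\<rparr> Mod ext1_coboundaries R N M"


section \<open>Group algebras and their modules\<close>

definition group_algebra :: "('g, 'b) monoid_scheme \<Rightarrow> ('g \<Rightarrow> 'k::field) ring"
  where "group_algebra G =
    \<lparr>carrier = {a. finite {g. a g \<noteq> 0} \<and> {g. a g \<noteq> 0} \<subseteq> carrier G},
     monoid.mult = (\<lambda>a b x. \<Sum>(g, h)\<in>{(g, h). a g \<noteq> 0 \<and> b h \<noteq> 0 \<and> g \<otimes>\<^bsub>G\<^esub> h = x}. a g * b h),
     one = (\<lambda>x. if x = \<one>\<^bsub>G\<^esub> then 1 else 0),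
     ring.zero = (\<lambda>x. 0),
     add = (\<lambda>a b x. a x + b x)\<rparr>"

definition trivial_mod :: "('g \<Rightarrow> 'k::field, 'k) module"
  where "trivial_mod =
    \<lparr>carrier = UNIV, monoid.mult = undefined, one = undefined, ring.zero = 0, add = (+),
     module.smult = (\<lambda>a c. c * (\<Sum>g\<in>{g. a g \<noteq> 0}. a g))\<rparr>"

text \<open>The right permutation module on a set \<open>B\<close> with right action \<open>act x g\<close>.\<close>

definition perm_mod ::
  "('g, 'b) monoid_scheme \<Rightarrow> 'x set \<Rightarrow> ('x \<Rightarrow> 'g \<Rightarrow> 'x) \<Rightarrow> ('g \<Rightarrow> 'k::field, 'x \<Rightarrow> 'k) module"
  where "perm_mod G B act =
    \<lparr>carrier = {v. finite {x. v x \<noteq> 0} \<and> {x. v x \<noteq> 0} \<subseteq> B},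
     monoid.mult = undefined, one = undefined,
     ring.zero = (\<lambda>x. 0),
     add = (\<lambda>v w x. v x + w x),
     module.smult = (\<lambda>a v y. \<Sum>(x, g)\<in>{(x, g). v x \<noteq> 0 \<and> a g \<noteq> 0 \<and> act x g = y}. v x * a g)\<rparr>"

text \<open>The scalar \<open>c\<close> of the ground field as an element of the group algebra.\<close>

definition scalar :: "('g, 'b) monoid_scheme \<Rightarrow> 'k::field \<Rightarrow> 'g \<Rightarrow> 'k"
  where "scalar G c = (\<lambda>g. if g = \<one>\<^bsub>G\<^esub> then c else 0)"

text \<open>The linear extension of \<open>g \<mapsto> g\<^sup>-\<^sup>1\<close>.\<close>

definition antipode :: "('g, 'b) monoid_scheme \<Rightarrow> ('g \<Rightarrow> 'k::field) \<Rightarrow> 'g \<Rightarrow> 'k"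
  where "antipode G a = (\<lambda>g. if g \<in> carrier G then a (inv\<^bsub>G\<^esub> g) else 0)"

text \<open>The contragredient dual: \<open>K\<close>-linear forms \<open>\<phi>\<close>, with \<open>(\<phi> g)(x) = \<phi>(x g\<^sup>-\<^sup>1)\<close> for \<open>g\<close> in \<open>G\<close>.\<close>

definition dual_mod ::
  "('g, 'b) monoid_scheme \<Rightarrow> ('g \<Rightarrow> 'k::field, 'm, 's) module_scheme \<Rightarrow> ('g \<Rightarrow> 'k, 'm \<Rightarrow> 'k) module"
  where "dual_mod G M =
    \<lparr>carrier = {\<phi> \<in> extensional (carrier M).
       (\<forall>x\<in>carrier M. \<forall>y\<in>carrier M. \<phi> (x \<oplus>\<^bsub>M\<^esub> y) = \<phi> x + \<phi> y) \<and>
       (\<forall>c. \<forall>x\<in>carrier M. \<phi> (scalar G c \<odot>\<^bsub>M\<^esub> x) = c * \<phi> x)},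
     monoid.mult = undefined, one = undefined,
     ring.zero = (\<lambda>x\<in>carrier M. 0),
     add = (\<lambda>\<phi> \<psi>. \<lambda>x\<in>carrier M. \<phi> x + \<psi> x),
     module.smult = (\<lambda>a \<phi>. \<lambda>x\<in>carrier M. \<phi> (antipode G a \<odot>\<^bsub>M\<^esub> x))\<rparr>"


section \<open>The hyperoctahedral group\<close>

definition symbols :: "nat \<Rightarrow> int set"
  where "symbols r = {- int r..int r} - {0}"

text \<open>The group acts on symbols from the right, so \<open>\<sigma> \<tau>\<close> means first \<open>\<sigma>\<close>, then \<open>\<tau>\<close>. As usual for
  \<^const>\<open>permutes\<close>, the elements are functions on all integers that fix everything outside
  \<open>symbols r\<close>, in particular 0.\<close>

definition hyperoct :: "nat \<Rightarrow> (int \<Rightarrow> int) monoid"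
  where "hyperoct r =
    \<lparr>carrier = {\<sigma>. \<sigma> permutes symbols r \<and> (\<forall>i\<in>symbols r. \<sigma> (- i) = - \<sigma> i)},
     monoid.mult = (\<lambda>\<sigma> \<tau>. \<tau> \<circ> \<sigma>),
     one = id\<rparr>"

text \<open>If \<open>\<sigma>\<close> is a product of sign changes followed by \<open>\<pi> \<in> S\<^sub>r\<close>, then \<open>\<pi> i = \<bar>\<sigma> i\<bar>\<close> for
  \<open>1 \<le> i \<le> r\<close>, and \<open>i\<close> undergoes a sign change iff \<open>\<sigma> i < 0\<close>. The sign of \<open>\<pi>\<close> is that of a
  permutation of \<open>{1..r}\<close>; as a permutation of all symbols \<open>\<pi>\<close> would always be even.\<close>

definition perm_part :: "nat \<Rightarrow> (int \<Rightarrow> int) \<Rightarrow> int \<Rightarrow> int"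
  where "perm_part r \<sigma> i = (if i \<in> {1..int r} then \<bar>\<sigma> i\<bar> else i)"

definition hsgn :: "nat \<Rightarrow> (int \<Rightarrow> int) \<Rightarrow> int"
  where "hsgn r \<sigma> = (- 1) ^ card {i \<in> {1..int r}. \<sigma> i < 0} * sign (perm_part r \<sigma>)"


section \<open>Bi-tableaux, bi-tabloids and Specht modules\<close>

definition is_partition :: "nat list \<Rightarrow> bool"
  where "is_partition p \<longleftrightarrow> sorted_wrt (\<ge>) p \<and> 0 \<notin> set p"

type_synonym bipart = "nat list \<times> nat list"

definition bipartition :: "nat \<Rightarrow> bipart \<Rightarrow> bool"
  where "bipartition r l \<longleftrightarrow>
    is_partition (fst l) \<and> is_partition (snd l) \<and> sum_list (fst l) + sum_list (snd l) = r"

definition young :: "nat list \<Rightarrow> (nat \<times> nat) set"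
  where "young p = {(i, j). i < length p \<and> j < p ! i}"

text \<open>A bi-tableau \<open>t = (t\<^sup>1, t\<^sup>2)\<close> is one function on the disjoint union of the two Young diagrams
  (\<open>t \<circ> Inl = t\<^sup>1\<close>, \<open>t \<circ> Inr = t\<^sup>2\<close>), set to 0 outside.\<close>

type_synonym bitab = "(nat \<times> nat) + (nat \<times> nat) \<Rightarrow> int"

definition diagram :: "bipart \<Rightarrow> ((nat \<times> nat) + (nat \<times> nat)) set"
  where "diagram l = young (fst l) <+> young (snd l)"

definition bitableaux :: "nat \<Rightarrow> bipart \<Rightarrow> bitab set"
  where "bitableaux r l =
    {t. bij_betw (\<lambda>b. \<bar>t b\<bar>) (diagram l) {1..int r} \<and> (\<forall>b. b \<notin> diagram l \<longrightarrow> t b = 0)}"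

text \<open>The right action through the entries. Since 0 is fixed, boxes outside the diagram keep the
  value 0.\<close>

definition tab_act :: "bitab \<Rightarrow> (int \<Rightarrow> int) \<Rightarrow> bitab"
  where "tab_act t \<sigma> = \<sigma> \<circ> t"

definition row1 :: "bipart \<Rightarrow> bitab \<Rightarrow> nat \<Rightarrow> int set"
  where "row1 l t i = {t (Inl (i, j)) | j. (i, j) \<in> young (fst l)}"

definition row2 :: "bipart \<Rightarrow> bitab \<Rightarrow> nat \<Rightarrow> int set"
  where "row2 l t i = {t (Inr (i, j)) | j. (i, j) \<in> young (snd l)}"

definition col1 :: "bipart \<Rightarrow> bitab \<Rightarrow> nat \<Rightarrow> int set"
  where "col1 l t j = {t (Inl (i, j)) | i. (i, j) \<in> young (fst l)}"

definition col2 :: "bipart \<Rightarrow> bitab \<Rightarrow> nat \<Rightarrow> int set"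
  where "col2 l t j = {t (Inr (i, j)) | i. (i, j) \<in> young (snd l)}"

definition signed :: "int set \<Rightarrow> int set"
  where "signed A = A \<union> uminus ` A"

definition row_stab :: "nat \<Rightarrow> bipart \<Rightarrow> bitab \<Rightarrow> (int \<Rightarrow> int) set"
  where "row_stab r l t = {\<sigma> \<in> carrier (hyperoct r).
    (\<forall>i. \<sigma> ` row1 l t i = row1 l t i) \<and>
    (\<forall>i. \<sigma> ` signed (row2 l t i) = signed (row2 l t i))}"

definition col_stab :: "nat \<Rightarrow> bipart \<Rightarrow> bitab \<Rightarrow> (int \<Rightarrow> int) set"
  where "col_stab r l t = {\<sigma> \<in> carrier (hyperoct r).
    (\<forall>j. \<sigma> ` signed (col1 l t j) = signed (col1 l t j)) \<and>
    (\<forall>j. \<sigma> ` col2 l t j = col2 l t j)}"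

definition tabloid :: "nat \<Rightarrow> bipart \<Rightarrow> bitab \<Rightarrow> bitab set"
  where "tabloid r l t = {tab_act t \<sigma> | \<sigma>. \<sigma> \<in> row_stab r l t}"

text \<open>\<open>{t}\<sigma> = {t\<sigma>}\<close> is the elementwise image of the class \<open>{t}\<close> under \<open>\<sigma>\<close>.\<close>

definition tabloid_act :: "bitab set \<Rightarrow> (int \<Rightarrow> int) \<Rightarrow> bitab set"
  where "tabloid_act T \<sigma> = (\<lambda>t. tab_act t \<sigma>) ` T"

definition M_mod :: "nat \<Rightarrow> bipart \<Rightarrow> ((int \<Rightarrow> int) \<Rightarrow> 'k::field, bitab set \<Rightarrow> 'k) module"
  where "M_mod r l = perm_mod (hyperoct r) (tabloid r l ` bitableaux r l) tabloid_act"

definition col_sum :: "nat \<Rightarrow> bipart \<Rightarrow> bitab \<Rightarrow> (int \<Rightarrow> int) \<Rightarrow> 'k::field"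
  where "col_sum r l t = (\<lambda>\<sigma>. if \<sigma> \<in> col_stab r l t then of_int (hsgn r \<sigma>) else 0)"

definition polytabloid :: "nat \<Rightarrow> bipart \<Rightarrow> bitab \<Rightarrow> bitab set \<Rightarrow> 'k::field"
  where "polytabloid r l t =
    col_sum r l t \<odot>\<^bsub>M_mod r l\<^esub> (\<lambda>T. if T = tabloid r l t then 1 else 0)"

definition S_mod :: "nat \<Rightarrow> bipart \<Rightarrow> ((int \<Rightarrow> int) \<Rightarrow> 'k::field, bitab set \<Rightarrow> 'k) module"
  where "S_mod r l = (M_mod r l)
    \<lparr>carrier := {\<lambda>T. \<Sum>t\<in>bitableaux r l. c t * polytabloid r l t T | c. True}\<rparr>"

definition dual_S_mod ::
  "nat \<Rightarrow> bipart \<Rightarrow> ((int \<Rightarrow> int) \<Rightarrow> 'k::field, (bitab set \<Rightarrow> 'k) \<Rightarrow> 'k) module"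
  where "dual_S_mod r l = dual_mod (hyperoct r) (S_mod r l)"

end

theory Submission
  imports Defs
begin

text \<open>
  For the trivial module, \<open>Ext\<^sup>1(k, M)\<close> is the group of derivations \<open>G \<rightarrow> M\<close> modulo the inner ones,
  so the theorem says that every derivation \<open>c\<close> from \<open>W\<^sub>r\<close> to the dual Specht module is inner.
  Evaluated at polytabloids, \<open>c\<close> becomes a family of scalars \<open>\<beta> \<sigma> t = (c \<sigma>\<^sup>-\<^sup>1)(e\<^sub>t)\<close> that satisfies
  \<open>\<beta> (\<sigma>\<tau>) t = \<beta> \<tau> (t\<sigma>) + \<beta> \<sigma> t\<close>, and \<open>c\<close> is inner iff some linear form \<open>m\<close> on the Specht module
  has \<open>\<beta> \<sigma> t = m(e\<^bsub>t\<sigma>\<^esub>) - m(e\<^sub>t)\<close>. Write \<open>N\<close> for the normal subgroup of sign changes.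

  Suppose that the first component of the bi-partition is not empty. In characteristic other than
  2, the order \<open>2\<^sup>r\<close> of \<open>N\<close> is invertible in the field, so averaging over \<open>N\<close> gives an inner
  derivation that agrees with \<open>c\<close> on \<open>N\<close>. After subtracting it, all values of \<open>c\<close> are fixed by \<open>N\<close>.
  Changing the sign of an entry in the first component negates \<open>e\<^sub>t\<close>, so such values are zero
  (\<open>derivation_inner_if_fst_nonempty\<close>).

  Suppose that it is empty. Then \<open>N\<close> acts trivially and \<open>2 c(\<nu>) = c(\<nu>\<^sup>2) = 0\<close> for \<open>\<nu>\<close> in \<open>N\<close>, so that
  everything reduces to the symmetric group \<open>S\<^sub>r\<close> and its classical Specht modules
  (\<open>derivation_inner_if_fst_empty\<close>). A transposition \<open>s\<close> of two entries in one column of \<open>t\<close>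
  negates \<open>e\<^sub>t\<close>, so the value \<open>h t\<close> of \<open>m\<close> at \<open>e\<^sub>t\<close> can only be \<open>- \<beta> s t / 2\<close>. Two such transpositions
  either commute or satisfy the braid relation. In the first case the cocycle identity shows that
  twice the difference of the two candidates for \<open>h t\<close> is zero, in the second case that three
  times the difference is zero; this is where characteristic 3 is excluded. So \<open>h\<close> is well
  defined, and \<open>h (t\<sigma>) = h t + \<beta> \<sigma> t\<close> (\<open>symmetric_group_cocycle_inner\<close>). If no column has two
  boxes, then the Specht module is trivial and \<open>\<beta>\<close> is a homomorphism from a group generated by
  involutions to the additive group of the field, hence zero.

  It remains to see that \<open>h\<close> comes from a linear form, i.e. that it respects the linear relations
  between polytabloids. The value of \<open>h\<close> on a linear relation between polytabloids does not change
  under \<open>S\<^sub>r\<close>, because \<open>\<beta> \<sigma>\<close> is linear in \<open>e\<^sub>t\<close>. A Garnir relation is negated by some transposition,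
  so \<open>h\<close> vanishes on it (\<open>garnir_funI\<close>). Hence \<open>h\<close> is alternating along columns and satisfies the Garnir
  relations. By the straightening algorithm such a function is determined by its values at the
  standard tableaux (\<open>garnir_fun_zero\<close>). The functions that give the coefficient of a fixed tabloid
  in \<open>e\<^sub>t\<close> have the same two properties, and at standard tableaux they form a unitriangular matrix. So
  \<open>h\<close> is a linear combination of them (\<open>garnir_fun_comb_pt_coeff\<close>), which is the required form.
\<close>

section \<open>Right modules and free modules\<close>

locale right_module = R?: ring R + M?: abelian_group M
  for R :: "('a, 'r) ring_scheme" (structure) and M :: "('a, 'm, 's) module_scheme" (structure) +
  assumes smult_closed [simp, intro]: "a \<in> carrier R \<Longrightarrow> x \<in> carrier M \<Longrightarrow> a \<odot>\<^bsub>M\<^esub> x \<in> carrier M"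
    and smult_l_distr: "a \<in> carrier R \<Longrightarrow> b \<in> carrier R \<Longrightarrow> x \<in> carrier M \<Longrightarrow>
      (a \<oplus>\<^bsub>R\<^esub> b) \<odot>\<^bsub>M\<^esub> x = a \<odot>\<^bsub>M\<^esub> x \<oplus>\<^bsub>M\<^esub> b \<odot>\<^bsub>M\<^esub> x"
    and smult_r_distr: "a \<in> carrier R \<Longrightarrow> x \<in> carrier M \<Longrightarrow> y \<in> carrier M \<Longrightarrow>
      a \<odot>\<^bsub>M\<^esub> (x \<oplus>\<^bsub>M\<^esub> y) = a \<odot>\<^bsub>M\<^esub> x \<oplus>\<^bsub>M\<^esub> a \<odot>\<^bsub>M\<^esub> y"
    and smult_assoc: "a \<in> carrier R \<Longrightarrow> b \<in> carrier R \<Longrightarrow> x \<in> carrier M \<Longrightarrow>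
      (a \<otimes>\<^bsub>R\<^esub> b) \<odot>\<^bsub>M\<^esub> x = b \<odot>\<^bsub>M\<^esub> (a \<odot>\<^bsub>M\<^esub> x)"
    and smult_one: "x \<in> carrier M \<Longrightarrow> \<one>\<^bsub>R\<^esub> \<odot>\<^bsub>M\<^esub> x = x"
begin

lemma smult_l_zero [simp]: "x \<in> carrier M \<Longrightarrow> \<zero>\<^bsub>R\<^esub> \<odot>\<^bsub>M\<^esub> x = \<zero>\<^bsub>M\<^esub>"
  using smult_l_distr[of "\<zero>\<^bsub>R\<^esub>" "\<zero>\<^bsub>R\<^esub>" x] by (simp add: M.add.l_cancel_one)

lemma smult_r_zero [simp]: "a \<in> carrier R \<Longrightarrow> a \<odot>\<^bsub>M\<^esub> \<zero>\<^bsub>M\<^esub> = \<zero>\<^bsub>M\<^esub>"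
  using smult_r_distr[of a "\<zero>\<^bsub>M\<^esub>" "\<zero>\<^bsub>M\<^esub>"] by (simp add: M.add.l_cancel_one)

end

text \<open>Module homomorphisms as plain functions, without the extensionality that \<^const>\<open>mod_hom\<close>
  adds.\<close>

definition lin_map ::
  "('a, 'r) ring_scheme \<Rightarrow> ('a, 'm, 's) module_scheme \<Rightarrow> ('a, 'n, 't) module_scheme \<Rightarrow> ('m \<Rightarrow> 'n) \<Rightarrow> bool"
  where "lin_map R M N f \<longleftrightarrow> f \<in> carrier M \<rightarrow> carrier N \<and>
    (\<forall>x\<in>carrier M. \<forall>y\<in>carrier M. f (x \<oplus>\<^bsub>M\<^esub> y) = f x \<oplus>\<^bsub>N\<^esub> f y) \<and>
    (\<forall>a\<in>carrier R. \<forall>x\<in>carrier M. f (a \<odot>\<^bsub>M\<^esub> x) = a \<odot>\<^bsub>N\<^esub> f x)"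

lemma lin_mapI:
  assumes "\<And>x. x \<in> carrier M \<Longrightarrow> f x \<in> carrier N"
    and "\<And>x y. x \<in> carrier M \<Longrightarrow> y \<in> carrier M \<Longrightarrow> f (x \<oplus>\<^bsub>M\<^esub> y) = f x \<oplus>\<^bsub>N\<^esub> f y"
    and "\<And>a x. a \<in> carrier R \<Longrightarrow> x \<in> carrier M \<Longrightarrow> f (a \<odot>\<^bsub>M\<^esub> x) = a \<odot>\<^bsub>N\<^esub> f x"
  shows "lin_map R M N f"
  using assms by (auto simp: lin_map_def)

lemma lin_map_closed: "lin_map R M N f \<Longrightarrow> x \<in> carrier M \<Longrightarrow> f x \<in> carrier N"
  and lin_map_add: "lin_map R M N f \<Longrightarrow> x \<in> carrier M \<Longrightarrow> y \<in> carrier M \<Longrightarrow> f (x \<oplus>\<^bsub>M\<^esub> y) = f x \<oplus>\<^bsub>N\<^esub> f y"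
  and lin_map_smult: "lin_map R M N f \<Longrightarrow> a \<in> carrier R \<Longrightarrow> x \<in> carrier M \<Longrightarrow> f (a \<odot>\<^bsub>M\<^esub> x) = a \<odot>\<^bsub>N\<^esub> f x"
  by (auto simp: lin_map_def)

lemma mod_hom_iff: "f \<in> mod_hom R M N \<longleftrightarrow> lin_map R M N f \<and> f \<in> extensional (carrier M)"
  by (auto simp: mod_hom_def lin_map_def PiE_def)

lemma (in right_module) restrict_mod_hom: "lin_map R M N f \<Longrightarrow> restrict f (carrier M) \<in> mod_hom R M N"
  by (auto simp: mod_hom_iff lin_map_def)

lemma lin_map_zero:
  assumes "right_module R M" "right_module R N" "lin_map R M N f"
  shows "f \<zero>\<^bsub>M\<^esub> = \<zero>\<^bsub>N\<^esub>"
proof -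
  interpret M: right_module R M by fact
  interpret N: right_module R N by fact
  have "f \<zero>\<^bsub>M\<^esub> = f (\<zero>\<^bsub>R\<^esub> \<odot>\<^bsub>M\<^esub> \<zero>\<^bsub>M\<^esub>)" by simp
  also have "\<dots> = \<zero>\<^bsub>R\<^esub> \<odot>\<^bsub>N\<^esub> f \<zero>\<^bsub>M\<^esub>" by (rule lin_map_smult[OF assms(3)]) auto
  also have "\<dots> = \<zero>\<^bsub>N\<^esub>" using lin_map_closed[OF assms(3)] by simp
  finally show ?thesis .
qed

lemma lin_map_minus:
  assumes "right_module R M" "right_module R N" "lin_map R M N f" "x \<in> carrier M"
  shows "f (\<ominus>\<^bsub>M\<^esub> x) = \<ominus>\<^bsub>N\<^esub> f x"
proof -
  interpret M: right_module R M by fact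
  interpret N: right_module R N by fact
  have "f (\<ominus>\<^bsub>M\<^esub> x) \<oplus>\<^bsub>N\<^esub> f x = f (\<ominus>\<^bsub>M\<^esub> x \<oplus>\<^bsub>M\<^esub> x)"
    by (rule lin_map_add[OF assms(3), symmetric]) (use assms in auto)
  also have "\<dots> = \<zero>\<^bsub>N\<^esub>" using lin_map_zero[OF assms(1-3)] assms by (simp add: M.M.l_neg)
  finally show ?thesis
    using lin_map_closed[OF assms(3)] assms by (intro N.M.minus_equality[symmetric]) auto
qed

lemma lin_map_diff:
  assumes "right_module R M" "right_module R N" "lin_map R M N f" "x \<in> carrier M" "y \<in> carrier M"
  shows "f (x \<ominus>\<^bsub>M\<^esub> y) = f x \<ominus>\<^bsub>N\<^esub> f y"
proof -
  interpret M: right_module R M by fact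
  show ?thesis
    unfolding a_minus_def using lin_map_minus[OF assms(1-3,5)] lin_map_add[OF assms(3,4), of "\<ominus>\<^bsub>M\<^esub> y"] assms(5)
    by simp
qed

lemma lin_map_finsum_zero:
  assumes "right_module R M" "right_module R N" "lin_map R M N f" "finite S"
    and "\<And>x. x \<in> S \<Longrightarrow> g x \<in> carrier M" "\<And>x. x \<in> S \<Longrightarrow> f (g x) = \<zero>\<^bsub>N\<^esub>"
  shows "f (\<Oplus>\<^bsub>M\<^esub>x\<in>S. g x) = \<zero>\<^bsub>N\<^esub>"
  using assms(4-)
proof induction
  interpret M: right_module R M by fact
  interpret N: right_module R N by fact
  case empty
  then show ?case using lin_map_zero[OF assms(1-3)] by simp
next
  interpret M: right_module R M by fact
  interpret N: right_module R N by fact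
  case (insert x S)
  have "(\<Oplus>\<^bsub>M\<^esub>x\<in>insert x S. g x) = g x \<oplus>\<^bsub>M\<^esub> (\<Oplus>\<^bsub>M\<^esub>x\<in>S. g x)"
    using insert by (intro M.M.finsum_insert) auto
  moreover have "(\<Oplus>\<^bsub>M\<^esub>x\<in>S. g x) \<in> carrier M" using insert by (intro M.M.finsum_closed) auto
  ultimately show ?case using insert lin_map_add[OF assms(3), of "g x"] by simp
qed

text \<open>Closure under negation need not be assumed, since \<open>- x\<close> is the multiple of \<open>x\<close> by
  \<open>- 1\<close>.\<close>

lemma right_module_submodule:
  assumes "right_module R M" "H \<subseteq> carrier M" "\<zero>\<^bsub>M\<^esub> \<in> H"
    and add: "\<And>x y. x \<in> H \<Longrightarrow> y \<in> H \<Longrightarrow> x \<oplus>\<^bsub>M\<^esub> y \<in> H"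
    and smult: "\<And>a x. a \<in> carrier R \<Longrightarrow> x \<in> H \<Longrightarrow> a \<odot>\<^bsub>M\<^esub> x \<in> H"
  shows "right_module R (M\<lparr>carrier := H\<rparr>)"
proof -
  interpret M: right_module R M by fact
  have [simp]: "x \<in> carrier M" if "x \<in> H" for x using that assms by auto
  have neg: "\<exists>y\<in>H. y \<oplus>\<^bsub>M\<^esub> x = \<zero>\<^bsub>M\<^esub>" if x: "x \<in> H" for x
  proof
    let ?y = "(\<ominus>\<^bsub>R\<^esub> \<one>\<^bsub>R\<^esub>) \<odot>\<^bsub>M\<^esub> x"
    show "?y \<in> H" using x by (intro smult) auto
    have "?y \<oplus>\<^bsub>M\<^esub> x = (\<ominus>\<^bsub>R\<^esub> \<one>\<^bsub>R\<^esub> \<oplus>\<^bsub>R\<^esub> \<one>\<^bsub>R\<^esub>) \<odot>\<^bsub>M\<^esub> x"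
      using x by (simp add: M.smult_l_distr M.smult_one)
    then show "?y \<oplus>\<^bsub>M\<^esub> x = \<zero>\<^bsub>M\<^esub>" using x by (simp add: M.R.l_neg)
  qed
  interpret H: abelian_group "M\<lparr>carrier := H\<rparr>"
    by (rule abelian_groupI) (use assms neg in \<open>auto simp: M.M.a_ac\<close>)
  show ?thesis
    by unfold_locales
      (use smult in \<open>auto simp: M.smult_l_distr M.smult_r_distr M.smult_assoc M.smult_one\<close>)
qed

text \<open>The basis element \<open>[x]\<close> of the free module, multiplied by \<open>a\<close>.\<close>

definition single :: "('a, 'r) ring_scheme \<Rightarrow> 'x \<Rightarrow> 'a \<Rightarrow> 'x \<Rightarrow> 'a"
  where "single R x a = (\<lambda>y. if y = x then a else \<zero>\<^bsub>R\<^esub>)"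

lemma free_mod_simps:
  "carrier (free_mod R B) = {u. (\<forall>x. u x \<in> carrier R) \<and> {x. u x \<noteq> \<zero>\<^bsub>R\<^esub>} \<subseteq> B \<and> finite {x. u x \<noteq> \<zero>\<^bsub>R\<^esub>}}"
  "\<zero>\<^bsub>free_mod R B\<^esub> = (\<lambda>x. \<zero>\<^bsub>R\<^esub>)"
  "u \<oplus>\<^bsub>free_mod R B\<^esub> v = (\<lambda>x. u x \<oplus>\<^bsub>R\<^esub> v x)"
  "a \<odot>\<^bsub>free_mod R B\<^esub> u = (\<lambda>x. u x \<otimes>\<^bsub>R\<^esub> a)"
  by (simp_all add: free_mod_def)

lemma right_module_free_mod:
  assumes "ring R" shows "right_module R (free_mod R B)"
proof -
  interpret R: ring R by fact
  have add: "u \<oplus>\<^bsub>free_mod R B\<^esub> v \<in> carrier (free_mod R B)"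
    if "u \<in> carrier (free_mod R B)" "v \<in> carrier (free_mod R B)" for u v
  proof -
    have "{x. u x \<oplus>\<^bsub>R\<^esub> v x \<noteq> \<zero>\<^bsub>R\<^esub>} \<subseteq> {x. u x \<noteq> \<zero>\<^bsub>R\<^esub>} \<union> {x. v x \<noteq> \<zero>\<^bsub>R\<^esub>}" by auto
    then show ?thesis using that finite_subset by (auto simp: free_mod_simps)
  qed
  have smult: "a \<odot>\<^bsub>free_mod R B\<^esub> u \<in> carrier (free_mod R B)"
    if "u \<in> carrier (free_mod R B)" "a \<in> carrier R" for a u
  proof -
    have "{x. u x \<otimes>\<^bsub>R\<^esub> a \<noteq> \<zero>\<^bsub>R\<^esub>} \<subseteq> {x. u x \<noteq> \<zero>\<^bsub>R\<^esub>}" using that by auto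
    then show ?thesis using that finite_subset by (auto simp: free_mod_simps)
  qed
  have neg: "\<exists>v\<in>carrier (free_mod R B). v \<oplus>\<^bsub>free_mod R B\<^esub> u = \<zero>\<^bsub>free_mod R B\<^esub>"
    if u: "u \<in> carrier (free_mod R B)" for u
  proof
    show "(\<ominus>\<^bsub>R\<^esub> \<one>\<^bsub>R\<^esub>) \<odot>\<^bsub>free_mod R B\<^esub> u \<in> carrier (free_mod R B)" using u by (intro smult) auto
    show "(\<ominus>\<^bsub>R\<^esub> \<one>\<^bsub>R\<^esub>) \<odot>\<^bsub>free_mod R B\<^esub> u \<oplus>\<^bsub>free_mod R B\<^esub> u = \<zero>\<^bsub>free_mod R B\<^esub>"
      using u by (auto simp: free_mod_simps R.r_minus R.l_neg)
  qed
  interpret abelian_group "free_mod R B"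
    by (rule abelian_groupI)
      (use add neg in \<open>auto simp: free_mod_simps R.a_ac\<close>)
  show ?thesis
    by unfold_locales
      (use smult in \<open>auto simp: free_mod_simps R.l_distr R.r_distr R.m_assoc\<close>)
qed

lemma single_in_free_mod:
  assumes "ring R" "x \<in> B" "a \<in> carrier R" shows "single R x a \<in> carrier (free_mod R B)"
proof -
  interpret R: ring R by fact
  have "{y. single R x a y \<noteq> \<zero>\<^bsub>R\<^esub>} \<subseteq> {x}" by (auto simp: single_def)
  then show ?thesis using assms finite_subset by (auto simp: free_mod_simps single_def)
qed

lemma (in right_module) lin_comb_superset:
  assumes "finite S" "{x. u x \<noteq> \<zero>\<^bsub>R\<^esub>} \<subseteq> S" "S \<subseteq> carrier M" "\<And>x. u x \<in> carrier R"
  shows "lin_comb R M u = (\<Oplus>\<^bsub>M\<^esub>x\<in>S. u x \<odot>\<^bsub>M\<^esub> x)"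
  unfolding lin_comb_def
  by (rule M.add.finprod_mono_neutral_cong_left) (use assms in auto)

lemma (in right_module) lin_comb_single:
  assumes "x \<in> carrier M" "a \<in> carrier R" shows "lin_comb R M (single R x a) = a \<odot>\<^bsub>M\<^esub> x"
proof -
  have "lin_comb R M (single R x a) = (\<Oplus>\<^bsub>M\<^esub>y\<in>{x}. single R x a y \<odot>\<^bsub>M\<^esub> y)"
    by (rule lin_comb_superset) (use assms in \<open>auto simp: single_def\<close>)
  also have "\<dots> = a \<odot>\<^bsub>M\<^esub> x" using assms by (simp add: single_def)
  finally show ?thesis .
qed

lemma lin_map_lin_comb:
  assumes "right_module R M" "B \<subseteq> carrier M"
  shows "lin_map R (free_mod R B) M (lin_comb R M)"
proof -
  interpret M: right_module R M by fact
  interpret F: right_module R "free_mod R B" using right_module_free_mod M.R.ring_axioms .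
  have Fu: "u x \<in> carrier R" "finite {x. u x \<noteq> \<zero>\<^bsub>R\<^esub>}" "{x. u x \<noteq> \<zero>\<^bsub>R\<^esub>} \<subseteq> carrier M"
    if "u \<in> carrier (free_mod R B)" for u x
    using that assms by (auto simp: free_mod_simps)
  show ?thesis
  proof (rule lin_mapI)
    fix u assume u: "u \<in> carrier (free_mod R B)"
    show "lin_comb R M u \<in> carrier M"
      unfolding lin_comb_def by (rule M.M.finsum_closed) (use Fu[OF u] in auto)
    fix v assume v: "v \<in> carrier (free_mod R B)"
    let ?S = "{x. u x \<noteq> \<zero>\<^bsub>R\<^esub>} \<union> {x. v x \<noteq> \<zero>\<^bsub>R\<^esub>}"
    have S: "finite ?S" "?S \<subseteq> carrier M" using Fu u v by auto
    have uv: "u \<oplus>\<^bsub>free_mod R B\<^esub> v = (\<lambda>x. u x \<oplus>\<^bsub>R\<^esub> v x)" by (simp add: free_mod_simps)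
    have "lin_comb R M (u \<oplus>\<^bsub>free_mod R B\<^esub> v) = (\<Oplus>\<^bsub>M\<^esub>x\<in>?S. (u x \<oplus>\<^bsub>R\<^esub> v x) \<odot>\<^bsub>M\<^esub> x)"
      unfolding uv by (rule M.lin_comb_superset[OF S(1) _ S(2)]) (use Fu u v in auto)
    also have "\<dots> = (\<Oplus>\<^bsub>M\<^esub>x\<in>?S. u x \<odot>\<^bsub>M\<^esub> x \<oplus>\<^bsub>M\<^esub> v x \<odot>\<^bsub>M\<^esub> x)"
      by (rule M.M.finsum_cong') (use Fu[OF u] Fu[OF v] S in \<open>auto simp: M.smult_l_distr subsetD\<close>)
    also have "\<dots> = (\<Oplus>\<^bsub>M\<^esub>x\<in>?S. u x \<odot>\<^bsub>M\<^esub> x) \<oplus>\<^bsub>M\<^esub> (\<Oplus>\<^bsub>M\<^esub>x\<in>?S. v x \<odot>\<^bsub>M\<^esub> x)"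
      by (rule M.M.finsum_addf) (use Fu[OF u] Fu[OF v] S in auto)
    also have "(\<Oplus>\<^bsub>M\<^esub>x\<in>?S. u x \<odot>\<^bsub>M\<^esub> x) = lin_comb R M u"
      by (rule M.lin_comb_superset[symmetric, OF S(1) _ S(2)]) (use Fu[OF u] in auto)
    also have "(\<Oplus>\<^bsub>M\<^esub>x\<in>?S. v x \<odot>\<^bsub>M\<^esub> x) = lin_comb R M v"
      by (rule M.lin_comb_superset[symmetric, OF S(1) _ S(2)]) (use Fu[OF v] in auto)
    finally show "lin_comb R M (u \<oplus>\<^bsub>free_mod R B\<^esub> v) = lin_comb R M u \<oplus>\<^bsub>M\<^esub> lin_comb R M v" .
  next
    fix a u assume a: "a \<in> carrier R" and u: "u \<in> carrier (free_mod R B)"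
    let ?S = "{x. u x \<noteq> \<zero>\<^bsub>R\<^esub>}"
    have au: "a \<odot>\<^bsub>free_mod R B\<^esub> u = (\<lambda>x. u x \<otimes>\<^bsub>R\<^esub> a)" by (simp add: free_mod_simps)
    have hom: "(\<Oplus>\<^bsub>M\<^esub>x\<in>S. a \<odot>\<^bsub>M\<^esub> g x) = a \<odot>\<^bsub>M\<^esub> (\<Oplus>\<^bsub>M\<^esub>x\<in>S. g x)"
      if "finite S" "g \<in> S \<rightarrow> carrier M" for S and g :: "'c \<Rightarrow> 'c"
      using that
    proof induction
      case (insert x S)
      then have g: "g x \<in> carrier M" "g \<in> S \<rightarrow> carrier M" by auto
      then have cl: "(\<Oplus>\<^bsub>M\<^esub>x\<in>S. g x) \<in> carrier M" by (intro M.M.finsum_closed)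
      have "(\<Oplus>\<^bsub>M\<^esub>x\<in>insert x S. g x) = g x \<oplus>\<^bsub>M\<^esub> (\<Oplus>\<^bsub>M\<^esub>x\<in>S. g x)"
        using insert g by (intro M.M.finsum_insert) auto
      moreover have "(\<Oplus>\<^bsub>M\<^esub>x\<in>insert x S. a \<odot>\<^bsub>M\<^esub> g x) = a \<odot>\<^bsub>M\<^esub> g x \<oplus>\<^bsub>M\<^esub> (\<Oplus>\<^bsub>M\<^esub>x\<in>S. a \<odot>\<^bsub>M\<^esub> g x)"
        using insert g a by (intro M.M.finsum_insert) auto
      ultimately show ?case using insert.IH g a cl by (simp add: M.smult_r_distr)
    qed (use a in simp)
    have "lin_comb R M (a \<odot>\<^bsub>free_mod R B\<^esub> u) = (\<Oplus>\<^bsub>M\<^esub>x\<in>?S. (u x \<otimes>\<^bsub>R\<^esub> a) \<odot>\<^bsub>M\<^esub> x)"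
      unfolding au by (rule M.lin_comb_superset[OF Fu(2)[OF u] _ Fu(3)[OF u]]) (use Fu(1)[OF u] a in auto)
    also have "\<dots> = (\<Oplus>\<^bsub>M\<^esub>x\<in>?S. a \<odot>\<^bsub>M\<^esub> (u x \<odot>\<^bsub>M\<^esub> x))"
      by (rule M.M.finsum_cong') (use Fu[OF u] a in \<open>auto simp: M.smult_assoc subsetD\<close>)
    also have "\<dots> = a \<odot>\<^bsub>M\<^esub> lin_comb R M u"
      unfolding lin_comb_def by (rule hom) (use Fu[OF u] in auto)
    finally show "lin_comb R M (a \<odot>\<^bsub>free_mod R B\<^esub> u) = a \<odot>\<^bsub>M\<^esub> lin_comb R M u" .
  qed
qed

text \<open>This gives \<open>d d = 0\<close> in the canonical resolution: each term is free on the kernel of the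
  preceding map, so that this map kills the generators.\<close>

lemma lin_map_kills_lin_comb:
  assumes "right_module R M" "right_module R N" "lin_map R M N f" "B \<subseteq> carrier M"
    and "u \<in> carrier (free_mod R B)" "\<And>x. x \<in> B \<Longrightarrow> f x = \<zero>\<^bsub>N\<^esub>"
  shows "f (lin_comb R M u) = \<zero>\<^bsub>N\<^esub>"
proof -
  interpret M: right_module R M by fact
  interpret N: right_module R N by fact
  have u: "u x \<in> carrier R" "finite {x. u x \<noteq> \<zero>\<^bsub>R\<^esub>}" "{x. u x \<noteq> \<zero>\<^bsub>R\<^esub>} \<subseteq> B" for x
    using assms(5) by (auto simp: free_mod_simps)
  show ?thesis
    unfolding lin_comb_def
  proof (rule lin_map_finsum_zero[OF assms(1-3) u(2)])
    fix x assume "x \<in> {x. u x \<noteq> \<zero>\<^bsub>R\<^esub>}"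
    then have x: "x \<in> B" "x \<in> carrier M" using u(3) assms(4) by auto
    show "u x \<odot>\<^bsub>M\<^esub> x \<in> carrier M" using x u(1) by simp
    show "f (u x \<odot>\<^bsub>M\<^esub> x) = \<zero>\<^bsub>N\<^esub>"
      using lin_map_smult[OF assms(3) u(1) x(2)] assms(6)[OF x(1)] u(1) by simp
  qed
qed

section \<open>The first extension group\<close>

text \<open>A cocycle \<open>f\<close> on \<open>P\<^sub>1\<close> kills the kernel of \<open>P\<^sub>1 \<rightarrow> P\<^sub>0\<close>, because this kernel consists of
  images of generators of \<open>P\<^sub>2\<close>. So \<open>f\<close> factors through a homomorphism \<open>\<phi>\<close> on the kernel \<open>K\<close>
  of \<open>P\<^sub>0 \<rightarrow> N\<close>, and a homomorphism on \<open>P\<^sub>0\<close> that extends \<open>\<phi>\<close> shows that \<open>f\<close> is a coboundary.\<close>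

theorem trivial_Ext1_if_relations_extend:
  assumes N: "right_module R N" and M: "right_module R M"
    and ext: "\<And>\<phi>. lin_map R ((res0 R N)\<lparr>carrier := relations R N (carrier N)\<rparr>) M \<phi> \<Longrightarrow>
      \<exists>g. lin_map R (res0 R N) M g \<and> (\<forall>k\<in>relations R N (carrier N). g k = \<phi> k)"
  shows "trivial_group (Ext1 R N M)"
proof -
  interpret N: right_module R N by fact
  interpret M: right_module R M by fact
  let ?K = "relations R N (carrier N)"
  let ?P0 = "res0 R N" and ?P1 = "res1 R N" and ?P2 = "res2 R N"
  let ?d0 = "lin_comb R N" and ?d1 = "lin_comb R ?P0" and ?d2 = "lin_comb R ?P1"
  let ?Z = "ext1_cocycles R N M" and ?B = "ext1_coboundaries R N M"
  have R: "ring R" by (rule N.R.ring_axioms)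
  have P: "right_module R ?P0" "right_module R ?P1" "right_module R ?P2"
    using right_module_free_mod[OF R] by (auto simp: res0_def res1_def res2_def)
  interpret P0: right_module R ?P0 by (rule P)
  interpret P1: right_module R ?P1 by (rule P)
  have K: "?K \<subseteq> carrier ?P0" by (auto simp: relations_def res0_def)
  have KK: "relations R ?P0 ?K \<subseteq> carrier ?P1" by (auto simp: relations_def res1_def)
  have d0: "lin_map R ?P0 N ?d0" unfolding res0_def by (rule lin_map_lin_comb[OF N]) simp
  have d1: "lin_map R ?P1 ?P0 ?d1" unfolding res1_def by (rule lin_map_lin_comb[OF P(1) K])
  have d2: "lin_map R ?P2 ?P1 ?d2" unfolding res2_def by (rule lin_map_lin_comb[OF P(2) KK])
  have d1K: "?d1 w \<in> ?K" if w: "w \<in> carrier ?P1" for w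
  proof -
    have "?d0 (?d1 w) = \<zero>\<^bsub>N\<^esub>"
      by (rule lin_map_kills_lin_comb[OF P(1) N d0 K]) (use w in \<open>auto simp: res1_def relations_def\<close>)
    then show ?thesis using lin_map_closed[OF d1 w] by (simp add: relations_def res0_def)
  qed
  have d1d2: "?d1 (?d2 w) = \<zero>\<^bsub>?P0\<^esub>" if w: "w \<in> carrier ?P2" for w
    by (rule lin_map_kills_lin_comb[OF P(2) P(1) d1 KK]) (use w in \<open>auto simp: res2_def relations_def\<close>)
  have single1: "single R k \<one>\<^bsub>R\<^esub> \<in> carrier ?P1" "?d1 (single R k \<one>\<^bsub>R\<^esub>) = k" if k: "k \<in> ?K" for k
    using single_in_free_mod[OF R k N.R.one_closed] P0.lin_comb_single[of k "\<one>\<^bsub>R\<^esub>"] k K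
    by (auto simp: res1_def P0.smult_one subsetD)
  have K_sub: "right_module R (?P0\<lparr>carrier := ?K\<rparr>)"
  proof (rule right_module_submodule[OF P(1) K])
    have mem: "k \<in> ?K \<longleftrightarrow> k \<in> carrier ?P0 \<and> ?d0 k = \<zero>\<^bsub>N\<^esub>" for k
      by (auto simp: relations_def res0_def)
    show "\<zero>\<^bsub>?P0\<^esub> \<in> ?K" unfolding mem using lin_map_zero[OF P(1) N d0] by simp
    show "x \<oplus>\<^bsub>?P0\<^esub> y \<in> ?K" if "x \<in> ?K" "y \<in> ?K" for x y
      using that unfolding mem by (simp add: lin_map_add[OF d0])
    show "a \<odot>\<^bsub>?P0\<^esub> x \<in> ?K" if "a \<in> carrier R" "x \<in> ?K" for a x
      using that unfolding mem by (simp add: lin_map_smult[OF d0])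
  qed
  interpret KM: right_module R "?P0\<lparr>carrier := ?K\<rparr>" by (rule K_sub)
  have BZ: "?B \<subseteq> ?Z"
  proof
    fix f assume "f \<in> ?B"
    then obtain g where g: "lin_map R ?P0 M g" and f: "f = restrict (\<lambda>w. g (?d1 w)) (carrier ?P1)"
      by (auto simp: ext1_coboundaries_def mod_hom_iff)
    have "lin_map R ?P1 M (\<lambda>w. g (?d1 w))"
      by (rule lin_mapI)
        (simp_all add: lin_map_closed[OF g] lin_map_closed[OF d1] lin_map_add[OF d1] lin_map_add[OF g]
          lin_map_smult[OF d1] lin_map_smult[OF g])
    then have "f \<in> mod_hom R ?P1 M" unfolding f by (rule P1.restrict_mod_hom)
    moreover have "f (?d2 w) = \<zero>\<^bsub>M\<^esub>" if "w \<in> carrier ?P2" for w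
      using that lin_map_closed[OF d2 that] d1d2 lin_map_zero[OF P(1) M g] by (simp add: f)
    ultimately show "f \<in> ?Z" by (simp add: ext1_cocycles_def)
  qed
  moreover have "?Z \<subseteq> ?B"
  proof
    fix f assume f: "f \<in> ?Z"
    then have fl: "lin_map R ?P1 M f" and fe: "f \<in> extensional (carrier ?P1)"
      by (auto simp: ext1_cocycles_def mod_hom_iff)
    have kill: "f w = \<zero>\<^bsub>M\<^esub>" if w: "w \<in> carrier ?P1" "?d1 w = \<zero>\<^bsub>?P0\<^esub>" for w
    proof -
      have wr: "w \<in> relations R ?P0 ?K" using w by (simp add: relations_def res1_def)
      have "single R w \<one>\<^bsub>R\<^esub> \<in> carrier ?P2"
        unfolding res2_def by (rule single_in_free_mod[OF R wr]) simp
      moreover have "?d2 (single R w \<one>\<^bsub>R\<^esub>) = w" using P1.lin_comb_single[OF w(1)] w by (simp add: P1.smult_one)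
      ultimately show ?thesis using f unfolding ext1_cocycles_def by force
    qed
    have fcong: "f w = f w'" if w: "w \<in> carrier ?P1" "w' \<in> carrier ?P1" "?d1 w = ?d1 w'" for w w'
    proof -
      have "f w \<ominus>\<^bsub>M\<^esub> f w' = f (w \<ominus>\<^bsub>?P1\<^esub> w')" using lin_map_diff[OF P(2) M fl w(1,2)] by simp
      also have "\<dots> = \<zero>\<^bsub>M\<^esub>"
        by (rule kill) (use w lin_map_diff[OF P(2) P(1) d1 w(1,2)] lin_map_closed[OF d1] in
            \<open>auto simp: P0.M.r_neg a_minus_def\<close>)
      finally have "f w \<oplus>\<^bsub>M\<^esub> \<ominus>\<^bsub>M\<^esub> f w' = \<zero>\<^bsub>M\<^esub>" by (simp add: a_minus_def)
      then show ?thesis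
        using M.M.minus_equality[of "f w" "\<ominus>\<^bsub>M\<^esub> f w'"] lin_map_closed[OF fl] w(1,2) by simp
    qed
    (* w and [d w] have the same image in P0, so f w is determined by the element d w of the kernel *)
    define \<phi> where "\<phi> k = f (single R k \<one>\<^bsub>R\<^esub>)" for k
    have "lin_map R (?P0\<lparr>carrier := ?K\<rparr>) M \<phi>"
    proof (rule lin_mapI, goal_cases)
      case (1 x)
      then show ?case using single1 lin_map_closed[OF fl] by (simp add: \<phi>_def)
    next
      case (2 x y)
      then have xy: "x \<in> ?K" "y \<in> ?K" "x \<oplus>\<^bsub>?P0\<^esub> y \<in> ?K" using KM.M.add.m_closed by auto
      show ?case
        unfolding \<phi>_def lin_map_add[OF fl single1(1)[OF xy(1)] single1(1)[OF xy(2)], symmetric]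
        by (rule fcong) (use xy single1 in \<open>auto simp: lin_map_add[OF d1]\<close>)
    next
      case (3 a x)
      then have xy: "x \<in> ?K" "a \<odot>\<^bsub>?P0\<^esub> x \<in> ?K" using KM.smult_closed by auto
      show ?case
        unfolding \<phi>_def lin_map_smult[OF fl 3(1) single1(1)[OF xy(1)], symmetric]
        by (rule fcong) (use 3 xy single1 in \<open>auto simp: lin_map_smult[OF d1]\<close>)
    qed
    then obtain g where g: "lin_map R ?P0 M g" and gk: "\<And>k. k \<in> ?K \<Longrightarrow> g k = \<phi> k" using ext by blast
    have "f = (\<lambda>w\<in>carrier ?P1. restrict g (carrier ?P0) (?d1 w))"
    proof
      fix w
      show "f w = (\<lambda>w\<in>carrier ?P1. restrict g (carrier ?P0) (?d1 w)) w"
      proof (cases "w \<in> carrier ?P1")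
        case True
        have "f w = \<phi> (?d1 w)"
          unfolding \<phi>_def by (rule fcong) (use True d1K single1 in auto)
        then show ?thesis using True d1K[OF True] gk K by auto
      qed (use fe in \<open>simp add: extensional_def\<close>)
    qed
    then show "f \<in> ?B" unfolding ext1_coboundaries_def using P0.restrict_mod_hom[OF g] by blast
  qed
  ultimately have ZB: "?B = ?Z" by blast
  let ?H = "(Hom R ?P1 M)\<lparr>carrier := ?Z\<rparr>"
  have Hmult: "f \<otimes>\<^bsub>?H\<^esub> g = (\<lambda>x\<in>carrier ?P1. f x \<oplus>\<^bsub>M\<^esub> g x)" for f g by (simp add: Hom_def)
  have Hone: "\<one>\<^bsub>?H\<^esub> = (\<lambda>x\<in>carrier ?P1. \<zero>\<^bsub>M\<^esub>)" by (simp add: Hom_def)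
  have Zl: "lin_map R ?P1 M f" and Z0: "w \<in> carrier ?P2 \<Longrightarrow> f (?d2 w) = \<zero>\<^bsub>M\<^esub>" if "f \<in> ?Z" for f w
    using that by (auto simp: ext1_cocycles_def mod_hom_iff)
  have Zv: "f x \<in> carrier M" if "f \<in> ?Z" "x \<in> carrier ?P1" for f x
    using lin_map_closed[OF Zl[OF that(1)] that(2)] .
  have Ze: "f \<in> extensional (carrier ?P1)" if "f \<in> ?Z" for f
    using that by (auto simp: ext1_cocycles_def mod_hom_iff)
  have ZI: "restrict F (carrier ?P1) \<in> ?Z"
    if "lin_map R ?P1 M F" "\<And>w. w \<in> carrier ?P2 \<Longrightarrow> F (?d2 w) = \<zero>\<^bsub>M\<^esub>" for F
    using that P1.restrict_mod_hom lin_map_closed[OF d2] by (auto simp: ext1_cocycles_def)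
  have "group ?H"
  proof (rule groupI)
    show "f \<otimes>\<^bsub>?H\<^esub> g \<in> carrier ?H" if "f \<in> carrier ?H" "g \<in> carrier ?H" for f g
    proof -
      have fg: "f \<in> ?Z" "g \<in> ?Z" using that by auto
      have "lin_map R ?P1 M (\<lambda>x. f x \<oplus>\<^bsub>M\<^esub> g x)"
        by (rule lin_mapI)
          (use fg Zv in \<open>simp_all add: lin_map_add[OF Zl] lin_map_smult[OF Zl] M.smult_r_distr
            M.M.a_ac\<close>)
      then have "(\<lambda>x\<in>carrier ?P1. f x \<oplus>\<^bsub>M\<^esub> g x) \<in> ?Z"
        by (rule ZI) (simp add: Z0[OF fg(1)] Z0[OF fg(2)])
      then show ?thesis unfolding Hmult by simp
    qed
    show "\<one>\<^bsub>?H\<^esub> \<in> carrier ?H"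
      unfolding Hone using ZI[of "\<lambda>_. \<zero>\<^bsub>M\<^esub>"] by (simp add: lin_map_def)
    show "f \<otimes>\<^bsub>?H\<^esub> g \<otimes>\<^bsub>?H\<^esub> h = f \<otimes>\<^bsub>?H\<^esub> (g \<otimes>\<^bsub>?H\<^esub> h)"
      if "f \<in> carrier ?H" "g \<in> carrier ?H" "h \<in> carrier ?H" for f g h
      unfolding Hmult by (rule restrict_ext) (use that Zv in \<open>simp add: M.M.a_assoc\<close>)
    show "\<one>\<^bsub>?H\<^esub> \<otimes>\<^bsub>?H\<^esub> f = f" if "f \<in> carrier ?H" for f
      unfolding Hmult Hone using that Zv[of f] Ze[of f] by (intro extensionalityI[where A = "carrier ?P1"]) auto
    show "\<exists>g\<in>carrier ?H. g \<otimes>\<^bsub>?H\<^esub> f = \<one>\<^bsub>?H\<^esub>" if "f \<in> carrier ?H" for f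
    proof
      have f: "f \<in> ?Z" using that by simp
      have "lin_map R ?P1 M (\<lambda>x. (\<ominus>\<^bsub>M\<^esub> f x))"
      proof (rule lin_mapI)
        fix a x assume ax: "a \<in> carrier R" "x \<in> carrier ?P1"
        have "\<ominus>\<^bsub>M\<^esub> f (a \<odot>\<^bsub>?P1\<^esub> x) = f (\<ominus>\<^bsub>?P1\<^esub> (a \<odot>\<^bsub>?P1\<^esub> x))"
          using lin_map_minus[OF P(2) M Zl[OF f]] ax by simp
        also have "\<ominus>\<^bsub>?P1\<^esub> (a \<odot>\<^bsub>?P1\<^esub> x) = a \<odot>\<^bsub>?P1\<^esub> (\<ominus>\<^bsub>?P1\<^esub> x)"
        proof (rule P1.M.minus_equality)
          show "a \<odot>\<^bsub>?P1\<^esub> (\<ominus>\<^bsub>?P1\<^esub> x) \<oplus>\<^bsub>?P1\<^esub> a \<odot>\<^bsub>?P1\<^esub> x = \<zero>\<^bsub>?P1\<^esub>"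
            using ax by (simp add: P1.smult_r_distr[symmetric] P1.M.l_neg)
        qed (use ax in auto)
        also have "f \<dots> = a \<odot>\<^bsub>M\<^esub> (\<ominus>\<^bsub>M\<^esub> f x)"
          using lin_map_smult[OF Zl[OF f] ax(1), of "\<ominus>\<^bsub>?P1\<^esub> x"] lin_map_minus[OF P(2) M Zl[OF f] ax(2)] ax by simp
        finally show "\<ominus>\<^bsub>M\<^esub> f (a \<odot>\<^bsub>?P1\<^esub> x) = a \<odot>\<^bsub>M\<^esub> (\<ominus>\<^bsub>M\<^esub> f x)" .
      qed (use Zv[OF f] in \<open>auto simp: lin_map_add[OF Zl[OF f]] M.M.minus_add\<close>)
      then have "(\<lambda>x\<in>carrier ?P1. \<ominus>\<^bsub>M\<^esub> f x) \<in> ?Z" by (rule ZI) (simp add: Z0[OF f])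
      then show "(\<lambda>x\<in>carrier ?P1. \<ominus>\<^bsub>M\<^esub> f x) \<in> carrier ?H" by simp
      show "(\<lambda>x\<in>carrier ?P1. \<ominus>\<^bsub>M\<^esub> f x) \<otimes>\<^bsub>?H\<^esub> f = \<one>\<^bsub>?H\<^esub>"
        unfolding Hmult Hone by (rule restrict_ext) (use Zv[OF f] in \<open>simp add: M.M.l_neg\<close>)
    qed
  qed
  then interpret H: group ?H .
  have "?Z \<lhd> ?H" using H.normal_self by simp
  then have "group (?H Mod ?Z)" by (rule normal.factorgroup_is_group)
  moreover have "carrier (?H Mod ?Z) = {?Z}"
  proof -
    have "?Z #>\<^bsub>?H\<^esub> f = ?Z" if "f \<in> ?Z" for f
      using H.coset_join2[OF _ H.subgroup_self, of f] that by simp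
    moreover have "\<one>\<^bsub>?H\<^esub> \<in> ?Z" using H.one_closed by simp
    ultimately show ?thesis by (auto simp: carrier_FactGroup)
  qed
  ultimately show ?thesis by (simp add: trivial_group_def Ext1_def ZB)
qed

section \<open>Modules over the group algebra of a finite group\<close>

lemma sum_delta_pair:
  assumes "finite S" "a \<in> S" shows "(\<Sum>x\<in>S. (if x = a then 1 else 0) * f x) = (f a :: 'k::field)"
proof -
  have "(\<Sum>x\<in>S. (if x = a then 1 else 0) * f x) = (\<Sum>x\<in>S. if x = a then f x else 0)"
    by (rule sum.cong) auto
  then show ?thesis using assms by simp
qed

text \<open>The associativity of the group algebra and of its action on permutation modules reduces
  to this: to sum \<open>F\<close> against the push-forward of the weights \<open>w\<close> along \<open>f\<close> is to sum \<open>F \<circ> f\<close>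
  against \<open>w\<close>.\<close>

lemma sum_fibres:
  assumes "finite S" "\<And>i. i \<in> I \<Longrightarrow> f i \<in> S"
  shows "(\<Sum>y\<in>S. (\<Sum>i\<in>I. if f i = y then w i else 0) * F y) = (\<Sum>i\<in>I. w i * (F (f i) :: 'k::field))"
proof -
  have "(\<Sum>y\<in>S. (\<Sum>i\<in>I. if f i = y then w i else 0) * F y) = (\<Sum>i\<in>I. \<Sum>y\<in>S. if f i = y then w i * F y else 0)"
    unfolding sum_distrib_right by (subst sum.swap) (intro sum.cong; auto)
  also have "\<dots> = (\<Sum>i\<in>I. w i * F (f i))"
    by (rule sum.cong) (use assms in simp_all)
  finally show ?thesis .
qed

definition grp_elem :: "'g \<Rightarrow> 'g \<Rightarrow> 'k::field"
  where "grp_elem g = (\<lambda>x. if x = g then 1 else 0)"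

locale finite_group = group G for G :: "('g, 'b) monoid_scheme" (structure) +
  assumes fin: "finite (carrier G)"
begin

abbreviation KG :: "('g \<Rightarrow> 'k::field) ring" where "KG \<equiv> group_algebra G"

lemma KG_carrier: "a \<in> carrier KG \<longleftrightarrow> (\<forall>g. g \<notin> carrier G \<longrightarrow> a g = 0)"
  unfolding group_algebra_def using fin by (auto intro: finite_subset)

lemma KG_zero: "\<zero>\<^bsub>KG\<^esub> = (\<lambda>x. 0)"
  and KG_add: "a \<oplus>\<^bsub>KG\<^esub> b = (\<lambda>x. a x + b x)"
  and KG_one: "\<one>\<^bsub>KG\<^esub> = grp_elem \<one>"
  by (simp_all add: group_algebra_def grp_elem_def)

lemma KG_mult:
  assumes "a \<in> carrier KG" "b \<in> carrier KG"
  shows "(a \<otimes>\<^bsub>KG\<^esub> b) x = (\<Sum>(g, h)\<in>carrier G \<times> carrier G. if g \<otimes> h = x then a g * b h else 0)"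
proof -
  have "(a \<otimes>\<^bsub>KG\<^esub> b) x = (\<Sum>(g, h)\<in>{(g, h). a g \<noteq> 0 \<and> b h \<noteq> 0 \<and> g \<otimes> h = x}. a g * b h)"
    by (simp add: group_algebra_def)
  also have "\<dots> = (\<Sum>(g, h)\<in>carrier G \<times> carrier G. if g \<otimes> h = x then a g * b h else 0)"
    by (rule sum.mono_neutral_cong_left)
      (use fin assms in \<open>auto simp: KG_carrier split: if_splits\<close>)
  finally show ?thesis .
qed

lemma KG_mult_sum:
  assumes "a \<in> carrier KG" "b \<in> carrier KG"
  shows "(\<Sum>x\<in>carrier G. (a \<otimes>\<^bsub>KG\<^esub> b) x * F x) = (\<Sum>(g, h)\<in>carrier G \<times> carrier G. a g * b h * F (g \<otimes> h))"
proof -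
  have "(\<Sum>x\<in>carrier G. (a \<otimes>\<^bsub>KG\<^esub> b) x * F x) =
    (\<Sum>x\<in>carrier G. (\<Sum>i\<in>carrier G \<times> carrier G. if fst i \<otimes> snd i = x then a (fst i) * b (snd i) else 0) * F x)"
    by (simp add: KG_mult[OF assms] case_prod_unfold)
  also have "\<dots> = (\<Sum>i\<in>carrier G \<times> carrier G. a (fst i) * b (snd i) * F (fst i \<otimes> snd i))"
    by (rule sum_fibres) (use fin in auto)
  finally show ?thesis by (simp add: case_prod_unfold)
qed

lemma KG_mult_closed:
  assumes "a \<in> carrier KG" "b \<in> carrier KG" shows "a \<otimes>\<^bsub>KG\<^esub> b \<in> carrier KG"
  unfolding KG_carrier
proof (intro allI impI)
  fix x assume "x \<notin> carrier G"
  then show "(a \<otimes>\<^bsub>KG\<^esub> b) x = 0" unfolding KG_mult[OF assms] by (intro sum.neutral) auto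
qed

lemma grp_elem_closed [simp]: "g \<in> carrier G \<Longrightarrow> grp_elem g \<in> carrier KG"
  by (auto simp: KG_carrier grp_elem_def)

lemma scalar_closed [simp]: "scalar G c \<in> carrier KG"
  by (auto simp: KG_carrier scalar_def)

lemma KG_mult_elem:
  assumes a: "a \<in> carrier KG" and h: "h \<in> carrier G"
  shows "a \<otimes>\<^bsub>KG\<^esub> grp_elem h = (\<lambda>x. if x \<in> carrier G then a (x \<otimes> inv h) else 0)"
proof
  fix x
  have "(a \<otimes>\<^bsub>KG\<^esub> grp_elem h) x = (\<Sum>g\<in>carrier G. \<Sum>k\<in>carrier G. if g \<otimes> k = x then a g * grp_elem h k else 0)"
    by (simp add: KG_mult[OF a grp_elem_closed[OF h]] sum.cartesian_product)
  also have "\<dots> = (\<Sum>g\<in>carrier G. \<Sum>k\<in>carrier G. if k = h then (if g \<otimes> h = x then a g else 0) else 0)"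
    by (intro sum.cong) (auto simp: grp_elem_def)
  also have "\<dots> = (\<Sum>g\<in>carrier G. if g \<otimes> h = x then a g else 0)" using fin h by simp
  also have "\<dots> = (\<Sum>g\<in>carrier G. if x \<in> carrier G \<and> g = x \<otimes> inv h then a g else 0)"
  proof (rule sum.cong)
    fix g assume g: "g \<in> carrier G"
    have "g \<otimes> h = x \<longleftrightarrow> x \<in> carrier G \<and> g = x \<otimes> inv h" using g h by (auto simp: m_assoc)
    then show "(if g \<otimes> h = x then a g else 0) = (if x \<in> carrier G \<and> g = x \<otimes> inv h then a g else 0)" by simp
  qed simp
  also have "\<dots> = (if x \<in> carrier G then a (x \<otimes> inv h) else 0)" using fin h by simp
  finally show "(a \<otimes>\<^bsub>KG\<^esub> grp_elem h) x = (if x \<in> carrier G then a (x \<otimes> inv h) else 0)" .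
qed

lemma KG_mult_scalar:
  assumes a: "a \<in> carrier KG"
  shows "a \<otimes>\<^bsub>KG\<^esub> scalar G c = (\<lambda>x. a x * c)" "scalar G c \<otimes>\<^bsub>KG\<^esub> a = (\<lambda>x. a x * c)"
proof -
  have *: "a x = 0" if "x \<notin> carrier G" for x using a that by (simp add: KG_carrier)
  show "a \<otimes>\<^bsub>KG\<^esub> scalar G c = (\<lambda>x. a x * c)"
  proof
    fix x
    have "(a \<otimes>\<^bsub>KG\<^esub> scalar G c) x = (\<Sum>g\<in>carrier G. \<Sum>k\<in>carrier G. if g \<otimes> k = x then a g * scalar G c k else 0)"
      by (simp add: KG_mult[OF a scalar_closed] sum.cartesian_product)
    also have "\<dots> = (\<Sum>g\<in>carrier G. \<Sum>k\<in>carrier G. if k = \<one> then (if g = x then a g * c else 0) else 0)"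
      by (intro sum.cong) (auto simp: scalar_def)
    also have "\<dots> = a x * c" using fin * by simp
    finally show "(a \<otimes>\<^bsub>KG\<^esub> scalar G c) x = a x * c" .
  qed
  show "scalar G c \<otimes>\<^bsub>KG\<^esub> a = (\<lambda>x. a x * c)"
  proof
    fix x
    have "(scalar G c \<otimes>\<^bsub>KG\<^esub> a) x = (\<Sum>g\<in>carrier G. \<Sum>k\<in>carrier G. if g \<otimes> k = x then scalar G c g * a k else 0)"
      by (simp add: KG_mult[OF scalar_closed a] sum.cartesian_product)
    also have "\<dots> = (\<Sum>g\<in>carrier G. if g = \<one> then (\<Sum>k\<in>carrier G. if k = x then a k * c else 0) else 0)"
      by (intro sum.cong) (auto simp: scalar_def intro!: sum.cong sum.neutral)
    also have "\<dots> = a x * c" using fin * by simp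
    finally show "(scalar G c \<otimes>\<^bsub>KG\<^esub> a) x = a x * c" .
  qed
qed

lemma scalar_one: "scalar G 1 = \<one>\<^bsub>KG\<^esub>"
  by (simp add: scalar_def KG_one grp_elem_def)

lemma KG_assoc:
  assumes "a \<in> carrier KG" "b \<in> carrier KG" "c \<in> carrier KG"
  shows "a \<otimes>\<^bsub>KG\<^esub> b \<otimes>\<^bsub>KG\<^esub> c = a \<otimes>\<^bsub>KG\<^esub> (b \<otimes>\<^bsub>KG\<^esub> c)"
proof
  fix x
  let ?G = "carrier G"
  note ab = KG_mult_closed[OF assms(1,2)] and bc = KG_mult_closed[OF assms(2,3)]
  have "(a \<otimes>\<^bsub>KG\<^esub> b \<otimes>\<^bsub>KG\<^esub> c) x = (\<Sum>p\<in>?G. (a \<otimes>\<^bsub>KG\<^esub> b) p * (\<Sum>k\<in>?G. if p \<otimes> k = x then c k else 0))"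
    by (simp add: KG_mult[OF ab assms(3)] sum.cartesian_product[symmetric] sum_distrib_left if_distrib cong: if_cong)
  also have "\<dots> = (\<Sum>(g, h)\<in>?G \<times> ?G. a g * b h * (\<Sum>k\<in>?G. if g \<otimes> h \<otimes> k = x then c k else 0))"
    by (rule KG_mult_sum[OF assms(1,2)])
  also have "\<dots> = (\<Sum>g\<in>?G. \<Sum>h\<in>?G. \<Sum>k\<in>?G. if g \<otimes> h \<otimes> k = x then a g * b h * c k else 0)"
    unfolding sum.cartesian_product[symmetric] sum_distrib_left by (intro sum.cong) auto
  also have "\<dots> = (\<Sum>g\<in>?G. \<Sum>h\<in>?G. \<Sum>k\<in>?G. a g * (b h * c k * (if g \<otimes> (h \<otimes> k) = x then 1 else 0)))"
    by (intro sum.cong) (auto simp: m_assoc)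
  also have "\<dots> = (\<Sum>g\<in>?G. a g * (\<Sum>q\<in>?G. (b \<otimes>\<^bsub>KG\<^esub> c) q * (if g \<otimes> q = x then 1 else 0)))"
    unfolding KG_mult_sum[OF assms(2,3)] sum.cartesian_product[symmetric] sum_distrib_left ..
  also have "\<dots> = (a \<otimes>\<^bsub>KG\<^esub> (b \<otimes>\<^bsub>KG\<^esub> c)) x"
    unfolding KG_mult[OF assms(1) bc] sum.cartesian_product[symmetric] sum_distrib_left
    by (intro sum.cong) auto
  finally show "(a \<otimes>\<^bsub>KG\<^esub> b \<otimes>\<^bsub>KG\<^esub> c) x = (a \<otimes>\<^bsub>KG\<^esub> (b \<otimes>\<^bsub>KG\<^esub> c)) x" .
qed

lemma ring_KG: "ring (KG :: ('g \<Rightarrow> 'k::field) ring)"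
proof (rule ringI)
  show "abelian_group (KG :: ('g \<Rightarrow> 'k) ring)"
  proof (rule abelian_groupI)
    fix a :: "'g \<Rightarrow> 'k" assume "a \<in> carrier KG"
    then show "\<exists>b\<in>carrier KG. b \<oplus>\<^bsub>KG\<^esub> a = \<zero>\<^bsub>KG\<^esub>"
      by (intro bexI[of _ "\<lambda>x. - a x"]) (auto simp: KG_carrier KG_add KG_zero)
  qed (auto simp: KG_carrier KG_add KG_zero add.assoc add.commute)
  show "monoid (KG :: ('g \<Rightarrow> 'k) ring)"
  proof (rule monoidI)
    show "\<one>\<^bsub>KG\<^esub> \<otimes>\<^bsub>KG\<^esub> a = a" "a \<otimes>\<^bsub>KG\<^esub> \<one>\<^bsub>KG\<^esub> = a" if "a \<in> carrier KG" for a :: "'g \<Rightarrow> 'k"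
      using KG_mult_scalar[OF that, of 1] by (simp_all add: scalar_one)
  qed (auto simp: KG_mult_closed KG_assoc KG_one)
  fix a b c :: "'g \<Rightarrow> 'k" assume abc: "a \<in> carrier KG" "b \<in> carrier KG" "c \<in> carrier KG"
  have add: "p \<oplus>\<^bsub>KG\<^esub> q \<in> carrier KG" if "p \<in> carrier KG" "q \<in> carrier KG" for p q :: "'g \<Rightarrow> 'k"
    using that by (simp add: KG_carrier KG_add)
  show "(a \<oplus>\<^bsub>KG\<^esub> b) \<otimes>\<^bsub>KG\<^esub> c = a \<otimes>\<^bsub>KG\<^esub> c \<oplus>\<^bsub>KG\<^esub> b \<otimes>\<^bsub>KG\<^esub> c"
    unfolding KG_add[of "a \<otimes>\<^bsub>KG\<^esub> c"]
    by (rule ext) (simp add: KG_mult abc add[OF abc(1,2)] sum.distrib[symmetric] case_prod_unfold,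
      intro sum.cong, auto simp: KG_add algebra_simps)
  show "c \<otimes>\<^bsub>KG\<^esub> (a \<oplus>\<^bsub>KG\<^esub> b) = c \<otimes>\<^bsub>KG\<^esub> a \<oplus>\<^bsub>KG\<^esub> c \<otimes>\<^bsub>KG\<^esub> b"
    unfolding KG_add[of "c \<otimes>\<^bsub>KG\<^esub> a"]
    by (rule ext) (simp add: KG_mult abc add[OF abc(1,2)] sum.distrib[symmetric] case_prod_unfold,
      intro sum.cong, auto simp: KG_add algebra_simps)
qed

text \<open>The augmentation, through which the group algebra acts on the trivial module.\<close>

lemma aug_supp: "a \<in> carrier KG \<Longrightarrow> (\<Sum>g\<in>{g. a g \<noteq> 0}. a g) = (\<Sum>g\<in>carrier G. a g)"
  using fin by (intro sum.mono_neutral_left) (auto simp: KG_carrier)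

lemma right_module_trivial: "right_module KG (trivial_mod :: ('g \<Rightarrow> 'k::field, 'k) module)"
proof -
  let ?T = "trivial_mod :: ('g \<Rightarrow> 'k, 'k) module"
  interpret R: ring "KG :: ('g \<Rightarrow> 'k) ring" by (rule ring_KG)
  interpret abelian_group ?T
    by (rule abelian_groupI) (auto simp: trivial_mod_def add.assoc add.commute intro: exI[of _ "- x" for x])
  show ?thesis
  proof unfold_locales
    fix a b :: "'g \<Rightarrow> 'k" and x y :: 'k assume ab: "a \<in> carrier KG" "b \<in> carrier KG"
    show "(a \<oplus>\<^bsub>KG\<^esub> b) \<odot>\<^bsub>?T\<^esub> x = a \<odot>\<^bsub>?T\<^esub> x \<oplus>\<^bsub>?T\<^esub> b \<odot>\<^bsub>?T\<^esub> x"
      using aug_supp[OF ab(1)] aug_supp[OF ab(2)] aug_supp[OF R.a_closed[OF ab]]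
      by (simp add: trivial_mod_def KG_add sum.distrib algebra_simps)
    have "(\<Sum>g\<in>carrier G. (a \<otimes>\<^bsub>KG\<^esub> b) g) = (\<Sum>g\<in>carrier G. a g) * (\<Sum>g\<in>carrier G. b g)"
      using KG_mult_sum[OF ab, of "\<lambda>_. 1"] by (simp add: sum_product sum.cartesian_product)
    then show "(a \<otimes>\<^bsub>KG\<^esub> b) \<odot>\<^bsub>?T\<^esub> x = b \<odot>\<^bsub>?T\<^esub> (a \<odot>\<^bsub>?T\<^esub> x)"
      using aug_supp[OF ab(1)] aug_supp[OF ab(2)] aug_supp[OF R.m_closed[OF ab]]
      by (simp add: trivial_mod_def)
  next
    fix x :: 'k
    show "\<one>\<^bsub>KG\<^esub> \<odot>\<^bsub>?T\<^esub> x = x"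
      by (simp add: trivial_mod_def KG_one grp_elem_def)
  qed (auto simp: trivial_mod_def algebra_simps)
qed

lemma perm_mod_smult:
  assumes B: "finite B" and a: "a \<in> carrier KG" and v: "v \<in> carrier (perm_mod G B act)"
  shows "(a \<odot>\<^bsub>perm_mod G B act\<^esub> v) y = (\<Sum>(x, g)\<in>B \<times> carrier G. if act x g = y then v x * a g else 0)"
proof -
  have "(a \<odot>\<^bsub>perm_mod G B act\<^esub> v) y = (\<Sum>(x, g)\<in>{(x, g). v x \<noteq> 0 \<and> a g \<noteq> 0 \<and> act x g = y}. v x * a g)"
    by (simp add: perm_mod_def)
  also have "\<dots> = (\<Sum>(x, g)\<in>B \<times> carrier G. if act x g = y then v x * a g else 0)"
    by (rule sum.mono_neutral_cong_left)
      (use fin B a v in \<open>auto simp: KG_carrier perm_mod_def split: if_splits\<close>)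
  finally show ?thesis .
qed

lemma perm_mod_carrier: "finite B \<Longrightarrow> v \<in> carrier (perm_mod G B act) \<longleftrightarrow> (\<forall>x. x \<notin> B \<longrightarrow> v x = 0)"
  unfolding perm_mod_def by (auto intro: finite_subset)

lemma perm_mod_simps:
  "\<zero>\<^bsub>perm_mod G B act\<^esub> = (\<lambda>x. 0)" "v \<oplus>\<^bsub>perm_mod G B act\<^esub> w = (\<lambda>x. v x + w x)"
  by (simp_all add: perm_mod_def)

lemma right_module_perm_mod:
  assumes B: "finite B"
    and act: "\<And>x g. x \<in> B \<Longrightarrow> g \<in> carrier G \<Longrightarrow> act x g \<in> B"
    and act_mult: "\<And>x g h. x \<in> B \<Longrightarrow> g \<in> carrier G \<Longrightarrow> h \<in> carrier G \<Longrightarrow> act x (g \<otimes> h) = act (act x g) h"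
    and act_one: "\<And>x. x \<in> B \<Longrightarrow> act x \<one> = x"
  shows "right_module KG (perm_mod G B act :: ('g \<Rightarrow> 'k::field, 'x \<Rightarrow> 'k) module)"
proof -
  let ?P = "perm_mod G B act :: ('g \<Rightarrow> 'k, 'x \<Rightarrow> 'k) module"
  interpret R: ring "KG :: ('g \<Rightarrow> 'k) ring" by (rule ring_KG)
  note car = perm_mod_carrier[OF B]
  interpret abelian_group ?P
  proof (rule abelian_groupI)
    fix v assume "v \<in> carrier ?P"
    then show "\<exists>w\<in>carrier ?P. w \<oplus>\<^bsub>?P\<^esub> v = \<zero>\<^bsub>?P\<^esub>"
      by (intro bexI[of _ "\<lambda>x. - v x"]) (auto simp: car perm_mod_simps)
  qed (auto simp: car perm_mod_simps add.assoc add.commute)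
  note sm = perm_mod_smult[OF B]
  have closed: "a \<odot>\<^bsub>?P\<^esub> v \<in> carrier ?P" if "a \<in> carrier KG" "v \<in> carrier ?P" for a v
    unfolding car using that act by (auto simp: sm intro!: sum.neutral)
  show ?thesis
  proof unfold_locales
    fix a b :: "'g \<Rightarrow> 'k" and v assume ab: "a \<in> carrier KG" "b \<in> carrier KG" and v: "v \<in> carrier ?P"
    show "(a \<oplus>\<^bsub>KG\<^esub> b) \<odot>\<^bsub>?P\<^esub> v = a \<odot>\<^bsub>?P\<^esub> v \<oplus>\<^bsub>?P\<^esub> b \<odot>\<^bsub>?P\<^esub> v"
      unfolding perm_mod_simps
      by (rule ext) (simp add: sm[OF R.a_closed[OF ab] v] sm[OF ab(1) v] sm[OF ab(2) v]
        sum.distrib[symmetric] case_prod_unfold, intro sum.cong, auto simp: KG_add algebra_simps)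
    show "(a \<otimes>\<^bsub>KG\<^esub> b) \<odot>\<^bsub>?P\<^esub> v = b \<odot>\<^bsub>?P\<^esub> (a \<odot>\<^bsub>?P\<^esub> v)"
    proof
      fix y
      let ?G = "carrier G"
      have "((a \<otimes>\<^bsub>KG\<^esub> b) \<odot>\<^bsub>?P\<^esub> v) y = (\<Sum>x\<in>B. v x * (\<Sum>p\<in>?G. (a \<otimes>\<^bsub>KG\<^esub> b) p * (if act x p = y then 1 else 0)))"
        unfolding sm[OF R.m_closed[OF ab] v] sum.cartesian_product[symmetric] sum_distrib_left
        by (intro sum.cong) auto
      also have "\<dots> = (\<Sum>x\<in>B. \<Sum>g\<in>?G. \<Sum>h\<in>?G. v x * (a g * b h * (if act x (g \<otimes> h) = y then 1 else 0)))"
        unfolding KG_mult_sum[OF ab] sum.cartesian_product[symmetric] sum_distrib_left ..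
      also have "\<dots> = (\<Sum>x\<in>B. \<Sum>g\<in>?G. v x * a g * (\<Sum>h\<in>?G. if act (act x g) h = y then b h else 0))"
        unfolding sum_distrib_left by (intro sum.cong) (auto simp: act_mult)
      also have "\<dots> = (\<Sum>i\<in>B \<times> ?G. v (fst i) * a (snd i) *
          (\<Sum>h\<in>?G. if act (act (fst i) (snd i)) h = y then b h else 0))"
        by (simp add: sum.cartesian_product case_prod_unfold)
      also have "\<dots> = (\<Sum>z\<in>B. (\<Sum>i\<in>B \<times> ?G. if act (fst i) (snd i) = z then v (fst i) * a (snd i) else 0) *
          (\<Sum>h\<in>?G. if act z h = y then b h else 0))"
        by (rule sum_fibres[symmetric]) (use B act in auto)
      also have "\<dots> = (\<Sum>z\<in>B. (a \<odot>\<^bsub>?P\<^esub> v) z * (\<Sum>h\<in>?G. if act z h = y then b h else 0))"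
        by (simp add: sm[OF ab(1) v] case_prod_unfold)
      also have "\<dots> = (b \<odot>\<^bsub>?P\<^esub> (a \<odot>\<^bsub>?P\<^esub> v)) y"
        unfolding sm[OF ab(2) closed[OF ab(1) v]] sum.cartesian_product[symmetric] sum_distrib_left
        by (intro sum.cong) auto
      finally show "((a \<otimes>\<^bsub>KG\<^esub> b) \<odot>\<^bsub>?P\<^esub> v) y = (b \<odot>\<^bsub>?P\<^esub> (a \<odot>\<^bsub>?P\<^esub> v)) y" .
    qed
  next
    fix a :: "'g \<Rightarrow> 'k" and v w assume a: "a \<in> carrier KG" and vw: "v \<in> carrier ?P" "w \<in> carrier ?P"
    show "a \<odot>\<^bsub>?P\<^esub> (v \<oplus>\<^bsub>?P\<^esub> w) = a \<odot>\<^bsub>?P\<^esub> v \<oplus>\<^bsub>?P\<^esub> a \<odot>\<^bsub>?P\<^esub> w"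
      unfolding perm_mod_simps(2)[of B act "a \<odot>\<^bsub>?P\<^esub> v"]
      by (rule ext) (simp add: sm[OF a add.m_closed[OF vw]] sm[OF a vw(1)] sm[OF a vw(2)]
        sum.distrib[symmetric] case_prod_unfold, intro sum.cong, auto simp: perm_mod_simps algebra_simps)
  next
    fix v assume v: "v \<in> carrier ?P"
    show "\<one>\<^bsub>KG\<^esub> \<odot>\<^bsub>?P\<^esub> v = v"
    proof
      fix y
      have "(\<one>\<^bsub>KG\<^esub> \<odot>\<^bsub>?P\<^esub> v) y = (\<Sum>x\<in>B. \<Sum>g\<in>carrier G. if g = \<one> then if x = y then v x else 0 else 0)"
        unfolding sm[OF R.one_closed v] sum.cartesian_product[symmetric]
        by (intro sum.cong) (auto simp: KG_one grp_elem_def act_one)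
      also have "\<dots> = v y" using fin B v by (simp add: car)
      finally show "(\<one>\<^bsub>KG\<^esub> \<odot>\<^bsub>?P\<^esub> v) y = v y" .
    qed
  qed (rule closed)
qed

lemma perm_mod_elem:
  assumes B: "finite B" and v: "v \<in> carrier (perm_mod G B act)" and g: "g \<in> carrier G"
  shows "(grp_elem g \<odot>\<^bsub>perm_mod G B act\<^esub> v) y = (\<Sum>x\<in>{x\<in>B. act x g = y}. v x)"
proof -
  have "(grp_elem g \<odot>\<^bsub>perm_mod G B act\<^esub> v) y =
      (\<Sum>x\<in>B. \<Sum>h\<in>carrier G. if h = g then if act x g = y then v x else 0 else 0)"
    unfolding perm_mod_smult[OF B grp_elem_closed[OF g] v] sum.cartesian_product[symmetric]
    by (intro sum.cong) (auto simp: grp_elem_def)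
  also have "\<dots> = (\<Sum>x\<in>{x\<in>B. act x g = y}. v x)" using fin g B by (simp add: sum.inter_filter)
  finally show ?thesis .
qed

lemma perm_mod_smult_elems:
  assumes B: "finite B" and a: "a \<in> carrier KG" and v: "v \<in> carrier (perm_mod G B act)"
  shows "a \<odot>\<^bsub>perm_mod G B act\<^esub> v = (\<lambda>y. \<Sum>g\<in>carrier G. a g * (grp_elem g \<odot>\<^bsub>perm_mod G B act\<^esub> v) y)"
proof
  fix y
  have "(a \<odot>\<^bsub>perm_mod G B act\<^esub> v) y = (\<Sum>g\<in>carrier G. \<Sum>x\<in>B. if act x g = y then v x * a g else 0)"
    unfolding perm_mod_smult[OF assms] sum.cartesian_product[symmetric] by (rule sum.swap)
  also have "\<dots> = (\<Sum>g\<in>carrier G. a g * (\<Sum>x\<in>{x\<in>B. act x g = y}. v x))"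
    unfolding sum_distrib_left sum.inter_filter[OF B] by (intro sum.cong refl) (auto simp: mult.commute)
  finally show "(a \<odot>\<^bsub>perm_mod G B act\<^esub> v) y = (\<Sum>g\<in>carrier G. a g * (grp_elem g \<odot>\<^bsub>perm_mod G B act\<^esub> v) y)"
    by (simp add: perm_mod_elem[OF B v])
qed

lemma perm_mod_scalar:
  assumes B: "finite B" and v: "v \<in> carrier (perm_mod G B act)" and act_one: "\<And>x. x \<in> B \<Longrightarrow> act x \<one> = x"
  shows "scalar G c \<odot>\<^bsub>perm_mod G B act\<^esub> v = (\<lambda>y. c * v y)"
proof
  fix y
  have "(scalar G c \<odot>\<^bsub>perm_mod G B act\<^esub> v) y = (\<Sum>g\<in>carrier G. if g = \<one> then c * (\<Sum>x\<in>{x\<in>B. act x g = y}. v x) else 0)"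
    unfolding perm_mod_smult_elems[OF B scalar_closed v]
    by (rule sum.cong) (auto simp: perm_mod_elem[OF B v] scalar_def)
  also have "\<dots> = c * (\<Sum>x\<in>{x\<in>B. x = y}. v x)"
    using fin act_one by (simp cong: conj_cong)
  also have "(\<Sum>x\<in>{x\<in>B. x = y}. v x) = v y"
    using v by (cases "y \<in> B") (auto simp: perm_mod_carrier[OF B] cong: conj_cong)
  finally show "(scalar G c \<odot>\<^bsub>perm_mod G B act\<^esub> v) y = c * v y" .
qed

lemma antipode_closed: "antipode G a \<in> carrier KG"
  by (simp add: KG_carrier antipode_def)

lemma antipode_elem: "g \<in> carrier G \<Longrightarrow> antipode G (grp_elem g) = grp_elem (inv g)"
  by (auto simp: antipode_def grp_elem_def fun_eq_iff)

text \<open>Inversion is an anti-automorphism, which makes the dual of a right module a right module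
  again.\<close>

lemma antipode_mult:
  assumes ab: "a \<in> carrier KG" "b \<in> carrier KG"
  shows "antipode G (a \<otimes>\<^bsub>KG\<^esub> b) = antipode G b \<otimes>\<^bsub>KG\<^esub> antipode G a"
proof
  fix x
  show "antipode G (a \<otimes>\<^bsub>KG\<^esub> b) x = (antipode G b \<otimes>\<^bsub>KG\<^esub> antipode G a) x"
  proof (cases "x \<in> carrier G")
    case True
    have "g \<otimes> h = inv x \<longleftrightarrow> inv h \<otimes> inv g = x" if "g \<in> carrier G" "h \<in> carrier G" for g h
      using that True by (metis inv_inv inv_mult_group m_closed)
    then have "antipode G (a \<otimes>\<^bsub>KG\<^esub> b) x =
      (\<Sum>(g, h)\<in>carrier G \<times> carrier G. if inv h \<otimes> inv g = x then a g * b h else 0)"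
      using True by (auto simp: antipode_def KG_mult[OF ab] intro!: sum.cong)
    also have "\<dots> = (\<Sum>(p, q)\<in>carrier G \<times> carrier G. if p \<otimes> q = x then a (inv q) * b (inv p) else 0)"
      by (rule sum.reindex_bij_witness[of _ "\<lambda>(p, q). (inv q, inv p)" "\<lambda>(g, h). (inv h, inv g)"]) auto
    also have "\<dots> = (antipode G b \<otimes>\<^bsub>KG\<^esub> antipode G a) x"
      unfolding KG_mult[OF antipode_closed antipode_closed]
      by (rule sum.cong) (auto simp: antipode_def)
    finally show ?thesis .
  next
    case False
    then show ?thesis
      using KG_mult_closed[OF antipode_closed antipode_closed, of b a] by (simp add: antipode_def KG_carrier)
  qed
qed

lemma dual_mod_simps:
  "carrier (dual_mod G M) = {\<phi> \<in> extensional (carrier M).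
       (\<forall>x\<in>carrier M. \<forall>y\<in>carrier M. \<phi> (x \<oplus>\<^bsub>M\<^esub> y) = \<phi> x + \<phi> y) \<and>
       (\<forall>c. \<forall>x\<in>carrier M. \<phi> (scalar G c \<odot>\<^bsub>M\<^esub> x) = c * \<phi> x)}"
  "\<zero>\<^bsub>dual_mod G M\<^esub> = (\<lambda>x\<in>carrier M. 0)"
  "\<phi> \<oplus>\<^bsub>dual_mod G M\<^esub> \<psi> = (\<lambda>x\<in>carrier M. \<phi> x + \<psi> x)"
  "a \<odot>\<^bsub>dual_mod G M\<^esub> \<phi> = (\<lambda>x\<in>carrier M. \<phi> (antipode G a \<odot>\<^bsub>M\<^esub> x))"
  by (simp_all add: dual_mod_def)

lemma right_module_dual_mod:
  fixes M :: "('g \<Rightarrow> 'k::field, 'm, 's) module_scheme"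
  assumes M: "right_module KG M" shows "right_module KG (dual_mod G M)"
proof -
  interpret M: right_module KG M by (rule M)
  let ?D = "dual_mod G M"
  interpret abelian_group ?D
  proof (rule abelian_groupI)
    fix \<phi> assume "\<phi> \<in> carrier ?D"
    then show "\<exists>\<psi>\<in>carrier ?D. \<psi> \<oplus>\<^bsub>?D\<^esub> \<phi> = \<zero>\<^bsub>?D\<^esub>"
      by (intro bexI[of _ "\<lambda>x\<in>carrier M. - \<phi> x"]) (auto simp: dual_mod_simps)
  qed (auto simp: dual_mod_simps fun_eq_iff extensional_def algebra_simps)
  have anti_scalar: "antipode G a \<odot>\<^bsub>M\<^esub> (scalar G c \<odot>\<^bsub>M\<^esub> x) = scalar G c \<odot>\<^bsub>M\<^esub> (antipode G a \<odot>\<^bsub>M\<^esub> x)"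
    if "x \<in> carrier M" for a c x
    using that KG_mult_scalar[OF antipode_closed[of a], of c]
    by (metis M.smult_assoc antipode_closed scalar_closed)
  have anti_add: "antipode G (a \<oplus>\<^bsub>KG\<^esub> b) = antipode G a \<oplus>\<^bsub>KG\<^esub> antipode G b" for a b :: "'g \<Rightarrow> 'k"
    by (auto simp: antipode_def KG_add)
  have closed: "antipode G a \<odot>\<^bsub>M\<^esub> x \<in> carrier M" if "x \<in> carrier M" for a x
    using that antipode_closed by (intro M.smult_closed)
  show ?thesis
  proof unfold_locales
    fix a b :: "'g \<Rightarrow> 'k" and \<phi> assume ab: "a \<in> carrier KG" "b \<in> carrier KG" and p: "\<phi> \<in> carrier ?D"
    show "a \<odot>\<^bsub>?D\<^esub> \<phi> \<in> carrier ?D"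
      using p closed by (auto simp: dual_mod_simps M.smult_r_distr antipode_closed anti_scalar)
    show "(a \<oplus>\<^bsub>KG\<^esub> b) \<odot>\<^bsub>?D\<^esub> \<phi> = a \<odot>\<^bsub>?D\<^esub> \<phi> \<oplus>\<^bsub>?D\<^esub> b \<odot>\<^bsub>?D\<^esub> \<phi>"
      using p closed by (auto simp: dual_mod_simps anti_add M.smult_l_distr antipode_closed)
    show "(a \<otimes>\<^bsub>KG\<^esub> b) \<odot>\<^bsub>?D\<^esub> \<phi> = b \<odot>\<^bsub>?D\<^esub> (a \<odot>\<^bsub>?D\<^esub> \<phi>)"
      using closed by (auto simp: dual_mod_simps antipode_mult[OF ab] M.smult_assoc antipode_closed)
  next
    fix \<phi> assume p: "\<phi> \<in> carrier ?D"
    have "antipode G \<one>\<^bsub>KG\<^esub> = (\<one>\<^bsub>KG\<^esub> :: 'g \<Rightarrow> 'k)" unfolding KG_one by (simp add: antipode_elem)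
    then show "\<one>\<^bsub>KG\<^esub> \<odot>\<^bsub>?D\<^esub> \<phi> = \<phi>"
      using p by (auto simp: dual_mod_simps M.smult_one extensional_def)
  qed (use closed in \<open>auto simp: dual_mod_simps\<close>)
qed

end

section \<open>Extensions of the trivial module and derivations\<close>

context finite_group
begin

lemma finsum_trivial:
  "finite S \<Longrightarrow> (\<Oplus>\<^bsub>(trivial_mod :: ('g \<Rightarrow> 'k::field, 'k) module)\<^esub>x\<in>S. f x) = (\<Sum>x\<in>S. f x)"
proof (induction rule: finite_induct)
  interpret right_module KG "trivial_mod :: ('g \<Rightarrow> 'k, 'k) module" by (rule right_module_trivial)
  case empty
  show ?case by (simp only: M.finsum_empty sum.empty) (simp add: trivial_mod_def)
next
  interpret right_module KG "trivial_mod :: ('g \<Rightarrow> 'k, 'k) module" by (rule right_module_trivial)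
  case (insert x S)
  have "(\<Oplus>\<^bsub>(trivial_mod :: ('g \<Rightarrow> 'k, 'k) module)\<^esub>x\<in>insert x S. f x) =
      f x \<oplus>\<^bsub>(trivial_mod :: ('g \<Rightarrow> 'k, 'k) module)\<^esub> (\<Oplus>\<^bsub>(trivial_mod :: ('g \<Rightarrow> 'k, 'k) module)\<^esub>x\<in>S. f x)"
    using insert by (intro M.finsum_insert) (auto simp: trivial_mod_def)
  then show ?case using insert by (simp add: trivial_mod_def)
qed

text \<open>Write \<open>[x]\<close> for the basis elements of the free module \<open>P\<close> on the field, \<open>K\<close> for the
  kernel of \<open>P \<rightarrow> k\<close>, and \<open>\<phi>\<close> for a homomorphism on \<open>K\<close>. The elements \<open>[1](g - 1)\<close> lie in \<open>K\<close>,
  and their images under \<open>\<phi>\<close> form a derivation. If it is inner, given by \<open>m\<close>, then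
  \<open>\<phi>([1] v) = m v\<close> for all \<open>v\<close> of augmentation zero, because the elements \<open>g - 1\<close> span these
  \<open>v\<close>. Let \<open>s\<close> be the homomorphism from \<open>P\<close> to the group algebra that sends \<open>[x]\<close> to the
  scalar \<open>x\<close>. Each \<open>u\<close> in \<open>P\<close> is the sum of \<open>u - [1] s(u)\<close>, which lies in \<open>K\<close>, and \<open>[1] s(u)\<close>;
  so \<open>u \<mapsto> \<phi>(u - [1] s(u)) + m s(u)\<close> extends \<open>\<phi>\<close>.\<close>

theorem trivial_Ext1_if_derivations_inner:
  fixes M :: "('g \<Rightarrow> 'k::field, 'm, 's) module_scheme"
  assumes M: "right_module KG M"
    and inner: "\<And>c. (\<And>g. g \<in> carrier G \<Longrightarrow> c g \<in> carrier M) \<Longrightarrow>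
      (\<And>g h. g \<in> carrier G \<Longrightarrow> h \<in> carrier G \<Longrightarrow> c (g \<otimes> h) = grp_elem h \<odot>\<^bsub>M\<^esub> c g \<oplus>\<^bsub>M\<^esub> c h) \<Longrightarrow>
      \<exists>m\<in>carrier M. \<forall>g\<in>carrier G. c g = grp_elem g \<odot>\<^bsub>M\<^esub> m \<ominus>\<^bsub>M\<^esub> m"
  shows "trivial_group (Ext1 (KG :: ('g \<Rightarrow> 'k) ring) trivial_mod M)"
proof (rule trivial_Ext1_if_relations_extend[OF right_module_trivial M])
  let ?T = "trivial_mod :: ('g \<Rightarrow> 'k, 'k) module"
  let ?R = "KG :: ('g \<Rightarrow> 'k) ring"
  let ?P = "res0 ?R ?T" and ?K = "relations ?R ?T (carrier ?T)"
  fix \<phi> assume \<phi>: "lin_map ?R (?P\<lparr>carrier := ?K\<rparr>) M \<phi>"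
  interpret KR: ring ?R by (rule ring_KG)
  interpret M: right_module ?R M by (rule M)
  interpret T: right_module ?R ?T by (rule right_module_trivial)
  have P: "right_module ?R ?P" unfolding res0_def by (rule right_module_free_mod[OF ring_KG])
  interpret P: right_module ?R ?P by (rule P)
  define aug where "aug a = (\<Sum>g\<in>carrier G. a g)" for a :: "'g \<Rightarrow> 'k"
  have T_smult: "a \<odot>\<^bsub>?T\<^esub> x = x * aug a" if "a \<in> carrier ?R" for a x
    using aug_supp[OF that] by (simp add: trivial_mod_def aug_def)
  have T_add: "x \<oplus>\<^bsub>?T\<^esub> y = x + y" and T_zero: "\<zero>\<^bsub>?T\<^esub> = 0" and T_car: "carrier ?T = UNIV" for x y
    by (simp_all add: trivial_mod_def)
  have P_mem: "u \<in> carrier ?P \<longleftrightarrow> (\<forall>c. u c \<in> carrier ?R) \<and> finite {c. u c \<noteq> (\<lambda>x. 0)}" for u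
    by (simp add: res0_def free_mod_simps KG_zero T_car)
  have P_add: "u \<oplus>\<^bsub>?P\<^esub> v = (\<lambda>c x. u c x + v c x)" for u v
    by (simp add: res0_def free_mod_simps KG_add)
  have P_smult: "a \<odot>\<^bsub>?P\<^esub> u = (\<lambda>c. u c \<otimes>\<^bsub>?R\<^esub> a)" for u a
    by (simp add: res0_def free_mod_simps)
  let ?d = "lin_comb ?R ?T"
  have d: "lin_map ?R ?P ?T ?d" unfolding res0_def by (rule lin_map_lin_comb[OF right_module_trivial]) simp
  have K_mem: "u \<in> ?K \<longleftrightarrow> u \<in> carrier ?P \<and> ?d u = 0" for u
    by (simp add: relations_def res0_def T_zero)
  have d_eq: "?d u = (\<Sum>c\<in>{c. u c \<noteq> (\<lambda>x. 0)}. c * aug (u c))" if "u \<in> carrier ?P" for u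
    using that unfolding lin_comb_def KG_zero by (subst finsum_trivial) (auto simp: P_mem T_smult)
  have \<phi>_closed: "\<phi> u \<in> carrier M" if "u \<in> ?K" for u using lin_map_closed[OF \<phi>] that by simp
  have \<phi>_add: "\<phi> (u \<oplus>\<^bsub>?P\<^esub> v) = \<phi> u \<oplus>\<^bsub>M\<^esub> \<phi> v" if "u \<in> ?K" "v \<in> ?K" for u v
    using lin_map_add[OF \<phi>] that by simp
  have \<phi>_smult: "\<phi> (a \<odot>\<^bsub>?P\<^esub> u) = a \<odot>\<^bsub>M\<^esub> \<phi> u" if "a \<in> carrier ?R" "u \<in> ?K" for a u
    using lin_map_smult[OF \<phi>] that by simp
  define one where "one v = (\<lambda>c::'k. if c = 1 then v else (\<lambda>x::'g. 0::'k))" for v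
  have one_P: "one v \<in> carrier ?P" if "v \<in> carrier ?R" for v
  proof -
    have "{c. one v c \<noteq> (\<lambda>x. 0)} \<subseteq> {1}" by (auto simp: one_def)
    then show ?thesis using that finite_subset unfolding P_mem by (auto simp: one_def KG_carrier)
  qed
  have d_one: "?d (one v) = aug v" if v: "v \<in> carrier ?R" for v
  proof -
    have "one v = single ?R 1 v" by (simp add: one_def single_def KG_zero fun_eq_iff)
    then show ?thesis using T.lin_comb_single[of 1 v] v by (simp add: T_car T_smult)
  qed
  have one_K: "one v \<in> ?K" if "v \<in> carrier ?R" "aug v = 0" for v
    using that one_P d_one by (simp add: K_mem)
  have one_add: "one v \<oplus>\<^bsub>?P\<^esub> one w = one (v \<oplus>\<^bsub>?R\<^esub> w)" for v w
    by (auto simp: P_add one_def KG_add fun_eq_iff)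
  have one_smult: "a \<odot>\<^bsub>?P\<^esub> one v = one (v \<otimes>\<^bsub>?R\<^esub> a)" if "a \<in> carrier ?R" for a v
    using KR.l_null[OF that] by (auto simp: P_smult one_def KG_zero fun_eq_iff)
  define \<delta> where "\<delta> g = (\<lambda>x. grp_elem g x - grp_elem \<one> x :: 'k)" for g
  have \<delta>: "\<delta> g \<in> carrier ?R" "aug (\<delta> g) = 0" if "g \<in> carrier G" for g
    using that fin by (auto simp: \<delta>_def aug_def KG_carrier grp_elem_def sum_subtractf)
  have \<delta>_add: "grp_elem g = \<delta> g \<oplus>\<^bsub>?R\<^esub> \<one>\<^bsub>?R\<^esub>" for g
    by (simp add: \<delta>_def KG_add KG_one fun_eq_iff)
  have elem_mult: "grp_elem g \<otimes>\<^bsub>?R\<^esub> grp_elem h = grp_elem (g \<otimes> h)"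
    if "g \<in> carrier G" "h \<in> carrier G" for g h
    unfolding KG_mult_elem[OF grp_elem_closed[OF that(1)] that(2)]
    using that by (auto simp: fun_eq_iff grp_elem_def m_assoc)
  have \<delta>_mult: "\<delta> (g \<otimes> h) = \<delta> g \<otimes>\<^bsub>?R\<^esub> grp_elem h \<oplus>\<^bsub>?R\<^esub> \<delta> h" if gh: "g \<in> carrier G" "h \<in> carrier G" for g h
  proof -
    have "\<delta> g \<otimes>\<^bsub>?R\<^esub> grp_elem h \<oplus>\<^bsub>?R\<^esub> grp_elem h = grp_elem (g \<otimes> h)"
      using \<delta>[OF gh(1)] gh by (simp add: elem_mult[symmetric] \<delta>_add[of g] KR.l_distr)
    then show ?thesis by (auto simp: \<delta>_def KG_add fun_eq_iff)
  qed
  define c where "c g = \<phi> (one (\<delta> g))" for g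
  have "\<exists>m\<in>carrier M. \<forall>g\<in>carrier G. c g = grp_elem g \<odot>\<^bsub>M\<^esub> m \<ominus>\<^bsub>M\<^esub> m"
  proof (rule inner)
    show "c g \<in> carrier M" if "g \<in> carrier G" for g
      unfolding c_def by (intro \<phi>_closed one_K \<delta> that)
    show "c (g \<otimes> h) = grp_elem h \<odot>\<^bsub>M\<^esub> c g \<oplus>\<^bsub>M\<^esub> c h" if gh: "g \<in> carrier G" "h \<in> carrier G" for g h
    proof -
      have h: "grp_elem h \<in> carrier ?R" using gh by simp
      have k: "one (\<delta> g) \<in> ?K" "one (\<delta> h) \<in> ?K" using one_K \<delta> gh by auto
      have "one (\<delta> g \<otimes>\<^bsub>?R\<^esub> grp_elem h) \<in> ?K"
        unfolding one_smult[OF h, symmetric]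
        using k(1) lin_map_smult[OF d h, of "one (\<delta> g)"] h by (simp add: K_mem T_smult)
      then show ?thesis
        unfolding c_def \<delta>_mult[OF gh] one_add[symmetric]
        using k \<phi>_add \<phi>_smult[OF h k(1)] by (simp add: one_smult[OF h])
    qed
  qed
  then obtain m where m: "m \<in> carrier M" "\<And>g. g \<in> carrier G \<Longrightarrow> c g = grp_elem g \<odot>\<^bsub>M\<^esub> m \<ominus>\<^bsub>M\<^esub> m" by blast
  have \<delta>m: "\<delta> g \<odot>\<^bsub>M\<^esub> m = c g" if g: "g \<in> carrier G" for g
  proof -
    have "grp_elem g \<odot>\<^bsub>M\<^esub> m = \<delta> g \<odot>\<^bsub>M\<^esub> m \<oplus>\<^bsub>M\<^esub> m"
      using m(1) \<delta>(1)[OF g] unfolding \<delta>_add[of g] by (simp add: M.smult_l_distr M.smult_one)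
    then show ?thesis using m(2)[OF g] m(1) \<delta>(1)[OF g] by (simp add: a_minus_def M.M.a_assoc M.M.r_neg)
  qed
  (* subtracting a multiple of g - 1 removes g from the support of v *)
  have \<phi>_one: "\<phi> (one v) = v \<odot>\<^bsub>M\<^esub> m" if "v \<in> carrier ?R" "aug v = 0" for v
    using that
  proof (induction "card {g. g \<noteq> \<one> \<and> v g \<noteq> 0}" arbitrary: v rule: less_induct)
    case less
    note v = less.prems
    have finv: "finite {g. g \<noteq> \<one> \<and> v g \<noteq> 0}"
      by (rule finite_subset[OF _ fin]) (use v in \<open>auto simp: KG_carrier\<close>)
    show ?case
    proof (cases "\<exists>g. g \<noteq> \<one> \<and> v g \<noteq> 0")
      case True
      then obtain g where g: "g \<noteq> \<one>" "v g \<noteq> 0" by blast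
      then have gG: "g \<in> carrier G" using v by (auto simp: KG_carrier)
      define w where "w = (\<lambda>x. v x - \<delta> g x * v g)"
      let ?s = "scalar G (v g)"
      have w: "w \<in> carrier ?R" using v \<delta>[OF gG] by (simp add: w_def KG_carrier)
      have "aug w = aug v - aug (\<delta> g) * v g" by (simp add: aug_def w_def sum_subtractf sum_distrib_right)
      then have w0: "aug w = 0" using v \<delta>[OF gG] by simp
      have "card {x. x \<noteq> \<one> \<and> w x \<noteq> 0} < card {x. x \<noteq> \<one> \<and> v x \<noteq> 0}"
        by (rule psubset_card_mono[OF finv])
          (use g in \<open>auto simp: w_def \<delta>_def grp_elem_def intro!: psubsetI split: if_splits\<close>)
      then have IH: "\<phi> (one w) = w \<odot>\<^bsub>M\<^esub> m" using less.hyps w w0 by blast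
      have v_eq: "v = w \<oplus>\<^bsub>?R\<^esub> \<delta> g \<otimes>\<^bsub>?R\<^esub> ?s"
        by (simp add: KG_mult_scalar[OF \<delta>(1)[OF gG]] KG_add w_def)
      have "\<phi> (one v) = \<phi> (one w) \<oplus>\<^bsub>M\<^esub> \<phi> (?s \<odot>\<^bsub>?P\<^esub> one (\<delta> g))"
      proof -
        have "one (\<delta> g) \<in> ?K" using one_K \<delta>[OF gG] by blast
        then have "?s \<odot>\<^bsub>?P\<^esub> one (\<delta> g) \<in> ?K"
          using lin_map_smult[OF d scalar_closed, of "one (\<delta> g)"] by (simp add: K_mem T_smult)
        then have "\<phi> (one w \<oplus>\<^bsub>?P\<^esub> ?s \<odot>\<^bsub>?P\<^esub> one (\<delta> g)) = \<phi> (one w) \<oplus>\<^bsub>M\<^esub> \<phi> (?s \<odot>\<^bsub>?P\<^esub> one (\<delta> g))"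
          using one_K[OF w w0] by (intro \<phi>_add)
        moreover have "one v = one w \<oplus>\<^bsub>?P\<^esub> ?s \<odot>\<^bsub>?P\<^esub> one (\<delta> g)"
          unfolding one_smult[OF scalar_closed] one_add v_eq[symmetric] ..
        ultimately show ?thesis by simp
      qed
      also have "\<phi> (?s \<odot>\<^bsub>?P\<^esub> one (\<delta> g)) = ?s \<odot>\<^bsub>M\<^esub> (\<delta> g \<odot>\<^bsub>M\<^esub> m)"
        using \<phi>_smult[OF scalar_closed one_K[OF \<delta>[OF gG]]] \<delta>m[OF gG] by (simp add: c_def)
      also have "\<phi> (one w) \<oplus>\<^bsub>M\<^esub> ?s \<odot>\<^bsub>M\<^esub> (\<delta> g \<odot>\<^bsub>M\<^esub> m) = (w \<oplus>\<^bsub>?R\<^esub> \<delta> g \<otimes>\<^bsub>?R\<^esub> ?s) \<odot>\<^bsub>M\<^esub> m"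
        using w \<delta>(1)[OF gG] m(1) by (simp add: IH M.smult_l_distr M.smult_assoc)
      finally show ?thesis unfolding v_eq[symmetric] .
    next
      case False
      then have "aug v = v \<one>"
        unfolding aug_def by (subst sum.remove[OF fin one_closed]) (auto intro!: sum.neutral)
      then have "v \<one> = 0" using v(2) by simp
      then have "v x = 0" for x using False by (cases "x = \<one>") auto
      then have "v = (\<lambda>x. 0)" by (rule ext)
      then have "v = \<zero>\<^bsub>?R\<^esub>" by (simp add: KG_zero)
      moreover have "\<phi> (one v) = \<zero>\<^bsub>M\<^esub>"
      proof -
        have "one v = \<zero>\<^bsub>?R\<^esub> \<odot>\<^bsub>?P\<^esub> one v"
          unfolding one_smult[OF KR.zero_closed] using \<open>v = \<zero>\<^bsub>?R\<^esub>\<close> by simp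
        then have "\<phi> (one v) = \<zero>\<^bsub>?R\<^esub> \<odot>\<^bsub>M\<^esub> \<phi> (one v)"
          using \<phi>_smult[OF KR.zero_closed one_K[OF v]] by simp
        then show ?thesis using \<phi>_closed[OF one_K[OF v]] by simp
      qed
      ultimately show ?thesis using m(1) by simp
    qed
  qed
  define s where "s u = (\<lambda>x. \<Sum>c\<in>{c. u c \<noteq> (\<lambda>x. 0)}. c * u c x)" for u :: "'k \<Rightarrow> 'g \<Rightarrow> 'k"
  have s_sup: "s u = (\<lambda>x. \<Sum>c\<in>S. c * u c x)" if "finite S" "{c. u c \<noteq> (\<lambda>x. 0)} \<subseteq> S" for u S
    unfolding s_def by (rule ext, rule sum.mono_neutral_left) (use that in auto)
  have s_R: "s u \<in> carrier ?R" if "u \<in> carrier ?P" for u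
    using that by (auto simp: s_def KG_carrier P_mem intro!: sum.neutral)
  have s_add: "s (u \<oplus>\<^bsub>?P\<^esub> v) = s u \<oplus>\<^bsub>?R\<^esub> s v" if uv: "u \<in> carrier ?P" "v \<in> carrier ?P" for u v
  proof -
    let ?S = "{c. u c \<noteq> (\<lambda>x. 0)} \<union> {c. v c \<noteq> (\<lambda>x. 0)}"
    have S: "finite ?S" using uv by (simp add: P_mem)
    have "{c. (u \<oplus>\<^bsub>?P\<^esub> v) c \<noteq> (\<lambda>x. 0)} \<subseteq> ?S" by (auto simp: P_add)
    note e = s_sup[OF S this] s_sup[OF S Un_upper1] s_sup[OF S Un_upper2]
    show ?thesis unfolding e KG_add by (simp add: P_add distrib_left sum.distrib)
  qed
  have s_smult: "s (a \<odot>\<^bsub>?P\<^esub> u) = s u \<otimes>\<^bsub>?R\<^esub> a" if a: "a \<in> carrier ?R" and u: "u \<in> carrier ?P" for a u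
  proof
    fix x
    let ?S = "{c. u c \<noteq> (\<lambda>x. 0)}"
    have S: "finite ?S" using u by (simp add: P_mem)
    have uR: "u c \<in> carrier ?R" for c using u by (simp add: P_mem)
    have "{c. (a \<odot>\<^bsub>?P\<^esub> u) c \<noteq> (\<lambda>x. 0)} \<subseteq> ?S"
      using KR.l_null[OF a] by (auto simp: P_smult KG_zero)
    then have "s (a \<odot>\<^bsub>?P\<^esub> u) x = (\<Sum>c\<in>?S. c * (u c \<otimes>\<^bsub>?R\<^esub> a) x)"
      using s_sup[OF S] by (simp add: P_smult)
    also have "\<dots> = (\<Sum>c\<in>?S. \<Sum>(g, h)\<in>carrier G \<times> carrier G. if g \<otimes> h = x then c * u c g * a h else 0)"
      by (rule sum.cong) (auto simp: KG_mult[OF uR a] sum_distrib_left case_prod_unfold intro!: sum.cong)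
    also have "\<dots> = (\<Sum>(g, h)\<in>carrier G \<times> carrier G. if g \<otimes> h = x then s u g * a h else 0)"
      by (subst sum.swap) (auto simp: s_def sum_distrib_right intro!: sum.cong)
    also have "\<dots> = (s u \<otimes>\<^bsub>?R\<^esub> a) x" by (simp add: KG_mult[OF s_R[OF u] a])
    finally show "s (a \<odot>\<^bsub>?P\<^esub> u) x = (s u \<otimes>\<^bsub>?R\<^esub> a) x" .
  qed
  have aug_s: "aug (s u) = ?d u" if u: "u \<in> carrier ?P" for u
    unfolding d_eq[OF u] aug_def s_def by (subst sum.swap) (simp add: sum_distrib_left)
  define r where "r u = u \<ominus>\<^bsub>?P\<^esub> one (s u)" for u
  have r_P: "r u \<in> carrier ?P" and r_eq: "r u \<oplus>\<^bsub>?P\<^esub> one (s u) = u" if u: "u \<in> carrier ?P" for u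
    unfolding r_def using u one_P[OF s_R[OF u]] by (simp_all add: a_minus_def P.M.a_assoc P.M.l_neg)
  have r_unique: "r u = w" if "u \<in> carrier ?P" "w \<in> carrier ?P" "w \<oplus>\<^bsub>?P\<^esub> one (s u) = u" for u w
  proof -
    have "r u \<oplus>\<^bsub>?P\<^esub> one (s u) = w \<oplus>\<^bsub>?P\<^esub> one (s u)" using that(3) r_eq[OF that(1)] by simp
    then show ?thesis
      by (rule P.M.add.r_cancel[OF _ r_P[OF that(1)] that(2) one_P[OF s_R[OF that(1)]]])
  qed
  have r_K: "r u \<in> ?K" if u: "u \<in> carrier ?P" for u
  proof -
    have "?d u = ?d (r u) + aug (s u)"
      using lin_map_add[OF d r_P[OF u] one_P[OF s_R[OF u]]] r_eq[OF u] d_one[OF s_R[OF u]] by (simp add: T_add)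
    then show ?thesis using aug_s[OF u] r_P[OF u] by (simp add: K_mem)
  qed
  have r_add: "r (u \<oplus>\<^bsub>?P\<^esub> v) = r u \<oplus>\<^bsub>?P\<^esub> r v" if uv: "u \<in> carrier ?P" "v \<in> carrier ?P" for u v
  proof (rule r_unique)
    have "(r u \<oplus>\<^bsub>?P\<^esub> r v) \<oplus>\<^bsub>?P\<^esub> one (s (u \<oplus>\<^bsub>?P\<^esub> v)) = (r u \<oplus>\<^bsub>?P\<^esub> one (s u)) \<oplus>\<^bsub>?P\<^esub> (r v \<oplus>\<^bsub>?P\<^esub> one (s v))"
      unfolding s_add[OF uv] one_add[symmetric]
      using r_P[OF uv(1)] r_P[OF uv(2)] one_P[OF s_R[OF uv(1)]] one_P[OF s_R[OF uv(2)]] by (simp add: P.M.a_ac)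
    then show "(r u \<oplus>\<^bsub>?P\<^esub> r v) \<oplus>\<^bsub>?P\<^esub> one (s (u \<oplus>\<^bsub>?P\<^esub> v)) = u \<oplus>\<^bsub>?P\<^esub> v"
      using r_eq uv by simp
  qed (use uv r_P in auto)
  have r_smult: "r (a \<odot>\<^bsub>?P\<^esub> u) = a \<odot>\<^bsub>?P\<^esub> r u" if a: "a \<in> carrier ?R" and u: "u \<in> carrier ?P" for a u
  proof (rule r_unique)
    have "a \<odot>\<^bsub>?P\<^esub> r u \<oplus>\<^bsub>?P\<^esub> one (s (a \<odot>\<^bsub>?P\<^esub> u)) = a \<odot>\<^bsub>?P\<^esub> (r u \<oplus>\<^bsub>?P\<^esub> one (s u))"
      unfolding s_smult[OF a u] one_smult[OF a, symmetric]
      by (rule P.smult_r_distr[symmetric]) (use a r_P[OF u] one_P[OF s_R[OF u]] in auto)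
    then show "a \<odot>\<^bsub>?P\<^esub> r u \<oplus>\<^bsub>?P\<^esub> one (s (a \<odot>\<^bsub>?P\<^esub> u)) = a \<odot>\<^bsub>?P\<^esub> u" using r_eq[OF u] by simp
  qed (use a u r_P in auto)
  define g where "g u = \<phi> (r u) \<oplus>\<^bsub>M\<^esub> s u \<odot>\<^bsub>M\<^esub> m" for u
  have "lin_map ?R ?P M g"
  proof (rule lin_mapI)
    note cl = \<phi>_closed[OF r_K] s_R m(1)
    show "g u \<in> carrier M" if "u \<in> carrier ?P" for u
      unfolding g_def using cl that by blast
    show "g (u \<oplus>\<^bsub>?P\<^esub> v) = g u \<oplus>\<^bsub>M\<^esub> g v" if "u \<in> carrier ?P" "v \<in> carrier ?P" for u v
      unfolding g_def using that cl
      by (simp add: r_add s_add \<phi>_add r_K M.smult_l_distr M.M.a_ac)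
    show "g (a \<odot>\<^bsub>?P\<^esub> u) = a \<odot>\<^bsub>M\<^esub> g u" if "a \<in> carrier ?R" "u \<in> carrier ?P" for a u
      unfolding g_def using that cl
      by (simp add: r_smult s_smult \<phi>_smult r_K M.smult_assoc M.smult_r_distr)
  qed
  moreover have "g k = \<phi> k" if k: "k \<in> ?K" for k
  proof -
    have kP: "k \<in> carrier ?P" "aug (s k) = 0" using k aug_s by (auto simp: K_mem)
    have "\<phi> k = \<phi> (r k \<oplus>\<^bsub>?P\<^esub> one (s k))" using r_eq[OF kP(1)] by simp
    also have "\<dots> = \<phi> (r k) \<oplus>\<^bsub>M\<^esub> \<phi> (one (s k))"
      by (rule \<phi>_add[OF r_K[OF kP(1)] one_K[OF s_R[OF kP(1)] kP(2)]])
    also have "\<phi> (one (s k)) = s k \<odot>\<^bsub>M\<^esub> m" by (rule \<phi>_one[OF s_R[OF kP(1)] kP(2)])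
    finally show ?thesis by (simp add: g_def)
  qed
  ultimately show "\<exists>g. lin_map ?R ?P M g \<and> (\<forall>k\<in>?K. g k = \<phi> k)" by blast
qed

end

section \<open>Tableaux and polytabloids of a diagram\<close>

type_synonym tab = "nat \<times> nat \<Rightarrow> int"

text \<open>The notation \<open>inv\<close> is taken by the inverse in a group.\<close>

abbreviation pinv :: "('b \<Rightarrow> 'c) \<Rightarrow> 'c \<Rightarrow> 'b"
  where "pinv \<equiv> inv_into UNIV"

text \<open>In a Garnir relation the boxes \<open>U\<close> in one column and \<open>B - U\<close> in another are filled with
  the entries of \<open>B\<close> in all possible ways. Up to the order in each column, such a filling is
  given by the set of boxes of \<open>B\<close> whose entries go to \<open>U\<close>. These sets stand for the cosets of
  \<open>Sym(U) \<times> Sym(B - U)\<close> in \<open>Sym(B)\<close>.\<close>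

definition exchanges :: "'b set \<Rightarrow> 'b set \<Rightarrow> 'b set set"
  where "exchanges B U = {Z. Z \<subseteq> B \<and> card Z = card U}"

text \<open>An arbitrary representative of the coset; by \<open>exchange_perm_indep\<close> its choice does not
  matter.\<close>

definition exchange_perm :: "'b set \<Rightarrow> 'b set \<Rightarrow> 'b set \<Rightarrow> 'b \<Rightarrow> 'b"
  where "exchange_perm B U Z = (SOME \<pi>. \<pi> permutes B \<and> \<pi> ` U = Z)"

lemma exchange_perm:
  assumes "finite B" "U \<subseteq> B" "Z \<in> exchanges B U"
  shows "exchange_perm B U Z permutes B" "exchange_perm B U Z ` U = Z"
proof -
  have Z: "Z \<subseteq> B" "card Z = card U" using assms by (auto simp: exchanges_def)
  have fin: "finite U" "finite Z" "finite (B - U)" "finite (B - Z)"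
    using assms Z finite_subset by auto
  obtain f where f: "bij_betw f U Z"
    using finite_same_card_bij[of U Z] fin Z by auto
  have "card (B - U) = card (B - Z)"
    using Z assms by (simp add: card_Diff_subset fin)
  then obtain g where g: "bij_betw g (B - U) (B - Z)"
    using finite_same_card_bij[of "B - U" "B - Z"] fin by auto
  define p where "p b = (if b \<in> U then f b else if b \<in> B then g b else b)" for b
  have 1: "bij_betw p U Z"
    using f by (rule bij_betw_cong[THEN iffD1, rotated]) (auto simp: p_def)
  have 2: "bij_betw p (B - U) (B - Z)"
    using g by (rule bij_betw_cong[THEN iffD1, rotated]) (auto simp: p_def)
  have "bij_betw p (U \<union> (B - U)) (Z \<union> (B - Z))"
    by (rule bij_betw_combine[OF 1 2]) auto
  moreover have "U \<union> (B - U) = B" "Z \<union> (B - Z) = B" using assms Z by auto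
  ultimately have "p permutes B"
    by (intro bij_imp_permutes) (use assms in \<open>auto simp: p_def\<close>)
  moreover have "p ` U = Z" using 1 by (simp add: bij_betw_def)
  ultimately have "\<exists>\<pi>. \<pi> permutes B \<and> \<pi> ` U = Z" by blast
  from someI_ex[OF this] show "exchange_perm B U Z permutes B" "exchange_perm B U Z ` U = Z"
    unfolding exchange_perm_def by auto
qed

lemma eq_neg_self_imp_zero:
  fixes a :: "'k::field"
  assumes "(2::'k) \<noteq> 0" "a = - a" shows "a = (0::'k)"
  using assms by (metis add.right_inverse mult_2 mult_eq_0_iff)

text \<open>The unknowns are found in the order of increasing \<open>w\<close>: the new index occurs in none of
  the earlier equations.\<close>

lemma unitriangular_solve:
  fixes m :: "'a \<Rightarrow> 'a \<Rightarrow> 'k::field" and w :: "'a \<Rightarrow> int"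
  assumes "finite S" "\<And>s. s \<in> S \<Longrightarrow> m s s = 1"
    and "\<And>s u. s \<in> S \<Longrightarrow> u \<in> S \<Longrightarrow> s \<noteq> u \<Longrightarrow> m s u \<noteq> 0 \<Longrightarrow> w u < w s"
  shows "\<exists>y. \<forall>s\<in>S. h s = (\<Sum>u\<in>S. y u * m s u)"
  using assms
proof (induction rule: finite_ranking_induct[where f = w])
  case (insert x S)
  show ?case
  proof (cases "x \<in> S")
    case True
    then show ?thesis using insert by (simp add: insert_absorb)
  next
    case False
    obtain y where y: "\<And>s. s \<in> S \<Longrightarrow> h s = (\<Sum>u\<in>S. y u * m s u)"
      using insert by (metis insertCI)
    define y' where "y' = y(x := h x - (\<Sum>u\<in>S. y u * m x u))"
    have eq: "(\<Sum>u\<in>S. y' u * m s u) = (\<Sum>u\<in>S. y u * m s u)" for s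
      by (rule sum.cong) (use False in \<open>auto simp: y'_def\<close>)
    have "m s x = 0" if "s \<in> S" for s
      using insert.prems(2)[of s x] insert.hyps(2)[OF that] that False by fastforce
    then have "\<forall>s\<in>insert x S. h s = (\<Sum>u\<in>insert x S. y' u * m s u)"
      using insert.hyps(1) False y insert.prems(1)[of x] by (auto simp: eq) (simp add: y'_def)
    then show ?thesis by blast
  qed
qed simp

lemma transpose_commute_or_braid:
  fixes x :: 'b
  shows "transpose x y \<circ> transpose z w = transpose z w \<circ> transpose x y \<or>
    transpose x y \<circ> (transpose z w \<circ> transpose x y) = transpose z w \<circ> (transpose x y \<circ> transpose z w)"
proof (cases "{x, y} \<inter> {z, w} = {} \<or> x = y \<or> z = w")
  case True
  then have "transpose x y \<circ> transpose z w = transpose z w \<circ> transpose x y"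
    by (auto simp: fun_eq_iff transpose_def)
  then show ?thesis by blast
next
  case False
  then have "transpose x y \<circ> (transpose z w \<circ> transpose x y) = transpose z w \<circ> (transpose x y \<circ> transpose z w)"
    by (auto simp: fun_eq_iff transpose_def)
  then show ?thesis by blast
qed

text \<open>The boxes of a Young diagram and the set of entries. Permutations of boxes act on the
  right of a tableau, permutations of entries on the left; as column and row stabilizers in
  terms of boxes do not depend on the tableau, most of the arguments are carried out with
  permutations of boxes.\<close>

locale young_shape =
  fixes D :: "(nat \<times> nat) set" and A :: "int set"
  assumes finD: "finite D" and finA: "finite A" and A0: "0 \<notin> A"
    and down: "\<And>i j i' j'. (i, j) \<in> D \<Longrightarrow> i' \<le> i \<Longrightarrow> j' \<le> j \<Longrightarrow> (i', j') \<in> D"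
begin

(* permutations of boxes are easier to handle when quantifiers over boxes are not split into two *)
declare split_paired_All [simp del] split_paired_Ex [simp del]

definition Tab :: "tab set"
  where "Tab = {t. bij_betw t D A \<and> (\<forall>b. b \<notin> D \<longrightarrow> t b = 0)}"

definition col_perms :: "(nat \<times> nat \<Rightarrow> nat \<times> nat) set"
  where "col_perms = {\<pi>. \<pi> permutes D \<and> (\<forall>b. snd (\<pi> b) = snd b)}"

definition row_perms :: "(nat \<times> nat \<Rightarrow> nat \<times> nat) set"
  where "row_perms = {\<pi>. \<pi> permutes D \<and> (\<forall>b. fst (\<pi> b) = fst b)}"

definition roweq :: "tab \<Rightarrow> tab \<Rightarrow> bool"
  where "roweq t u \<longleftrightarrow> (\<exists>\<rho>\<in>row_perms. u = t \<circ> \<rho>)"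

text \<open>The coefficient of the tabloid of \<open>u\<close> in the polytabloid of \<open>t\<close>; tabloids are
  represented by tableaux up to \<open>roweq\<close>.\<close>

definition pt_coeff :: "tab \<Rightarrow> tab \<Rightarrow> 'k::field"
  where "pt_coeff t u = (\<Sum>\<pi>\<in>{\<pi> \<in> col_perms. roweq (t \<circ> \<pi>) u}. of_int (sign \<pi>))"

lemma fin_col_perms: "finite col_perms"
  by (rule finite_subset[OF _ finite_permutations[OF finD]]) (auto simp: col_perms_def)

lemma col_perms_permutes: "\<pi> \<in> col_perms \<Longrightarrow> \<pi> permutes D" by (simp add: col_perms_def)

lemma col_perms_id: "id \<in> col_perms" by (simp add: col_perms_def permutes_id)

lemma col_perms_comp: "\<pi> \<in> col_perms \<Longrightarrow> \<kappa> \<in> col_perms \<Longrightarrow> \<pi> \<circ> \<kappa> \<in> col_perms"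
  by (auto simp: col_perms_def permutes_compose)

lemma col_perms_inv: "\<pi> \<in> col_perms \<Longrightarrow> pinv \<pi> \<in> col_perms"
proof -
  assume p: "\<pi> \<in> col_perms"
  have "snd (pinv \<pi> b) = snd b" for b
  proof -
    have "snd (\<pi> (pinv \<pi> b)) = snd (pinv \<pi> b)" using p unfolding col_perms_def by blast
    moreover have "\<pi> (pinv \<pi> b) = b"
      using p permutes_inverses(1)[of \<pi> D b] by (simp add: col_perms_def)
    ultimately show ?thesis by simp
  qed
  then show ?thesis using p by (simp add: col_perms_def permutes_inv)
qed

lemma row_perms_id: "id \<in> row_perms" by (simp add: row_perms_def permutes_id)

lemma row_perms_comp: "\<pi> \<in> row_perms \<Longrightarrow> \<kappa> \<in> row_perms \<Longrightarrow> \<pi> \<circ> \<kappa> \<in> row_perms"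
  by (auto simp: row_perms_def permutes_compose)

lemma row_perms_inv: "\<pi> \<in> row_perms \<Longrightarrow> pinv \<pi> \<in> row_perms"
proof -
  assume p: "\<pi> \<in> row_perms"
  have "fst (pinv \<pi> b) = fst b" for b
  proof -
    have "fst (\<pi> (pinv \<pi> b)) = fst (pinv \<pi> b)" using p unfolding row_perms_def by blast
    moreover have "\<pi> (pinv \<pi> b) = b"
      using p permutes_inverses(1)[of \<pi> D b] by (simp add: row_perms_def)
    ultimately show ?thesis by simp
  qed
  then show ?thesis using p by (simp add: row_perms_def permutes_inv)
qed

lemma sign_comp:
  assumes "\<pi> permutes D" "\<kappa> permutes D" shows "sign (\<pi> \<circ> \<kappa>) = sign \<pi> * sign \<kappa>"
  using assms finD by (intro sign_compose permutes_imp_permutation)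

lemma roweq_refl: "roweq t t"
  unfolding roweq_def using row_perms_id by (intro bexI[of _ id]) auto

lemma roweq_sym: "roweq t u \<Longrightarrow> roweq u t"
proof -
  assume "roweq t u"
  then obtain \<rho> where r: "\<rho> \<in> row_perms" "u = t \<circ> \<rho>" by (auto simp: roweq_def)
  then have "t = u \<circ> pinv \<rho>"
    by (auto simp: row_perms_def fun_eq_iff permutes_inverses)
  then show ?thesis unfolding roweq_def using row_perms_inv[OF r(1)] by blast
qed

lemma roweq_trans: "roweq t u \<Longrightarrow> roweq u v \<Longrightarrow> roweq t v"
  unfolding roweq_def using row_perms_comp by (metis comp_assoc)

lemma Tab_comp: "t \<in> Tab \<Longrightarrow> \<pi> permutes D \<Longrightarrow> t \<circ> \<pi> \<in> Tab"
  unfolding Tab_def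
  by (auto intro: bij_betw_trans permutes_imp_bij simp: permutes_not_in)

lemma Tab_act: "t \<in> Tab \<Longrightarrow> \<sigma> permutes A \<Longrightarrow> \<sigma> \<circ> t \<in> Tab"
  unfolding Tab_def using A0
  by (auto intro: bij_betw_trans permutes_imp_bij simp: permutes_not_in)

lemma Tab_eqD: "t \<in> Tab \<Longrightarrow> b \<in> D \<Longrightarrow> b' \<in> D \<Longrightarrow> t b = t b' \<longleftrightarrow> b = b'"
  unfolding Tab_def by (auto simp: bij_betw_def inj_on_def)

lemma Tab_in: "t \<in> Tab \<Longrightarrow> b \<in> D \<Longrightarrow> t b \<in> A"
  unfolding Tab_def by (auto simp: bij_betw_def)

lemma finTab: "finite Tab"
proof (rule finite_subset)
  show "Tab \<subseteq> {t. \<forall>b. (b \<in> D \<longrightarrow> t b \<in> A) \<and> (b \<notin> D \<longrightarrow> t b = 0)}"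
    by (auto simp: Tab_def bij_betw_def)
  show "finite {t :: tab. \<forall>b. (b \<in> D \<longrightarrow> t b \<in> A) \<and> (b \<notin> D \<longrightarrow> t b = 0)}"
    using finD finA by (rule finite_set_of_finite_funs)
qed

lemma inj_comp_right: "\<sigma> permutes A \<Longrightarrow> \<sigma> \<circ> t = \<sigma> \<circ> u \<longleftrightarrow> t = u"
  by (auto simp: fun_eq_iff dest: permutes_inj injD)

lemma roweq_act: "\<sigma> permutes A \<Longrightarrow> roweq (\<sigma> \<circ> t) (\<sigma> \<circ> u) \<longleftrightarrow> roweq t u"
  unfolding roweq_def comp_assoc by (simp add: inj_comp_right)

lemma pt_coeff_act: "\<sigma> permutes A \<Longrightarrow> pt_coeff (\<sigma> \<circ> t) (\<sigma> \<circ> u) = pt_coeff t u"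
  unfolding pt_coeff_def comp_assoc by (simp add: roweq_act)

lemma roweq_cong: "roweq u v \<Longrightarrow> roweq t u \<longleftrightarrow> roweq t v"
  using roweq_trans roweq_sym by blast

lemma pt_coeff_roweq: "roweq u v \<Longrightarrow> pt_coeff t u = pt_coeff t v"
  unfolding pt_coeff_def by (simp add: roweq_cong)

lemma pt_coeff_col_perms:
  assumes "\<kappa> \<in> col_perms"
  shows "pt_coeff (t \<circ> \<kappa>) u = (of_int (sign \<kappa>) * pt_coeff t u :: 'k::field)"
proof -
  have "(\<Sum>\<pi>\<in>{\<pi> \<in> col_perms. roweq (t \<circ> \<pi>) u}. of_int (sign \<pi>) :: 'k) =
     (\<Sum>\<pi>\<in>{\<pi> \<in> col_perms. roweq (t \<circ> \<kappa> \<circ> \<pi>) u}. of_int (sign (\<kappa> \<circ> \<pi>)))"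
  proof (rule sum.reindex_bij_witness[of _ "\<lambda>\<pi>. \<kappa> \<circ> \<pi>" "\<lambda>\<pi>. pinv \<kappa> \<circ> \<pi>"])
  qed (use assms col_perms_comp col_perms_inv in \<open>auto simp: col_perms_permutes fun_eq_iff o_def permutes_inverses[OF col_perms_permutes]
        permutes_inv_o[OF col_perms_permutes]\<close>)
  also have "\<dots> = (\<Sum>\<pi>\<in>{\<pi> \<in> col_perms. roweq (t \<circ> \<kappa> \<circ> \<pi>) u}. of_int (sign \<kappa>) * of_int (sign \<pi>))"
    by (rule sum.cong) (use assms in \<open>auto simp: sign_comp col_perms_permutes\<close>)
  finally have eq: "pt_coeff t u = (of_int (sign \<kappa>) * pt_coeff (t \<circ> \<kappa>) u :: 'k)"
    by (simp add: pt_coeff_def sum_distrib_left)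
  have "of_int (sign \<kappa>) * (of_int (sign \<kappa>) :: 'k) = 1"
    by (metis of_int_1 of_int_mult sign_idempotent)
  then show ?thesis unfolding eq by (simp flip: mult.assoc)
qed

text \<open>The value of \<open>G\<close> at the Garnir element for \<open>t\<close>. It uses coset representatives instead of
  the whole group \<open>Sym(B)\<close>, because the orders of the subgroups need not be invertible in the
  field.\<close>

definition garnir_sum :: "(tab \<Rightarrow> 'k::field) \<Rightarrow> tab \<Rightarrow> (nat \<times> nat) set \<Rightarrow> (nat \<times> nat) set \<Rightarrow> 'k"
  where "garnir_sum G t B U = (\<Sum>Z\<in>exchanges B U. of_int (sign (exchange_perm B U Z)) * G (t \<circ> exchange_perm B U Z))"

definition col_anti :: "(tab \<Rightarrow> 'k::field) \<Rightarrow> bool"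
  where "col_anti G \<longleftrightarrow> (\<forall>t\<in>Tab. \<forall>\<pi>\<in>col_perms. G (t \<circ> \<pi>) = of_int (sign \<pi>) * G t)"

text \<open>Two representatives of the same coset differ by a permutation of \<open>U\<close> and of \<open>B - U\<close>.
  Each of these two sets lies in one column, so that this is a column permutation.\<close>

lemma exchange_perm_indep:
  assumes G: "col_anti G" and t: "t \<in> Tab" and B: "B \<subseteq> D" "U \<subseteq> B"
    and cU: "\<And>b. b \<in> U \<Longrightarrow> snd b = j" and cY: "\<And>b. b \<in> B - U \<Longrightarrow> snd b = j'"
    and p: "\<pi> permutes B" "\<pi>' permutes B" "\<pi> ` U = \<pi>' ` U"
  shows "of_int (sign \<pi>) * G (t \<circ> \<pi>) = (of_int (sign \<pi>') * G (t \<circ> \<pi>') :: 'k::field)"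
proof -
  define \<kappa> where "\<kappa> = pinv \<pi> \<circ> \<pi>'"
  have pD: "\<pi> permutes D" "\<pi>' permutes D" using p B permutes_subset by auto
  have k: "\<kappa> permutes B" unfolding \<kappa>_def using p by (intro permutes_compose permutes_inv)
  have kU: "\<kappa> b \<in> U" if "b \<in> U" for b
  proof -
    have "\<pi>' b \<in> \<pi> ` U" unfolding p(3) using that by (rule imageI)
    then obtain c where "c \<in> U" "\<pi>' b = \<pi> c" by blast
    then show ?thesis using p by (simp add: \<kappa>_def permutes_inverses)
  qed
  have kY: "\<kappa> b \<in> B - U" if b: "b \<in> B - U" for b
  proof -
    have "\<pi>' b \<notin> \<pi> ` U"
      unfolding p(3) using b inj_image_mem_iff[OF permutes_inj[OF p(2)]] by simp
    moreover have "\<pi> (\<kappa> b) = \<pi>' b" using p(1) by (simp add: \<kappa>_def permutes_inverses)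
    ultimately have "\<kappa> b \<notin> U" by (metis imageI)
    then show ?thesis using b permutes_in_image[OF k, of b] by simp
  qed
  have "snd (\<kappa> b) = snd b" for b
    by (metis DiffI cU cY kU kY k permutes_not_in)
  then have kC: "\<kappa> \<in> col_perms" using k B permutes_subset by (auto simp: col_perms_def)
  have eq: "\<pi>' = \<pi> \<circ> \<kappa>" using p by (auto simp: \<kappa>_def fun_eq_iff permutes_inverses)
  have "G (t \<circ> \<pi>') = of_int (sign \<kappa>) * G (t \<circ> \<pi>)"
    using G Tab_comp[OF t pD(1)] kC unfolding col_anti_def eq comp_assoc[symmetric] by blast
  moreover have "sign \<pi>' = sign \<pi> * sign \<kappa>" unfolding eq using pD kC by (simp add: sign_comp col_perms_permutes)
  moreover have "of_int (sign \<kappa>) * (of_int (sign \<kappa>) :: 'k) = 1"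
    by (metis of_int_1 of_int_mult sign_idempotent)
  ultimately show ?thesis by simp
qed

text \<open>A transposition of two boxes of \<open>B\<close> permutes the cosets of \<open>Sym(U) \<times> Sym(B - U)\<close> and
  changes the sign of each representative.\<close>

lemma garnir_sum_transpose:
  assumes G: "col_anti G" and t: "t \<in> Tab" and B: "B \<subseteq> D" "U \<subseteq> B"
    and cU: "\<And>b. b \<in> U \<Longrightarrow> snd b = j" and cY: "\<And>b. b \<in> B - U \<Longrightarrow> snd b = j'"
    and b: "b \<in> B" "b' \<in> B" "b \<noteq> b'"
  shows "garnir_sum G (t \<circ> transpose b b') B U = - garnir_sum G t B U"
proof -
  let ?s = "transpose b b'" and ?r = "exchange_perm B U"
  have finB: "finite B" using B finD finite_subset by auto
  have s: "?s permutes B" using b by (intro permutes_swap_id)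
  have img: "?s ` Z \<in> exchanges B U" if "Z \<in> exchanges B U" for Z
    using that s permutes_image[OF s] unfolding exchanges_def
    by (auto simp: card_image permutes_inj_on[OF s] permutes_in_image[OF s])
  have "garnir_sum G (t \<circ> ?s) B U = (\<Sum>Z\<in>exchanges B U. - (of_int (sign (?r (?s ` Z))) * G (t \<circ> ?r (?s ` Z))))"
    unfolding garnir_sum_def
  proof (rule sum.cong)
    fix Z assume Z: "Z \<in> exchanges B U"
    note r = exchange_perm[OF finB B(2) Z] and r' = exchange_perm[OF finB B(2) img[OF Z]]
    have "of_int (sign (?s \<circ> ?r Z)) * G (t \<circ> (?s \<circ> ?r Z)) =
      of_int (sign (?r (?s ` Z))) * G (t \<circ> ?r (?s ` Z))"
    proof (rule exchange_perm_indep[OF G t B cU cY])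
      show "?s \<circ> ?r Z permutes B" by (rule permutes_compose[OF r(1) s])
      have "(?s \<circ> ?r Z) ` U = ?s ` (?r Z ` U)" by (rule image_comp[symmetric])
      then show "(?s \<circ> ?r Z) ` U = ?r (?s ` Z) ` U" by (simp only: r(2) r'(2))
    qed (assumption | rule r'(1))+
    moreover have "sign (?s \<circ> ?r Z) = - sign (?r Z)"
      using r s permutes_subset[OF _ B(1)] b by (simp add: sign_comp sign_swap_id)
    ultimately show "of_int (sign (?r Z)) * G (t \<circ> ?s \<circ> ?r Z) =
        - (of_int (sign (?r (?s ` Z))) * G (t \<circ> ?r (?s ` Z)))"
      by (simp add: comp_assoc neg_eq_iff_add_eq_0 eq_neg_iff_add_eq_0)
  qed simp
  also have "\<dots> = - garnir_sum G t B U"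
    unfolding garnir_sum_def sum_negf
    by (rule arg_cong[where f = uminus], rule sum.reindex_bij_witness[of _ "\<lambda>Z. ?s ` Z" "\<lambda>Z. ?s ` Z"])
      (auto simp: image_comp o_def intro: img)
  finally show ?thesis .
qed

section \<open>Standard tableaux\<close>

text \<open>The weight is the same for all tableaux of one tabloid and decreases when an inversion
  is created in a column. It replaces the dominance order of tabloids.\<close>

definition row_weight :: "tab \<Rightarrow> int" where "row_weight t = (\<Sum>b\<in>D. int (fst b) * t b)"

definition col_incr :: "tab \<Rightarrow> bool"
  where "col_incr t \<longleftrightarrow> (\<forall>i i' j. (i', j) \<in> D \<longrightarrow> i < i' \<longrightarrow> t (i, j) < t (i', j))"

definition row_incr :: "tab \<Rightarrow> bool"
  where "row_incr t \<longleftrightarrow> (\<forall>i j j'. (i, j') \<in> D \<longrightarrow> j < j' \<longrightarrow> t (i, j) < t (i, j'))"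

definition Std :: "tab set" where "Std = {t \<in> Tab. col_incr t \<and> row_incr t}"

lemma col_incrD: "col_incr t \<Longrightarrow> b' \<in> D \<Longrightarrow> snd b = snd b' \<Longrightarrow> fst b < fst b' \<Longrightarrow> t b < t b'"
  unfolding col_incr_def by (cases b, cases b') auto

lemma row_incrD: "row_incr t \<Longrightarrow> b' \<in> D \<Longrightarrow> fst b = fst b' \<Longrightarrow> snd b < snd b' \<Longrightarrow> t b < t b'"
  unfolding row_incr_def by (cases b, cases b') auto

lemma row_weight_row_perms:
  assumes "\<rho> \<in> row_perms" shows "row_weight (t \<circ> \<rho>) = row_weight t"
proof -
  have p: "\<rho> permutes D" and f: "fst (\<rho> b) = fst b" for b
    using assms by (auto simp: row_perms_def)
  have "row_weight t = (\<Sum>b\<in>D. int (fst (\<rho> b)) * t (\<rho> b))"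
    unfolding row_weight_def using sum.permute[OF p, of "\<lambda>b. int (fst b) * t b"] by (simp add: o_def)
  then show ?thesis by (simp add: row_weight_def f)
qed

lemma row_weight_roweq: "roweq t u \<Longrightarrow> row_weight u = row_weight t"
  by (auto simp: roweq_def row_weight_row_perms)

lemma row_weight_swap:
  assumes b: "b \<in> D" "b' \<in> D" and lt: "fst b < fst b'" "t b' < t b"
  shows "row_weight t < row_weight (t \<circ> transpose b b')"
proof -
  have ne: "b \<noteq> b'" using lt by auto
  have D: "D = insert b (insert b' (D - {b, b'}))" using b by auto
  have fin: "finite (D - {b, b'})" using finD by simp
  have "row_weight s = int (fst b) * s b + (int (fst b') * s b' + (\<Sum>c\<in>D - {b, b'}. int (fst c) * s c))" for s
    unfolding row_weight_def by (subst D) (use ne fin in simp)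
  note e = this[of t] this[of "t \<circ> transpose b b'"]
  have "(\<Sum>c\<in>D - {b, b'}. int (fst c) * (t \<circ> transpose b b') c) = (\<Sum>c\<in>D - {b, b'}. int (fst c) * t c)"
    by (rule sum.cong) (auto simp: transpose_apply_other)
  then have "row_weight (t \<circ> transpose b b') - row_weight t = (int (fst b') - int (fst b)) * (t b - t b')"
    using e by (simp add: algebra_simps)
  moreover have "\<dots> > 0" using lt by (intro mult_pos_pos) auto
  ultimately show ?thesis by simp
qed

lemma transpose_col_perms: "b \<in> D \<Longrightarrow> b' \<in> D \<Longrightarrow> snd b = snd b' \<Longrightarrow> transpose b b' \<in> col_perms"
  by (auto simp: col_perms_def permutes_swap_id transpose_def)

text \<open>Applied to columns (\<open>q\<close> the column index, \<open>r\<close> the row index) and, with the roles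
  exchanged, to rows. Let \<open>b\<close> be a moved box with \<open>r b\<close> as large as possible. Both the image
  and the preimage of \<open>b\<close> are moved boxes of the same line, so they come before \<open>b\<close>; the
  preimage is the box \<open>c\<close>.\<close>

lemma inversion_exists:
  assumes p: "\<pi> permutes D" "\<pi> \<noteq> id" and cls: "\<And>b. q (\<pi> b) = (q b :: nat)"
    and det: "\<And>b b'. q b = q b' \<Longrightarrow> r b = r b' \<Longrightarrow> b = b'"
  obtains c b where "b \<in> D" "c \<in> D" "q c = q b" "r c < (r b :: nat)" "r (\<pi> b) < r (\<pi> c)"
proof -
  define Mv where "Mv = {b. \<pi> b \<noteq> b}"
  have MD: "Mv \<subseteq> D" using p by (auto simp: Mv_def permutes_def)
  have fM: "finite Mv" using MD finD finite_subset by auto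
  have "Mv \<noteq> {}" using p(2) by (auto simp: Mv_def fun_eq_iff)
  then have "Max (r ` Mv) \<in> r ` Mv" using fM by (intro Max_in) auto
  then obtain b where b: "b \<in> Mv" "r b = Max (r ` Mv)" by auto
  have mx: "r c \<le> r b" if "c \<in> Mv" for c using that b fM by simp
  define c where "c = pinv \<pi> b"
  have pc: "\<pi> c = b" unfolding c_def using p by (simp add: permutes_inverses)
  have cb: "c \<noteq> b" using b pc by (auto simp: Mv_def)
  have cM: "c \<in> Mv" using cb pc by (auto simp: Mv_def)
  have pbM: "\<pi> b \<in> Mv" using b p(1) by (auto simp: Mv_def dest: permutes_inj injD)
  have "r c \<noteq> r b" using det[of c b] cls[of c] cb pc by auto
  then have 1: "r c < r b" using mx[OF cM] by simp
  have "r (\<pi> b) \<noteq> r b" using det[of "\<pi> b" b] cls[of b] b by (auto simp: Mv_def)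
  then have 2: "r (\<pi> b) < r (\<pi> c)" using mx[OF pbM] pc by simp
  show thesis by (rule that[OF _ _ _ 1 2]) (use b cM MD cls[of c] pc in auto)
qed

text \<open>A column permutation other than the identity creates an inversion in an increasing
  column, and removing an inversion increases the weight. So only the identity can maximize
  the weight.\<close>

lemma row_weight_col_perms_less:
  assumes t: "t \<in> Tab" "col_incr t" and p: "\<pi> \<in> col_perms" "\<pi> \<noteq> id"
  shows "row_weight (t \<circ> \<pi>) < row_weight t"
proof -
  have improve: "\<exists>\<pi>'\<in>col_perms. row_weight (t \<circ> \<kappa>) < row_weight (t \<circ> \<pi>')" if k: "\<kappa> \<in> col_perms" "\<kappa> \<noteq> id" for \<kappa>
  proof -
    obtain c b where cb: "b \<in> D" "c \<in> D" "snd c = snd b" "fst c < fst b" "fst (\<kappa> b) < fst (\<kappa> c)"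
      by (rule inversion_exists[of \<kappa> snd fst]) (use k in \<open>auto simp: col_perms_def prod_eq_iff\<close>)
    have s: "snd (\<kappa> b) = snd b" "snd (\<kappa> c) = snd c" using k by (auto simp: col_perms_def)
    have "\<kappa> c \<in> D" using cb col_perms_permutes[OF k(1)] by (simp add: permutes_in_image)
    then have "t (\<kappa> b) < t (\<kappa> c)"
      by (intro col_incrD[OF t(2)]) (use s cb in auto)
    then have "row_weight (t \<circ> \<kappa>) < row_weight (t \<circ> \<kappa> \<circ> transpose c b)"
      by (intro row_weight_swap) (use cb in auto)
    then show ?thesis
      using col_perms_comp[OF k(1) transpose_col_perms[OF cb(2,1,3)]] by (auto simp: comp_assoc)
  qed
  obtain m where m: "m \<in> col_perms" "\<And>\<kappa>. \<kappa> \<in> col_perms \<Longrightarrow> row_weight (t \<circ> \<kappa>) \<le> row_weight (t \<circ> m)"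
  proof -
    have "Max ((\<lambda>\<kappa>. row_weight (t \<circ> \<kappa>)) ` col_perms) \<in> (\<lambda>\<kappa>. row_weight (t \<circ> \<kappa>)) ` col_perms"
      using fin_col_perms col_perms_id by (intro Max_in) auto
    then obtain m where "m \<in> col_perms" "row_weight (t \<circ> m) = Max ((\<lambda>\<kappa>. row_weight (t \<circ> \<kappa>)) ` col_perms)" by auto
    then show ?thesis using that fin_col_perms by simp
  qed
  have "m = id" using improve[OF m(1)] m(2) by fastforce
  then show ?thesis using improve[OF p] m(2) by fastforce
qed

text \<open>A column permutation that maximizes the weight leaves no inversion.\<close>

lemma col_sort:
  assumes t: "t \<in> Tab" obtains \<pi> where "\<pi> \<in> col_perms" "col_incr (t \<circ> \<pi>)"
proof -
  have "Max ((\<lambda>\<kappa>. row_weight (t \<circ> \<kappa>)) ` col_perms) \<in> (\<lambda>\<kappa>. row_weight (t \<circ> \<kappa>)) ` col_perms"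
    using fin_col_perms col_perms_id by (intro Max_in) auto
  then obtain m where m: "m \<in> col_perms" "row_weight (t \<circ> m) = Max ((\<lambda>\<kappa>. row_weight (t \<circ> \<kappa>)) ` col_perms)" by auto
  have mx: "row_weight (t \<circ> \<kappa>) \<le> row_weight (t \<circ> m)" if "\<kappa> \<in> col_perms" for \<kappa> using that m fin_col_perms by simp
  have "col_incr (t \<circ> m)"
    unfolding col_incr_def
  proof (intro allI impI)
    fix i i' j assume ij: "(i', j) \<in> D" "i < i'"
    have D: "(i, j) \<in> D" using down[OF ij(1), of i j] ij by simp
    have "t \<circ> m \<in> Tab" using t m by (simp add: Tab_comp col_perms_permutes)
    then have ne: "(t \<circ> m) (i, j) \<noteq> (t \<circ> m) (i', j)" using Tab_eqD D ij by fastforce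
    show "(t \<circ> m) (i, j) < (t \<circ> m) (i', j)"
    proof (rule ccontr)
      assume "\<not> ?thesis"
      then have "row_weight (t \<circ> m) < row_weight (t \<circ> m \<circ> transpose (i, j) (i', j))"
        by (intro row_weight_swap) (use ne D ij in auto)
      moreover have "m \<circ> transpose (i, j) (i', j) \<in> col_perms"
        using m D ij by (intro col_perms_comp transpose_col_perms) auto
      ultimately show False using mx by (fastforce simp: comp_assoc)
    qed
  qed
  then show ?thesis using that m by blast
qed

text \<open>A row permutation other than the identity creates an inversion in an increasing row.\<close>

lemma row_incr_unique:
  assumes t: "row_incr t" and u: "row_incr u" and tu: "roweq t u" shows "t = u"
proof -
  obtain \<rho> where r: "\<rho> \<in> row_perms" "u = t \<circ> \<rho>" using tu by (auto simp: roweq_def)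
  show ?thesis
  proof (cases "\<rho> = id")
    case False
    obtain c b where cb: "b \<in> D" "c \<in> D" "fst c = fst b" "snd c < snd b" "snd (\<rho> b) < snd (\<rho> c)"
      by (rule inversion_exists[of \<rho> fst snd]) (use r False in \<open>auto simp: row_perms_def prod_eq_iff\<close>)
    have f: "fst (\<rho> b) = fst b" "fst (\<rho> c) = fst c" using r by (auto simp: row_perms_def)
    have "\<rho> c \<in> D" using cb r by (simp add: permutes_in_image row_perms_def)
    then have "t (\<rho> b) < t (\<rho> c)"
      by (intro row_incrD[OF t]) (use f cb in auto)
    moreover have "u c < u b" by (rule row_incrD[OF u]) (use cb in auto)
    ultimately show ?thesis using r by simp
  qed (use r in simp)
qed

lemma pt_coeff_Std_diag:
  assumes "s \<in> Std" shows "pt_coeff s s = (1::'k::field)"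
proof -
  have "{\<pi> \<in> col_perms. roweq (s \<circ> \<pi>) s} = {id}"
    using assms row_weight_col_perms_less[of s] row_weight_roweq col_perms_id roweq_refl by (fastforce simp: Std_def)
  then show ?thesis by (simp add: pt_coeff_def)
qed

text \<open>Besides its own tabloid, the polytabloid of a standard tableau contains only tabloids of
  smaller weight, so the matrix of coefficients at standard tableaux is unitriangular.\<close>

lemma pt_coeff_Std_less:
  assumes s: "s \<in> Std" "u \<in> Std" "s \<noteq> u" and nz: "pt_coeff s u \<noteq> (0::'k::field)"
  shows "row_weight u < row_weight s"
proof -
  obtain \<pi> where p: "\<pi> \<in> col_perms" "roweq (s \<circ> \<pi>) u"
    using nz unfolding pt_coeff_def by (metis (no_types, lifting) mem_Collect_eq sum.not_neutral_contains_not_neutral)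
  have "\<pi> \<noteq> id" using row_incr_unique[of s u] s p by (auto simp: Std_def)
  then show ?thesis using row_weight_col_perms_less[of s \<pi>] row_weight_roweq[OF p(2)] s p by (simp add: Std_def)
qed

section \<open>Garnir relations and straightening\<close>

text \<open>For a violation \<open>t (i, j) > t (i, j')\<close> of standardness, the Garnir relation exchanges
  entries between the boxes of column \<open>j\<close> from row \<open>i\<close> downwards and those of column \<open>j'\<close> up
  to row \<open>i\<close>. Together these are more boxes than column \<open>j\<close> has.\<close>

definition leg :: "nat \<Rightarrow> nat \<Rightarrow> (nat \<times> nat) set"
  where "leg i j = {b \<in> D. snd b = j \<and> i \<le> fst b}"

definition col_top :: "nat \<Rightarrow> nat \<Rightarrow> (nat \<times> nat) set"
  where "col_top i j = {b \<in> D. snd b = j \<and> fst b \<le> i}"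

definition garnir_fun :: "(tab \<Rightarrow> 'k::field) \<Rightarrow> bool"
  where "garnir_fun G \<longleftrightarrow> col_anti G \<and>
    (\<forall>t\<in>Tab. \<forall>i j j'. (i, j') \<in> D \<longrightarrow> j < j' \<longrightarrow> garnir_sum G t (leg i j \<union> col_top i j') (leg i j) = 0)"

text \<open>The entries of the leg are at least \<open>\<theta> = t (i, j)\<close>, those of the other boxes are
  smaller. An exchange moves entries of the first kind to the right and entries of the second
  kind to the left. The sum of all column indices does not change, so \<open>t\<close> may be replaced by
  \<open>t - \<theta>\<close>, and then each entry contributes a non-negative amount to the difference.\<close>

lemma garnir_measure:
  assumes t: "t \<in> Tab" and inc: "col_incr t" and ij: "(i, j') \<in> D" "j < j'"
    and viol: "t (i, j') < t (i, j)"
    and Z: "Z \<in> exchanges (leg i j \<union> col_top i j') (leg i j)" "Z \<noteq> leg i j"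
    and p: "\<pi> permutes (leg i j \<union> col_top i j')" "\<pi> ` leg i j = Z"
  shows "(\<Sum>b\<in>D. int (snd b) * t b) < (\<Sum>b\<in>D. int (snd b) * t (\<pi> b))"
proof -
  let ?U = "leg i j" and ?Y = "col_top i j'" and ?q = "pinv \<pi>"
  have fin: "finite ?U" "finite ?Y" using finD by (auto simp: leg_def col_top_def)
  have pD: "\<pi> permutes D" using p(1) by (rule permutes_subset) (auto simp: leg_def col_top_def)
  have q: "?q permutes (?U \<union> ?Y)" using p(1) by (rule permutes_inv)
  define \<theta> where "\<theta> = t (i, j)"
  have D: "(i, j) \<in> D" using down[OF ij(1), of i j] ij by simp
  have tU: "\<theta> \<le> t b" if b: "b \<in> ?U" for b
  proof -
    obtain x where x: "b = (x, j)" "(x, j) \<in> D" "i \<le> x"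
      using b by (cases b) (auto simp: leg_def)
    then show ?thesis using inc unfolding \<theta>_def col_incr_def by (cases "i = x") (auto intro: less_imp_le)
  qed
  have tY: "t b < \<theta>" if b: "b \<in> ?Y" for b
  proof -
    obtain x where x: "b = (x, j')" "x \<le> i"
      using b by (cases b) (auto simp: col_top_def)
    then have "t b \<le> t (i, j')"
      using inc ij unfolding col_incr_def by (cases "i = x") (auto intro: less_imp_le)
    then show ?thesis using viol by (simp add: \<theta>_def)
  qed
  have re: "(\<Sum>b\<in>D. f (?q b) (b::nat\<times>nat)) = (\<Sum>b\<in>D. f b (\<pi> b))" for f :: "nat \<times> nat \<Rightarrow> nat \<times> nat \<Rightarrow> int"
    using sum.permute[OF pD, of "\<lambda>b. f (?q b) b"] pD by (simp add: o_def permutes_inverses)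
  have sndq: "snd (?q b) \<in> {j, j'}" if "b \<in> ?U \<union> ?Y" for b
    using permutes_in_image[OF q, of b] that by (auto simp: leg_def col_top_def)
  have nn: "(int (snd (?q b)) - int (snd b)) * (t b - \<theta>) \<ge> 0" if "b \<in> D" for b
  proof -
    consider "b \<in> ?U" | "b \<in> ?Y" | "b \<notin> ?U \<union> ?Y" by auto
    then show ?thesis
    proof cases
      case 1
      then have "snd b = j" "j \<le> snd (?q b)" using sndq[of b] ij by (auto simp: leg_def)
      then show ?thesis using tU[OF 1] by simp
    next
      case 2
      then have "snd b = j'" "snd (?q b) \<le> j'" using sndq[of b] ij by (auto simp: col_top_def)
      then show ?thesis using tY[OF 2] by (simp add: mult_nonpos_nonpos)
    next
      case 3
      then show ?thesis using permutes_not_in[OF q] by simp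
    qed
  qed
  (* a box of column j' whose entry moves to column j makes the difference positive *)
  have "\<exists>b\<in>Z. b \<notin> ?U"
    using Z fin card_subset_eq[of ?U Z] by (auto simp: exchanges_def)
  then obtain b where b: "b \<in> Z" "b \<notin> ?U" by blast
  then have bY: "b \<in> ?Y" using Z by (auto simp: exchanges_def)
  have "?q b \<in> ?U" using b p(2) p(1) by (auto simp: permutes_inverses)
  then have "snd (?q b) = j" by (simp add: leg_def)
  moreover have "snd b = j'" "b \<in> D" using bY by (auto simp: col_top_def)
  ultimately have pos: "(int (snd (?q b)) - int (snd b)) * (t b - \<theta>) > 0"
    using tY[OF bY] ij by (simp add: mult_neg_neg)
  have "0 < (\<Sum>b\<in>D. (int (snd (?q b)) - int (snd b)) * (t b - \<theta>))"
    using finD \<open>b \<in> D\<close> pos nn by (rule sum_pos2)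
  also have "\<dots> = (\<Sum>b\<in>D. int (snd (?q b)) * t b) - (\<Sum>b\<in>D. int (snd b) * t b)
      - ((\<Sum>b\<in>D. int (snd (?q b)) * \<theta>) - (\<Sum>b\<in>D. int (snd b) * \<theta>))"
    by (simp add: algebra_simps sum.distrib sum_subtractf)
  also have "(\<Sum>b\<in>D. int (snd (?q b)) * t b) = (\<Sum>b\<in>D. int (snd b) * t (\<pi> b))"
    using re[of "\<lambda>c b. int (snd c) * t b"] .
  also have "(\<Sum>b\<in>D. int (snd (?q b)) * \<theta>) = (\<Sum>b\<in>D. int (snd b) * \<theta>)"
    using re[of "\<lambda>c b. int (snd c) * \<theta>"] .
  finally show ?thesis by simp
qed

text \<open>Straightening: after sorting the columns, a Garnir relation expresses the value at a
  non-standard tableau by values at tableaux with larger sum of column index times entry. As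
  there are only finitely many tableaux, induction applies.\<close>

lemma garnir_fun_zero:
  assumes G: "garnir_fun G" and van: "\<And>s. s \<in> Std \<Longrightarrow> G s = (0::'k::field)" and t: "t \<in> Tab"
  shows "G t = 0"
  using t
proof (induction "card {t'\<in>Tab. (\<Sum>b\<in>D. int (snd b) * t b) < (\<Sum>b\<in>D. int (snd b) * t' b)}"
    arbitrary: t rule: less_induct)
  case less
  let ?m = "\<lambda>t. \<Sum>b\<in>D. int (snd b) * t b"
  have anti: "G (t \<circ> \<pi>) = of_int (sign \<pi>) * G t" if "t \<in> Tab" "\<pi> \<in> col_perms" for t \<pi>
    using G that by (auto simp: garnir_fun_def col_anti_def)
  obtain \<kappa> where k: "\<kappa> \<in> col_perms" "col_incr (t \<circ> \<kappa>)" using col_sort[OF less.prems] .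
  define u where "u = t \<circ> \<kappa>"
  have u: "u \<in> Tab" using k less.prems by (simp add: u_def Tab_comp col_perms_permutes)
  have "?m t = (\<Sum>b\<in>D. int (snd (\<kappa> b)) * t (\<kappa> b))"
    using sum.permute[OF col_perms_permutes[OF k(1)], of "\<lambda>b. int (snd b) * t b"] by (simp add: o_def)
  also have "\<dots> = ?m u" unfolding u_def
    by (rule sum.cong) (use k in \<open>auto simp: col_perms_def\<close>)
  finally have mu: "?m t = ?m u" .
  have IH: "G t' = 0" if t': "t' \<in> Tab" "?m u < ?m t'" for t'
  proof (rule less.hyps[OF _ t'(1)], rule psubset_card_mono)
    show "finite {t' \<in> Tab. ?m t < ?m t'}" using finTab by simp
    show "{t'' \<in> Tab. ?m t' < ?m t''} \<subset> {t' \<in> Tab. ?m t < ?m t'}"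
      using t' mu by (intro psubsetI) auto
  qed
  have "G u = 0"
  proof (cases "row_incr u")
    case True
    then show ?thesis using u k van by (simp add: Std_def u_def)
  next
    case False
    then obtain i j j' where ij: "(i, j') \<in> D" "j < j'" "\<not> u (i, j) < u (i, j')"
      by (auto simp: row_incr_def)
    have "(i, j) \<in> D" using down[OF ij(1), of i j] ij by simp
    then have viol: "u (i, j') < u (i, j)" using ij Tab_eqD[OF u, of "(i, j)" "(i, j')"] by auto
    let ?U = "leg i j" and ?Y = "col_top i j'"
    let ?B = "?U \<union> ?Y"
    have fin: "finite ?B" using finD by (auto simp: leg_def col_top_def)
    have BD: "?B \<subseteq> D" by (auto simp: leg_def col_top_def)
    have Uin: "?U \<in> exchanges ?B ?U" by (auto simp: exchanges_def)
    note rep = exchange_perm[OF fin Un_upper1]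
    have finE: "finite (exchanges ?B ?U)"
      by (rule finite_subset[OF _ finite_Pow_iff[THEN iffD2, OF fin]]) (auto simp: exchanges_def)
    have zero: "of_int (sign (exchange_perm ?B ?U Z)) * G (u \<circ> exchange_perm ?B ?U Z) = 0"
      if Z: "Z \<in> exchanges ?B ?U - {?U}" for Z
    proof -
      have Z': "Z \<in> exchanges ?B ?U" "Z \<noteq> ?U" using Z by auto
      have "?m u < (\<Sum>b\<in>D. int (snd b) * u (exchange_perm ?B ?U Z b))"
        by (rule garnir_measure[OF u _ ij(1,2) viol Z' rep[OF Z'(1)]]) (use k in \<open>simp only: u_def\<close>)
      then have "G (u \<circ> exchange_perm ?B ?U Z) = 0"
        by (intro IH Tab_comp[OF u] permutes_subset[OF rep(1)[OF Z'(1)] BD]) simp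
      then show ?thesis by simp
    qed
    have "garnir_sum G u ?B ?U = 0" using G u ij by (simp add: garnir_fun_def)
    then have "of_int (sign (exchange_perm ?B ?U ?U)) * G (u \<circ> exchange_perm ?B ?U ?U) = 0"
      unfolding garnir_sum_def sum.remove[OF finE Uin] using zero by simp
    moreover have "of_int (sign (exchange_perm ?B ?U ?U)) * G (u \<circ> exchange_perm ?B ?U ?U) = of_int (sign (id :: nat \<times> nat \<Rightarrow> nat \<times> nat)) * G (u \<circ> id)"
      by (rule exchange_perm_indep[of G u ?B ?U j j'])
        (use G u BD rep[OF Uin] in \<open>auto simp: garnir_fun_def leg_def col_top_def permutes_id\<close>)
    ultimately show ?thesis by simp
  qed
  then show ?case using anti[OF less.prems k(1)] by (auto simp: u_def sign_def split: if_splits)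
qed

lemma Tab_transpose:
  assumes t: "t \<in> Tab" and b: "b \<in> D" "b' \<in> D"
  shows "transpose (t b) (t b') \<circ> t = t \<circ> transpose b b'"
proof
  fix c
  have "t c = t d \<longleftrightarrow> c = d" if "d \<in> D" for d
  proof (cases "c \<in> D")
    case False
    then have "t c = 0" using t by (simp add: Tab_def)
    moreover have "t d \<noteq> 0" using Tab_in[OF t that] A0 by auto
    ultimately show ?thesis using False that by auto
  qed (use Tab_eqD[OF t] that in auto)
  then show "(transpose (t b) (t b') \<circ> t) c = (t \<circ> transpose b b') c"
    using b by (auto simp: transpose_def)
qed

lemma Tab_transpose_permutes:
  "t \<in> Tab \<Longrightarrow> b \<in> D \<Longrightarrow> b' \<in> D \<Longrightarrow> transpose (t b) (t b') permutes A"
  by (intro permutes_swap_id Tab_in)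

text \<open>If the tabloid of \<open>u\<close> has two of the exchanged entries in one row, then it is fixed by
  their transposition, while the Garnir element is negated. Otherwise it does not occur at
  all: in each tableau that contributes, the exchanged entries are in columns \<open>j\<close> and \<open>j'\<close>,
  which have fewer rows than there are such entries.\<close>

lemma garnir_sum_pt_coeff:
  assumes two: "(2::'k::field) \<noteq> 0" and t: "t \<in> Tab" and u: "u \<in> Tab"
    and ij: "(i, j') \<in> D" "j < j'"
  shows "garnir_sum (\<lambda>t. pt_coeff t u :: 'k) t (leg i j \<union> col_top i j') (leg i j) = 0"
proof -
  let ?U = "leg i j" and ?Y = "col_top i j'"
  let ?B = "?U \<union> ?Y"
  let ?r = "exchange_perm ?B ?U"
  have BD: "?B \<subseteq> D" by (auto simp: leg_def col_top_def)
  have fin: "finite ?B" using BD finD finite_subset by blast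
  note rep = exchange_perm[OF fin Un_upper1]
  have anti: "col_anti (\<lambda>t. pt_coeff t u :: 'k)" by (simp add: col_anti_def pt_coeff_col_perms)
  show ?thesis
  proof (cases "\<exists>b\<in>?B. \<exists>b'\<in>?B. \<exists>c\<in>D. \<exists>c'\<in>D. b \<noteq> b' \<and> u c = t b \<and> u c' = t b' \<and> fst c = fst c'")
    case True
    then obtain b b' c c' where b: "b \<in> ?B" "b' \<in> ?B" "b \<noteq> b'" and c: "c \<in> D" "c' \<in> D" "fst c = fst c'"
      and uc: "u c = t b" "u c' = t b'" by blast
    have bD: "b \<in> D" "b' \<in> D" using b BD by auto
    let ?s = "transpose (t b) (t b')"
    have sA: "?s permutes A" using Tab_transpose_permutes[OF t bD] .
    have st: "?s \<circ> t = t \<circ> transpose b b'" using Tab_transpose[OF t bD] .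
    have su: "?s \<circ> u = u \<circ> transpose c c'" using Tab_transpose[OF u c(1,2)] uc by simp
    have "transpose c c' \<in> row_perms" using c by (auto simp: row_perms_def permutes_swap_id transpose_def)
    then have row: "roweq u (?s \<circ> u)" unfolding su roweq_def by blast
    have "pt_coeff (t \<circ> p) u = (pt_coeff (t \<circ> transpose b b' \<circ> p) u :: 'k)" for p
    proof -
      have "pt_coeff (t \<circ> p) u = (pt_coeff (?s \<circ> (t \<circ> p)) (?s \<circ> u) :: 'k)"
        by (rule pt_coeff_act[OF sA, symmetric])
      also have "\<dots> = pt_coeff (?s \<circ> t \<circ> p) u" unfolding comp_assoc by (rule pt_coeff_roweq[OF row, symmetric])
      finally show ?thesis by (simp add: st)
    qed
    then have "garnir_sum (\<lambda>t. pt_coeff t u :: 'k) t ?B ?U = garnir_sum (\<lambda>t. pt_coeff t u) (t \<circ> transpose b b') ?B ?U"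
      by (simp add: garnir_sum_def)
    also have "\<dots> = - garnir_sum (\<lambda>t. pt_coeff t u) t ?B ?U"
      by (rule garnir_sum_transpose[OF anti t BD Un_upper1 _ _ b, of j j']) (auto simp: leg_def col_top_def)
    finally show ?thesis using eq_neg_self_imp_zero two by blast
  next
    case False
    have "pt_coeff (t \<circ> ?r Z) u = (0::'k)" if Z: "Z \<in> exchanges ?B ?U" for Z
    proof -
      note r = rep[OF Z]
      have "\<not> roweq (t \<circ> ?r Z \<circ> \<pi>) u" if p: "\<pi> \<in> col_perms" for \<pi>
      proof
        assume "roweq (t \<circ> ?r Z \<circ> \<pi>) u"
        then obtain \<rho> where \<rho>: "\<rho> \<in> row_perms" "u = t \<circ> ?r Z \<circ> \<pi> \<circ> \<rho>" by (auto simp: roweq_def)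
        define f where "f b = pinv \<pi> (pinv (?r Z) b)" for b
        have rD: "?r Z permutes D" using permutes_subset[OF r(1) BD] .
        have fD: "f b \<in> D" if "b \<in> D" for b
          using that permutes_in_image[OF permutes_inv[OF rD]] permutes_in_image[OF permutes_inv[OF col_perms_permutes[OF p]]]
          by (simp add: f_def)
        have fcol: "(fst (f b), j) \<in> D" if b: "b \<in> ?B" for b
        proof -
          have "pinv (?r Z) b \<in> ?B" using b permutes_in_image[OF permutes_inv[OF r(1)]] by simp
          then have "snd (pinv (?r Z) b) \<in> {j, j'}" by (auto simp: leg_def col_top_def)
          moreover have "snd (f b) = snd (pinv (?r Z) b)" using col_perms_inv[OF p] by (simp add: col_perms_def f_def)
          ultimately have "j \<le> snd (f b)" using ij by auto
          moreover have "(fst (f b), snd (f b)) \<in> D" using fD[OF subsetD[OF BD b]] by simp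
          ultimately show ?thesis using down[of "fst (f b)" "snd (f b)" "fst (f b)" j] by simp
        qed
        let ?R = "{x. (x, j) \<in> D}"
        have finR: "finite ?R"
          by (rule finite_subset[of _ "fst ` D"]) (use finD in \<open>auto intro: rev_image_eqI\<close>)
        have "card ?R < card ?B"
        proof -
          have "?R \<subseteq> fst ` ?U \<union> {..<i}" by (force simp: leg_def)
          then have "card ?R \<le> card (fst ` ?U \<union> {..<i})" using fin by (intro card_mono) auto
          also have "\<dots> \<le> card (fst ` ?U) + card {..<i}" by (rule card_Un_le)
          also have "\<dots> \<le> card ?U + i" using card_image_le[of ?U fst] fin by simp
          also have "\<dots> < card ?U + card ?Y"
          proof -
            have "(\<lambda>x. (x, j')) ` {..i} \<subseteq> ?Y" using down[OF ij(1)] by (auto simp: col_top_def)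
            then have "card ((\<lambda>x. (x, j')) ` {..i}) \<le> card ?Y" using fin by (intro card_mono) auto
            moreover have "card ((\<lambda>x. (x, j')) ` {..i}) = Suc i" by (subst card_image) (auto simp: inj_on_def)
            ultimately show ?thesis by simp
          qed
          also have "\<dots> = card ?B"
            by (rule card_Un_disjoint[symmetric]) (use fin ij in \<open>auto simp: leg_def col_top_def\<close>)
          finally show ?thesis .
        qed
        moreover have "card ((\<lambda>b. fst (f b)) ` ?B) \<le> card ?R"
          using fcol finR by (intro card_mono) auto
        ultimately have "\<not> inj_on (\<lambda>b. fst (f b)) ?B" by (intro pigeonhole) simp
        then obtain b b' where b: "b \<in> ?B" "b' \<in> ?B" "b \<noteq> b'" "fst (f b) = fst (f b')"
          by (auto simp: inj_on_def)
        define c where "c b = pinv \<rho> (f b)" for b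
        have rp: "\<rho> permutes D" using \<rho> by (simp add: row_perms_def)
        have uc: "u (c b) = t b" for b
          using \<rho>(2) rp p rD by (simp add: c_def f_def permutes_inverses col_perms_permutes[THEN permutes_inverses(1)])
        have cD: "c b \<in> D" if "b \<in> D" for b
          using fD[OF that] permutes_in_image[OF permutes_inv[OF rp]] by (simp add: c_def)
        have cf: "fst (c b) = fst (f b)" for b using row_perms_inv[OF \<rho>(1)] by (simp add: row_perms_def c_def)
        have "c b \<in> D" "c b' \<in> D" using cD[OF subsetD[OF BD]] b by simp_all
        then show False using False b uc cf by metis
      qed
      then show ?thesis by (auto simp: pt_coeff_def intro!: sum.neutral)
    qed
    then show ?thesis by (simp add: garnir_sum_def)
  qed
qed

lemma garnir_fun_pt_coeff: "(2::'k::field) \<noteq> 0 \<Longrightarrow> u \<in> Tab \<Longrightarrow> garnir_fun (\<lambda>t. pt_coeff t u :: 'k)"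
  unfolding garnir_fun_def using garnir_sum_pt_coeff by (auto simp: col_anti_def pt_coeff_col_perms)

lemma garnir_fun_diff_comb:
  assumes "garnir_fun h" "\<And>u. u \<in> S \<Longrightarrow> garnir_fun (g u)"
  shows "garnir_fun (\<lambda>t. h t - (\<Sum>u\<in>S. y u * g u t) :: 'k::field)"
proof -
  have lin: "garnir_sum (\<lambda>t. h t - (\<Sum>u\<in>S. y u * g u t)) t B U =
      garnir_sum h t B U - (\<Sum>u\<in>S. y u * garnir_sum (g u) t B U)" for t B U
    unfolding garnir_sum_def right_diff_distrib sum_subtractf
    by (subst sum_distrib_left, subst sum_distrib_left, subst sum.swap) (simp add: mult.left_commute)
  show ?thesis
    unfolding garnir_fun_def
  proof safe
    show "col_anti (\<lambda>t. h t - (\<Sum>u\<in>S. y u * g u t))"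
      unfolding col_anti_def
    proof safe
      fix t \<pi> assume t: "t \<in> Tab" "\<pi> \<in> col_perms"
      have "h (t \<circ> \<pi>) = of_int (sign \<pi>) * h t" using assms t by (auto simp: garnir_fun_def col_anti_def)
      moreover have "g u (t \<circ> \<pi>) = of_int (sign \<pi>) * g u t" if "u \<in> S" for u
        using assms that t by (auto simp: garnir_fun_def col_anti_def)
      ultimately show "h (t \<circ> \<pi>) - (\<Sum>u\<in>S. y u * g u (t \<circ> \<pi>)) =
          of_int (sign \<pi>) * (h t - (\<Sum>u\<in>S. y u * g u t))"
        by (simp add: right_diff_distrib sum_distrib_left mult.left_commute)
    qed
  next
    fix t i j j' assume "t \<in> Tab" "(i, j') \<in> D" "j < (j'::nat)"
    then show "garnir_sum (\<lambda>t. h t - (\<Sum>u\<in>S. y u * g u t)) t (leg i j \<union> col_top i j') (leg i j) = 0"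
      unfolding lin using assms by (auto simp: garnir_fun_def)
  qed
qed

text \<open>The unitriangular system yields a combination of coefficient functions that agrees with
  \<open>h\<close> at the standard tableaux, and two functions that satisfy the column and Garnir relations
  and agree there are equal.\<close>

lemma garnir_fun_comb_pt_coeff:
  assumes two: "(2::'k::field) \<noteq> 0" and h: "garnir_fun (h :: tab \<Rightarrow> 'k)"
  shows "\<exists>y. \<forall>t\<in>Tab. h t = (\<Sum>u\<in>Tab. y u * pt_coeff t u)"
proof -
  have fS: "finite Std" using finTab by (rule rev_finite_subset) (auto simp: Std_def)
  have "\<exists>y. \<forall>s\<in>Std. h s = (\<Sum>u\<in>Std. y u * pt_coeff s u)"
    by (rule unitriangular_solve[OF fS, of _ row_weight]) (use pt_coeff_Std_diag pt_coeff_Std_less in blast)+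
  then obtain y where y: "\<And>s. s \<in> Std \<Longrightarrow> h s = (\<Sum>u\<in>Std. y u * pt_coeff s u)" by blast
  have "garnir_fun (\<lambda>t. h t - (\<Sum>u\<in>Std. y u * pt_coeff t u))"
    by (rule garnir_fun_diff_comb[OF h garnir_fun_pt_coeff[OF two]]) (simp add: Std_def)
  then have "h t - (\<Sum>u\<in>Std. y u * pt_coeff t u) = 0" if "t \<in> Tab" for t
    by (rule garnir_fun_zero) (use y that in auto)
  moreover have "(\<Sum>u\<in>Tab. (if u \<in> Std then y u else 0) * pt_coeff t u) = (\<Sum>u\<in>Std. y u * pt_coeff t u)" for t
    by (rule sum.mono_neutral_cong_right) (use finTab in \<open>auto simp: Std_def\<close>)
  ultimately have "\<forall>t\<in>Tab. h t = (\<Sum>u\<in>Tab. (if u \<in> Std then y u else 0) * pt_coeff t u)"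
    by simp
  then show ?thesis by (rule exI[of _ "\<lambda>u. if u \<in> Std then y u else 0"])
qed

text \<open>The assumption says that the values of \<open>h\<close> on linear relations between polytabloids are
  invariant under \<open>S\<^sub>r\<close>. The Garnir relation is negated by a transposition, so the value of
  \<open>h\<close> on it equals its own negative. The index type is the one needed for the Garnir
  relations.\<close>

lemma garnir_funI:
  assumes two: "(2::'k::field) \<noteq> 0" and anti: "col_anti (h :: tab \<Rightarrow> 'k)"
    and inv: "\<And>s (I :: (nat \<times> nat) set set) c f. s permutes A \<Longrightarrow> finite I \<Longrightarrow> f ` I \<subseteq> Tab \<Longrightarrow>
      (\<And>u. u \<in> Tab \<Longrightarrow> (\<Sum>i\<in>I. c i * pt_coeff (f i) u) = (0::'k)) \<Longrightarrow>
      (\<Sum>i\<in>I. c i * (h (s \<circ> f i) - h (f i))) = 0"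
  shows "garnir_fun h"
  unfolding garnir_fun_def
proof (intro conjI anti ballI allI impI)
  fix t i j j' assume t: "t \<in> Tab" and ij: "(i, j') \<in> D" "j < (j'::nat)"
  let ?U = "leg i j" and ?Y = "col_top i j'"
  let ?B = "?U \<union> ?Y"
  let ?r = "exchange_perm ?B ?U"
  have BD: "?B \<subseteq> D" by (auto simp: leg_def col_top_def)
  have fin: "finite ?B" using BD finD finite_subset by blast
  note rep = exchange_perm[OF fin Un_upper1]
  have finE: "finite (exchanges ?B ?U)"
    by (rule finite_subset[OF _ finite_Pow_iff[THEN iffD2, OF fin]]) (auto simp: exchanges_def)
  have D: "(i, j) \<in> D" using down[OF ij(1), of i j] ij by simp
  have b: "(i, j) \<in> ?B" "(i, j') \<in> ?B" "(i, j) \<noteq> (i, j')"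
    using D ij by (auto simp: leg_def col_top_def)
  let ?s = "transpose (t (i, j)) (t (i, j'))"
  have st: "?s \<circ> t = t \<circ> transpose (i, j) (i, j')" using Tab_transpose[OF t D ij(1)] .
  have "(\<Sum>Z\<in>exchanges ?B ?U. of_int (sign (?r Z)) * (h (?s \<circ> (t \<circ> ?r Z)) - h (t \<circ> ?r Z))) = 0"
  proof (rule inv[OF Tab_transpose_permutes[OF t D ij(1)] finE])
    show "(\<lambda>Z. t \<circ> ?r Z) ` exchanges ?B ?U \<subseteq> Tab"
      using Tab_comp[OF t permutes_subset[OF rep(1) BD]] by blast
  qed (use garnir_sum_pt_coeff[OF two t _ ij] in \<open>simp add: garnir_sum_def\<close>)
  then have "garnir_sum h (t \<circ> transpose (i, j) (i, j')) ?B ?U = garnir_sum h t ?B ?U"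
    by (simp add: garnir_sum_def right_diff_distrib sum_subtractf comp_assoc[symmetric] st)
  moreover have "garnir_sum h (t \<circ> transpose (i, j) (i, j')) ?B ?U = - garnir_sum h t ?B ?U"
    by (rule garnir_sum_transpose[OF anti t BD Un_upper1 _ _ b, of j j']) (auto simp: leg_def col_top_def)
  ultimately show "garnir_sum h t ?B ?U = 0" using eq_neg_self_imp_zero two by metis
qed

lemma Tab_transition:
  assumes t: "t \<in> Tab" and u: "u \<in> Tab"
  obtains \<rho> where "\<rho> permutes D" "u = t \<circ> \<rho>"
proof -
  define \<rho> where "\<rho> b = (if b \<in> D then inv_into D t (u b) else b)" for b
  have bt: "bij_betw t D A" and bu: "bij_betw u D A" using t u by (auto simp: Tab_def)
  have "bij_betw (inv_into D t \<circ> u) D D" using bu bij_betw_inv_into[OF bt] by (rule bij_betw_trans)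
  then have "bij_betw \<rho> D D" by (rule bij_betw_cong[THEN iffD1, rotated]) (simp add: \<rho>_def)
  then have p: "\<rho> permutes D" by (rule bij_imp_permutes) (simp add: \<rho>_def)
  have "u b = t (\<rho> b)" for b
  proof (cases "b \<in> D")
    case True
    then show ?thesis using bu bt f_inv_into_f[of "u b" t D] by (auto simp: \<rho>_def bij_betw_def)
  qed (use t u in \<open>simp add: \<rho>_def Tab_def\<close>)
  then show thesis using that[OF p] by (simp add: fun_eq_iff)
qed

lemma Tab_map_permutation:
  assumes t: "t \<in> Tab" and p: "\<pi> permutes D"
  shows "map_permutation D t \<pi> permutes A" "map_permutation D t \<pi> \<circ> t = t \<circ> \<pi>"
    "sign (map_permutation D t \<pi>) = sign \<pi>"
proof -
  have bt: "bij_betw t D A" using t by (simp add: Tab_def)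
  have inj: "inj_on t D" using bt by (simp add: bij_betw_def)
  show m: "map_permutation D t \<pi> permutes A" by (rule map_permutation_permutes[OF bt p])
  show "sign (map_permutation D t \<pi>) = sign \<pi>" by (rule sign_map_permutation[OF inj p finD])
  show "map_permutation D t \<pi> \<circ> t = t \<circ> \<pi>"
  proof
    fix b show "(map_permutation D t \<pi> \<circ> t) b = (t \<circ> \<pi>) b"
    proof (cases "b \<in> D")
      case True
      then show ?thesis by (simp add: map_permutation_apply[OF inj])
    next
      case False
      then have "t b = 0" "\<pi> b = b" using t permutes_not_in[OF p] by (auto simp: Tab_def)
      then show ?thesis using permutes_not_in[OF m A0] by simp
    qed
  qed
qed

section \<open>Cocycles of the symmetric group\<close>

text \<open>Composing \<open>\<pi>\<close> with the transposition of \<open>b\<close> and \<open>\<pi> b\<close> makes \<open>b\<close> a fixed box, and the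
  transposition is again a column permutation.\<close>

lemma col_perms_induct [consumes 1, case_names id swap]:
  assumes "\<pi> \<in> col_perms" "P id"
    and step: "\<And>\<pi> c c'. \<pi> \<in> col_perms \<Longrightarrow> P \<pi> \<Longrightarrow> c \<in> D \<Longrightarrow> c' \<in> D \<Longrightarrow> c \<noteq> c' \<Longrightarrow> snd c = snd c' \<Longrightarrow> P (transpose c c' \<circ> \<pi>)"
  shows "P \<pi>"
  using assms(1)
proof (induction "card {b. \<pi> b \<noteq> b}" arbitrary: \<pi> rule: less_induct)
  case less
  show ?case
  proof (cases "\<pi> = id")
    case False
    then obtain b where b: "\<pi> b \<noteq> b" by (auto simp: fun_eq_iff)
    have p: "\<pi> permutes D" using col_perms_permutes[OF less.prems] .
    have D: "b \<in> D" using b permutes_not_in[OF p] by blast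
    then have D: "b \<in> D" "\<pi> b \<in> D" using permutes_in_image[OF p] by auto
    have sn: "snd b = snd (\<pi> b)" using less.prems by (simp add: col_perms_def)
    define \<pi>' where "\<pi>' = transpose b (\<pi> b) \<circ> \<pi>"
    have "\<pi>' \<in> col_perms" unfolding \<pi>'_def by (rule col_perms_comp[OF transpose_col_perms[OF D sn] less.prems])
    moreover have "card {c. \<pi>' c \<noteq> c} < card {c. \<pi> c \<noteq> c}"
    proof (rule psubset_card_mono)
      have "{c. \<pi> c \<noteq> c} \<subseteq> D" using p by (auto simp: permutes_def)
      then show "finite {c. \<pi> c \<noteq> c}" using finD finite_subset by blast
      have "\<pi>' c = c" if "\<pi> c = c" for c
        using that b permutes_inj[OF p] by (auto simp: \<pi>'_def transpose_def dest: injD)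
      moreover have "\<pi>' b = b" by (simp add: \<pi>'_def)
      ultimately show "{c. \<pi>' c \<noteq> c} \<subset> {c. \<pi> c \<noteq> c}" using b by (auto intro!: psubsetI)
    qed
    ultimately have "P \<pi>'" using less.hyps by blast
    then have "P (transpose b (\<pi> b) \<circ> \<pi>')"
      using \<open>\<pi>' \<in> col_perms\<close> D b sn by (intro step) auto
    moreover have "transpose b (\<pi> b) \<circ> \<pi>' = \<pi>" by (simp add: \<pi>'_def fun_eq_iff)
    ultimately show ?thesis by simp
  qed (use assms in simp)
qed

text \<open>If no column has two boxes, then there is only one row, and only one tabloid.\<close>

lemma pt_coeff_one_row:
  assumes triv: "\<And>b b'. b \<in> D \<Longrightarrow> b' \<in> D \<Longrightarrow> snd b = snd b' \<Longrightarrow> b = b'"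
    and t: "t \<in> Tab" and u: "u \<in> Tab"
  shows "pt_coeff t u = (1::'k::field)"
proof -
  have "\<pi> = id" if "\<pi> \<in> col_perms" for \<pi>
    using that by (induction rule: col_perms_induct) (use triv in auto)
  then have col_perms: "col_perms = {id}" using col_perms_id by auto
  have f0: "fst b = 0" if "b \<in> D" for b
    using triv[OF that, of "(0, snd b)"] down[of "fst b" "snd b" 0 "snd b"] that
    by (metis fst_conv le0 le_refl prod.collapse snd_conv)
  obtain \<rho> where p: "\<rho> permutes D" and u_eq: "u = t \<circ> \<rho>" using Tab_transition[OF t u] .
  have "fst (\<rho> b) = fst b" for b
    using f0[of b] f0[of "\<rho> b"] permutes_in_image[OF p, of b] permutes_not_in[OF p, of b] by (cases "b \<in> D") auto
  then have "\<rho> \<in> row_perms" using p by (simp add: row_perms_def)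
  then have "roweq t u" using u_eq by (auto simp: roweq_def)
  then have "{\<pi> \<in> col_perms. roweq (t \<circ> \<pi>) u} = {id}" using col_perms by auto
  then show ?thesis by (simp add: pt_coeff_def)
qed

text \<open>This is the vanishing of the first cohomology of \<open>S\<^sub>r\<close> with values in a dual Specht
  module, with the cocycle given by its values \<open>\<beta> \<sigma> t\<close> at polytabloids. The second assumption
  on \<open>\<beta>\<close> says that \<open>\<beta> \<sigma> t\<close> depends linearly on the polytabloid of \<open>t\<close>. The conclusion exhibits
  \<open>\<beta>\<close> as the coboundary of the linear form with coordinates \<open>y\<close>.\<close>

theorem symmetric_group_cocycle_inner:
  fixes \<beta> :: "(int \<Rightarrow> int) \<Rightarrow> tab \<Rightarrow> 'k::field"
  assumes two: "(2::'k) \<noteq> 0" and three: "(3::'k) \<noteq> 0"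
    and coc: "\<And>\<sigma> \<tau> t. \<sigma> permutes A \<Longrightarrow> \<tau> permutes A \<Longrightarrow> t \<in> Tab \<Longrightarrow> \<beta> (\<tau> \<circ> \<sigma>) t = \<beta> \<tau> (\<sigma> \<circ> t) + \<beta> \<sigma> t"
    and rel: "\<And>\<sigma> (I :: (nat \<times> nat) set set) c f. \<sigma> permutes A \<Longrightarrow> finite I \<Longrightarrow> f ` I \<subseteq> Tab \<Longrightarrow>
      (\<And>u. u \<in> Tab \<Longrightarrow> (\<Sum>i\<in>I. c i * pt_coeff (f i) u) = (0::'k)) \<Longrightarrow> (\<Sum>i\<in>I. c i * \<beta> \<sigma> (f i)) = 0"
  shows "\<exists>y. \<forall>\<sigma> t. \<sigma> permutes A \<longrightarrow> t \<in> Tab \<longrightarrow>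
    \<beta> \<sigma> t = (\<Sum>u\<in>Tab. y u * (pt_coeff (\<sigma> \<circ> t) u - pt_coeff t u))"
proof -
  have \<beta>_prop: "\<beta> \<sigma> t' = a * \<beta> \<sigma> t"
    if "\<sigma> permutes A" "t \<in> Tab" "t' \<in> Tab" "\<And>u. u \<in> Tab \<Longrightarrow> pt_coeff t' u = a * (pt_coeff t u :: 'k)" for \<sigma> t t' a
  proof -
    (* a two-element index set of the required type *)
    let ?I = "{{}, {(0::nat, 0::nat)}}"
    have "(\<Sum>i\<in>?I. (if i = {} then 1 else - a) * \<beta> \<sigma> (if i = {} then t' else t)) = 0"
      by (rule rel) (use that in auto)
    then show ?thesis by simp
  qed
  have \<beta>_col_perms: "\<beta> \<sigma> (t \<circ> \<pi>) = of_int (sign \<pi>) * \<beta> \<sigma> t"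
    if "\<sigma> permutes A" "t \<in> Tab" "\<pi> \<in> col_perms" for \<sigma> t \<pi>
    using that by (intro \<beta>_prop) (auto simp: Tab_comp col_perms_permutes pt_coeff_col_perms)
  show ?thesis
  proof (cases "\<exists>a\<in>D. \<exists>a'\<in>D. a \<noteq> a' \<and> snd a = snd a'")
    case False
    have \<beta>_const: "\<beta> \<sigma> t' = \<beta> \<sigma> t" if "\<sigma> permutes A" "t \<in> Tab" "t' \<in> Tab" for \<sigma> t t'
      using \<beta>_prop[OF that, of 1] pt_coeff_one_row False that by (metis mult_1)
    have pt1: "pt_coeff t u = (1::'k)" if "t \<in> Tab" "u \<in> Tab" for t u
      using pt_coeff_one_row[OF _ that] False by blast
    have \<beta>_id: "\<beta> id t = 0" if "t \<in> Tab" for t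
    proof -
      have "\<beta> id t = \<beta> id t + \<beta> id t" using coc[OF permutes_id permutes_id that] by (simp only: comp_id id_comp)
      then show ?thesis by (metis add.right_neutral add_left_cancel)
    qed
    have \<beta>_tr: "\<beta> (transpose x y) t = 0" if t: "t \<in> Tab" and xy: "x \<in> A" "y \<in> A" for x y t
    proof -
      have s: "transpose x y permutes A" using xy by (rule permutes_swap_id)
      have "0 = \<beta> (transpose x y) (transpose x y \<circ> t) + \<beta> (transpose x y) t"
        using coc[OF s s t] \<beta>_id[OF t] by simp
      then have "2 * \<beta> (transpose x y) t = 0" using \<beta>_const[OF s t Tab_act[OF t s]] by simp
      then show ?thesis using two by simp
    qed
    have "\<beta> \<sigma> t = 0" if "\<sigma> permutes A" "t \<in> Tab" for \<sigma> t
      using that(1) finA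
    proof (induction rule: permutes_induct)
      case (swap x y p)
      then show ?case
        using coc[OF \<open>p permutes A\<close> permutes_swap_id[of x A y] that(2)]
          \<beta>_tr[OF Tab_act[OF that(2) \<open>p permutes A\<close>], of x y] by (simp add: comp_def)
    qed (use \<beta>_id that in \<open>simp add: id_def\<close>)
    then show ?thesis by (intro exI[of _ "\<lambda>_. 0"]) simp
  next
    case True
    then obtain a a' where a: "a \<in> D" "a' \<in> D" "a \<noteq> a'" "snd a = snd a'" by blast
    let ?s = "\<lambda>t b b'. transpose (t b) (t b' :: int)"
    (* two transpositions along columns of t give the same value, by the relation between them *)
    have swap_val: "\<beta> (?s t b b') t = \<beta> (?s t c c') t"
      if t: "t \<in> Tab" and b: "b \<in> D" "b' \<in> D" "b \<noteq> b'" "snd b = snd b'"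
        and c: "c \<in> D" "c' \<in> D" "c \<noteq> c'" "snd c = snd c'" for t b b' c c'
    proof -
      let ?x = "?s t b b'" and ?y = "?s t c c'"
      have x: "?x permutes A" "?x \<circ> t = t \<circ> transpose b b'" "transpose b b' \<in> col_perms"
        and y: "?y permutes A" "?y \<circ> t = t \<circ> transpose c c'" "transpose c c' \<in> col_perms"
        using Tab_transpose_permutes Tab_transpose transpose_col_perms t b c by auto
      have \<beta>x: "\<beta> \<sigma> (?x \<circ> t) = - \<beta> \<sigma> t" and \<beta>y: "\<beta> \<sigma> (?y \<circ> t) = - \<beta> \<sigma> t"
        if "\<sigma> permutes A" for \<sigma>
        using \<beta>_col_perms[OF that t] x y b c by (simp_all add: sign_swap_id)
      have xt: "?x \<circ> t \<in> Tab" and yt: "?y \<circ> t \<in> Tab" using Tab_act[OF t x(1)] Tab_act[OF t y(1)] .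
      have \<beta>xx: "\<beta> \<sigma> (?y \<circ> (?x \<circ> t)) = \<beta> \<sigma> t" and \<beta>yy: "\<beta> \<sigma> (?x \<circ> (?y \<circ> t)) = \<beta> \<sigma> t"
        if s: "\<sigma> permutes A" for \<sigma>
      proof -
        have e1: "?y \<circ> (?x \<circ> t) = ?y \<circ> t \<circ> transpose b b'" by (simp only: x(2) comp_assoc)
        have e2: "?x \<circ> (?y \<circ> t) = ?x \<circ> t \<circ> transpose c c'" by (simp only: y(2) comp_assoc)
        show "\<beta> \<sigma> (?y \<circ> (?x \<circ> t)) = \<beta> \<sigma> t" "\<beta> \<sigma> (?x \<circ> (?y \<circ> t)) = \<beta> \<sigma> t"
          unfolding e1 e2 using \<beta>_col_perms[OF s yt x(3)] \<beta>_col_perms[OF s xt y(3)] \<beta>x[OF s] \<beta>y[OF s] b c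
          by (simp_all add: sign_swap_id)
      qed
      have xy: "\<beta> (?x \<circ> ?y) t = \<beta> ?y t - \<beta> ?x t" and yx: "\<beta> (?y \<circ> ?x) t = \<beta> ?x t - \<beta> ?y t"
        using coc[OF y(1) x(1) t] coc[OF x(1) y(1) t] \<beta>y[OF x(1)] \<beta>x[OF y(1)] by simp_all
      have "\<beta> (?x \<circ> (?y \<circ> ?x)) t = \<beta> ?x t + \<beta> (?y \<circ> ?x) t"
        using coc[OF permutes_compose[OF x(1) y(1)] x(1) t] \<beta>xx[OF x(1)] by (simp add: comp_assoc)
      then have xyx: "\<beta> (?x \<circ> (?y \<circ> ?x)) t = 2 * \<beta> ?x t - \<beta> ?y t" using yx by simp
      have "\<beta> (?y \<circ> (?x \<circ> ?y)) t = \<beta> ?y t + \<beta> (?x \<circ> ?y) t"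
        using coc[OF permutes_compose[OF y(1) x(1)] y(1) t] \<beta>yy[OF y(1)] by (simp add: comp_assoc)
      then have yxy: "\<beta> (?y \<circ> (?x \<circ> ?y)) t = 2 * \<beta> ?y t - \<beta> ?x t" using xy by simp
      from transpose_commute_or_braid[of "t b" "t b'" "t c" "t c'"]
      have "2 * (\<beta> ?x t - \<beta> ?y t) = 0 \<or> 3 * (\<beta> ?x t - \<beta> ?y t) = 0"
      proof
        assume "?x \<circ> ?y = ?y \<circ> ?x"
        then have e: "\<beta> ?x t - \<beta> ?y t = \<beta> ?y t - \<beta> ?x t" using xy yx by simp
        have "2 * (\<beta> ?x t - \<beta> ?y t) = (\<beta> ?x t - \<beta> ?y t) - (\<beta> ?y t - \<beta> ?x t)"
          by (simp add: algebra_simps)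
        then show ?thesis unfolding e by simp
      next
        assume "?x \<circ> (?y \<circ> ?x) = ?y \<circ> (?x \<circ> ?y)"
        then have e: "2 * \<beta> ?x t - \<beta> ?y t = 2 * \<beta> ?y t - \<beta> ?x t" using xyx yxy by metis
        have "3 * (\<beta> ?x t - \<beta> ?y t) = (2 * \<beta> ?x t - \<beta> ?y t) - (2 * \<beta> ?y t - \<beta> ?x t)"
          by (simp add: algebra_simps)
        also have "\<dots> = 0" unfolding e by (rule diff_self)
        finally show ?thesis by (rule disjI2)
      qed
      then show ?thesis using two three by simp
    qed
    (* the only possible value of a linear form at e_t, since the transposition negates e_t *)
    define h where "h t = - \<beta> (?s t a a') t / 2" for t
    have h2: "2 * h t = - \<beta> (?s t b b') t"
      if "t \<in> Tab" "b \<in> D" "b' \<in> D" "b \<noteq> b'" "snd b = snd b'" for t b b'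
      using swap_val[OF that a] two by (simp add: h_def)
    have h_act: "h (\<sigma> \<circ> t) = h t + \<beta> \<sigma> t" if s: "\<sigma> permutes A" and t: "t \<in> Tab" for \<sigma> t
    proof -
      let ?x = "?s t a a'" and ?y = "?s (\<sigma> \<circ> t) a a'"
      have x: "?x permutes A" and y: "?y permutes A"
        using Tab_transpose_permutes[OF t a(1,2)] Tab_transpose_permutes[OF Tab_act[OF t s] a(1,2)] by auto
      have "?y \<circ> \<sigma> = \<sigma> \<circ> ?x"
        using permutes_inj[OF s] by (auto simp: fun_eq_iff transpose_def dest: injD)
      then have "\<beta> ?y (\<sigma> \<circ> t) + \<beta> \<sigma> t = \<beta> \<sigma> (?x \<circ> t) + \<beta> ?x t"
        using coc[OF s y t] coc[OF x s t] by simp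
      moreover have "\<beta> \<sigma> (?x \<circ> t) = - \<beta> \<sigma> t"
        unfolding Tab_transpose[OF t a(1,2)] \<beta>_col_perms[OF s t transpose_col_perms[OF a(1,2,4)]]
        using a by (simp add: sign_swap_id)
      ultimately have "\<beta> ?y (\<sigma> \<circ> t) = \<beta> ?x t - 2 * \<beta> \<sigma> t" by (simp add: algebra_simps)
      then have "2 * h (\<sigma> \<circ> t) = 2 * (h t + \<beta> \<sigma> t)"
        using h2[OF t a] h2[OF Tab_act[OF t s] a] by (simp add: algebra_simps)
      then show ?thesis using mult_left_cancel[OF two] by blast
    qed
    have h_swap: "h (t \<circ> transpose c c') = - h t"
      if t: "t \<in> Tab" and c: "c \<in> D" "c' \<in> D" "c \<noteq> c'" "snd c = snd c'" for t c c'
      using h_act[OF Tab_transpose_permutes[OF t c(1,2)] t] Tab_transpose[OF t c(1,2)] h2[OF t c]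
      by (simp add: algebra_simps)
    have h_col_perms: "\<forall>t\<in>Tab. h (t \<circ> \<pi>) = of_int (sign \<pi>) * h t" if "\<pi> \<in> col_perms" for \<pi>
      using that
    proof (induction rule: col_perms_induct)
      case (swap \<pi> c c')
      have "h (t \<circ> (transpose c c' \<circ> \<pi>)) = of_int (sign (transpose c c' \<circ> \<pi>)) * h t" if t: "t \<in> Tab" for t
      proof -
        have tr: "transpose c c' \<in> col_perms" using swap by (intro transpose_col_perms) auto
        have "h (t \<circ> transpose c c' \<circ> \<pi>) = of_int (sign \<pi>) * h (t \<circ> transpose c c')"
          using swap.IH Tab_comp[OF t col_perms_permutes[OF tr]] by blast
        then show ?thesis
          using h_swap[OF t \<open>c \<in> D\<close> \<open>c' \<in> D\<close> \<open>c \<noteq> c'\<close> \<open>snd c = snd c'\<close>] swap by (simp add: comp_assoc sign_comp col_perms_permutes tr sign_swap_id)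
      qed
      then show ?case by blast
    qed simp
    have "garnir_fun h"
    proof (rule garnir_funI[OF two])
      show "col_anti h" using h_col_perms by (auto simp: col_anti_def)
      fix s :: "int \<Rightarrow> int" and I :: "(nat \<times> nat) set set" and c f
      assume *: "s permutes A" "finite I" "f ` I \<subseteq> Tab"
        "\<And>u. u \<in> Tab \<Longrightarrow> (\<Sum>i\<in>I. c i * pt_coeff (f i) u) = (0::'k)"
      have "(\<Sum>i\<in>I. c i * (h (s \<circ> f i) - h (f i))) = (\<Sum>i\<in>I. c i * \<beta> s (f i))"
        by (rule sum.cong) (use * h_act[OF *(1)] in \<open>auto simp: image_subset_iff\<close>)
      then show "(\<Sum>i\<in>I. c i * (h (s \<circ> f i) - h (f i))) = 0" using rel[OF *] by simp
    qed
    then obtain y where y: "\<And>t. t \<in> Tab \<Longrightarrow> h t = (\<Sum>u\<in>Tab. y u * pt_coeff t u)"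
      using garnir_fun_comb_pt_coeff[OF two] by blast
    have "\<beta> \<sigma> t = (\<Sum>u\<in>Tab. y u * (pt_coeff (\<sigma> \<circ> t) u - pt_coeff t u))" if "\<sigma> permutes A" "t \<in> Tab" for \<sigma> t
    proof -
      have "\<beta> \<sigma> t = h (\<sigma> \<circ> t) - h t" using h_act[OF that] by simp
      then show ?thesis using y[OF that(2)] y[OF Tab_act[OF that(2,1)]]
        by (simp add: right_diff_distrib sum_subtractf)
    qed
    then show ?thesis by blast
  qed
qed

end

section \<open>The hyperoctahedral group\<close>

lemma hyperoct_carrier: "\<sigma> \<in> carrier (hyperoct r) \<longleftrightarrow> \<sigma> permutes symbols r \<and> (\<forall>i. \<sigma> (- i) = - \<sigma> i)"
proof -
  have "\<sigma> (- i) = - \<sigma> i" if "\<sigma> permutes symbols r" "\<forall>i\<in>symbols r. \<sigma> (- i) = - \<sigma> i" for i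
  proof (cases "i \<in> symbols r")
    case False
    then have "- i \<notin> symbols r" by (auto simp: symbols_def)
    then show ?thesis using False that(1) by (simp add: permutes_not_in)
  qed (use that in blast)
  then show ?thesis by (auto simp: hyperoct_def)
qed

lemma hyperoct_simps: "\<sigma> \<otimes>\<^bsub>hyperoct r\<^esub> \<tau> = \<tau> \<circ> \<sigma>" "\<one>\<^bsub>hyperoct r\<^esub> = id"
  by (simp_all add: hyperoct_def)

lemma hyperoct_pinv: "\<sigma> \<in> carrier (hyperoct r) \<Longrightarrow> pinv \<sigma> \<in> carrier (hyperoct r)"
  unfolding hyperoct_carrier
proof safe
  fix i assume s: "\<sigma> permutes symbols r" "\<forall>i. \<sigma> (- i) = - \<sigma> i"
  show "pinv \<sigma> permutes symbols r" by (rule permutes_inv[OF s(1)])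
  have "\<sigma> (- pinv \<sigma> i) = - i" using s(2) permutes_inverses(1)[OF s(1)] by simp
  then show "pinv \<sigma> (- i) = - pinv \<sigma> i" using permutes_inverses(2)[OF s(1), of "- pinv \<sigma> i"] by simp
qed

lemma hyperoct_cancel:
  assumes "\<sigma> \<in> carrier (hyperoct r)"
  shows "\<sigma> \<circ> pinv \<sigma> = id" "pinv \<sigma> \<circ> \<sigma> = id" "pinv \<sigma> \<circ> (\<sigma> \<circ> f) = f" "\<sigma> \<circ> (pinv \<sigma> \<circ> f) = f" "pinv (pinv \<sigma>) = \<sigma>"
proof -
  have p: "\<sigma> permutes symbols r" using assms by (simp add: hyperoct_carrier)
  show "\<sigma> \<circ> pinv \<sigma> = id" "pinv \<sigma> \<circ> \<sigma> = id" "pinv (pinv \<sigma>) = \<sigma>"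
    using permutes_inv_o[OF p] permutes_inv_inv[OF p] by simp_all
  then show "pinv \<sigma> \<circ> (\<sigma> \<circ> f) = f" "\<sigma> \<circ> (pinv \<sigma> \<circ> f) = f" by (simp_all flip: comp_assoc)
qed

lemma hyperoct_comp: "\<sigma> \<in> carrier (hyperoct r) \<Longrightarrow> \<tau> \<in> carrier (hyperoct r) \<Longrightarrow> \<tau> \<circ> \<sigma> \<in> carrier (hyperoct r)"
  by (simp add: hyperoct_carrier permutes_compose)

lemma finite_group_hyperoct: "finite_group (hyperoct r)"
proof -
  have "group (hyperoct r)"
  proof (rule groupI)
    show "\<exists>\<tau>\<in>carrier (hyperoct r). \<tau> \<otimes>\<^bsub>hyperoct r\<^esub> \<sigma> = \<one>\<^bsub>hyperoct r\<^esub>" if "\<sigma> \<in> carrier (hyperoct r)" for \<sigma>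
      using that hyperoct_pinv[OF that]
      by (intro bexI[of _ "pinv \<sigma>"]) (simp_all add: hyperoct_simps hyperoct_cancel[OF that])
    show "\<one>\<^bsub>hyperoct r\<^esub> \<in> carrier (hyperoct r)" by (simp add: hyperoct_carrier hyperoct_simps permutes_id)
  qed (auto simp: hyperoct_simps hyperoct_comp comp_assoc)
  moreover have "finite (carrier (hyperoct r))"
    by (rule finite_subset[OF _ finite_permutations[of "symbols r"]])
      (auto simp: hyperoct_carrier symbols_def)
  ultimately show ?thesis by (simp add: finite_group_def finite_group_axioms_def)
qed

lemma hyperoct_inv: "\<sigma> \<in> carrier (hyperoct r) \<Longrightarrow> inv\<^bsub>hyperoct r\<^esub> \<sigma> = pinv \<sigma>"
proof -
  assume s: "\<sigma> \<in> carrier (hyperoct r)"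
  interpret finite_group "hyperoct r" by (rule finite_group_hyperoct)
  show ?thesis
    by (rule inv_equality) (simp_all add: s hyperoct_pinv[OF s] hyperoct_simps hyperoct_cancel[OF s])
qed

lemma hyperoct_abs: "\<sigma> \<in> carrier (hyperoct r) \<Longrightarrow> \<bar>\<sigma> \<bar>i\<bar>\<bar> = \<bar>\<sigma> i\<bar>"
  by (cases "i \<ge> 0") (auto simp: hyperoct_carrier)

lemma hyperoct_zero: "\<sigma> \<in> carrier (hyperoct r) \<Longrightarrow> \<sigma> i = 0 \<longleftrightarrow> i = 0"
proof -
  assume s: "\<sigma> \<in> carrier (hyperoct r)"
  have p: "\<sigma> permutes symbols r" using s by (simp add: hyperoct_carrier)
  have "\<sigma> 0 = 0" by (rule permutes_not_in[OF p]) (simp add: symbols_def)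
  then show ?thesis using permutes_inj[OF p] by (auto dest: injD[of \<sigma> i 0])
qed

lemma perm_part_permutes:
  assumes s: "\<sigma> \<in> carrier (hyperoct r)" shows "perm_part r \<sigma> permutes {1..int r}"
proof (rule bij_imp_permutes)
  have p: "\<sigma> permutes symbols r" and odd: "\<sigma> (- i) = - \<sigma> i" for i using s by (auto simp: hyperoct_carrier)
  have m: "perm_part r \<sigma> ` {1..int r} \<subseteq> {1..int r}"
  proof safe
    fix i assume i: "i \<in> {1..int r}"
    then have "i \<in> symbols r" by (auto simp: symbols_def)
    then have "\<sigma> i \<in> symbols r" using permutes_in_image[OF p] by blast
    then show "perm_part r \<sigma> i \<in> {1..int r}" using i by (auto simp: perm_part_def symbols_def abs_if)
  qed
  have "inj_on (perm_part r \<sigma>) {1..int r}"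
  proof (rule inj_onI)
    fix i k assume ik: "i \<in> {1..int r}" "k \<in> {1..int r}" "perm_part r \<sigma> i = perm_part r \<sigma> k"
    then have "\<sigma> i = \<sigma> k \<or> \<sigma> i = \<sigma> (- k)" by (auto simp: perm_part_def abs_eq_iff odd)
    then have "i = k \<or> i = - k" using permutes_inj[OF p] by (auto dest: injD)
    then show "i = k" using ik by auto
  qed
  then show "bij_betw (perm_part r \<sigma>) {1..int r} {1..int r}"
    using endo_inj_surj[OF _ m] by (simp add: bij_betw_def)
qed (simp only: perm_part_def if_False)

lemma perm_part_comp:
  assumes "\<sigma> \<in> carrier (hyperoct r)" "\<tau> \<in> carrier (hyperoct r)"
  shows "perm_part r (\<tau> \<circ> \<sigma>) = perm_part r \<tau> \<circ> perm_part r \<sigma>"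
proof
  fix i
  show "perm_part r (\<tau> \<circ> \<sigma>) i = (perm_part r \<tau> \<circ> perm_part r \<sigma>) i"
  proof (cases "i \<in> {1..int r}")
    case True
    then have "perm_part r \<sigma> i \<in> {1..int r}" using permutes_in_image[OF perm_part_permutes[OF assms(1)]] by blast
    then show ?thesis using True hyperoct_abs[OF assms(2), of "\<sigma> i"] by (simp add: perm_part_def)
  next
    case False
    then show ?thesis by (auto simp: perm_part_def)
  qed
qed

text \<open>In this form the sign is visibly multiplicative, because elements of the group are odd
  functions.\<close>

lemma hsgn_alt:
  assumes s: "\<sigma> \<in> carrier (hyperoct r)"
  shows "hsgn r \<sigma> = (\<Prod>i\<in>{1..int r}. sgn (\<sigma> i)) * sign (perm_part r \<sigma>)"
proof -
  have "(\<Prod>i\<in>{1..int r}. sgn (\<sigma> i)) = (\<Prod>i\<in>{1..int r}. if \<sigma> i < 0 then - 1 else 1)"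
    by (rule prod.cong) (use hyperoct_zero[OF s] in \<open>auto simp: sgn_if\<close>)
  also have "\<dots> = (- 1) ^ card {i \<in> {1..int r}. \<sigma> i < 0}"
    by (subst prod.inter_filter[symmetric]) auto
  finally show ?thesis by (simp add: hsgn_def)
qed

lemma hsgn_comp:
  assumes "\<sigma> \<in> carrier (hyperoct r)" "\<tau> \<in> carrier (hyperoct r)"
  shows "hsgn r (\<tau> \<circ> \<sigma>) = hsgn r \<sigma> * hsgn r \<tau>"
proof -
  let ?A = "{1..int r}"
  note p = perm_part_permutes[OF assms(1)] perm_part_permutes[OF assms(2)]
  have "sgn (\<tau> (\<sigma> i)) = sgn (\<sigma> i) * sgn (\<tau> (perm_part r \<sigma> i))" if "i \<in> ?A" for i
  proof (cases "\<sigma> i \<ge> 0")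
    case False
    then have "\<sigma> i = - perm_part r \<sigma> i" using that by (simp add: perm_part_def)
    then have "\<tau> (\<sigma> i) = - \<tau> (perm_part r \<sigma> i)" using assms(2) by (simp add: hyperoct_carrier)
    then show ?thesis using False by (simp add: sgn_if)
  qed (use that hyperoct_zero[OF assms(1)] in \<open>auto simp: perm_part_def sgn_if\<close>)
  then have "(\<Prod>i\<in>?A. sgn ((\<tau> \<circ> \<sigma>) i)) = (\<Prod>i\<in>?A. sgn (\<sigma> i)) * (\<Prod>i\<in>?A. sgn (\<tau> (perm_part r \<sigma> i)))"
    by (simp add: prod.distrib)
  also have "(\<Prod>i\<in>?A. sgn (\<tau> (perm_part r \<sigma> i))) = (\<Prod>i\<in>?A. sgn (\<tau> i))"
    using prod.permute[OF p(1), of "\<lambda>i. sgn (\<tau> i)"] by (simp add: o_def)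
  finally show ?thesis
    using assms p by (simp add: hsgn_alt hyperoct_comp perm_part_comp mult_ac
        sign_compose permutes_imp_permutation[of ?A])
qed

lemma hsgn_id: "hsgn r id = 1"
proof -
  have "perm_part r id = id" by (auto simp: perm_part_def fun_eq_iff)
  moreover have "{i \<in> {1..int r}. id i < 0} = {}" by auto
  ultimately show ?thesis by (simp only: hsgn_def card.empty sign_id) simp
qed

lemma hsgn_conj:
  assumes s: "\<sigma> \<in> carrier (hyperoct r)" and t: "\<tau> \<in> carrier (hyperoct r)"
  shows "hsgn r (\<sigma> \<circ> \<tau> \<circ> pinv \<sigma>) = hsgn r \<tau>"
proof -
  have "hsgn r (pinv \<sigma>) * hsgn r \<sigma> = hsgn r (\<sigma> \<circ> pinv \<sigma>)"
    by (rule hsgn_comp[symmetric]) (use s hyperoct_pinv in auto)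
  also have "\<dots> = 1" using s by (simp add: hsgn_id hyperoct_cancel)
  finally have "hsgn r (pinv \<sigma>) * hsgn r \<sigma> = 1" .
  then show ?thesis using s t by (simp add: hsgn_comp hyperoct_comp hyperoct_pinv mult_ac)
qed

section \<open>Bi-tabloids and Specht modules\<close>

lemma finite_young: "finite (young p)"
proof -
  have "young p = (SIGMA i:{..<length p}. {..<p ! i})" by (auto simp: young_def)
  then show ?thesis by simp
qed

lemma finite_diagram: "finite (diagram l)"
  by (simp add: diagram_def finite_young)

lemma bitableaux_act:
  assumes t: "t \<in> bitableaux r l" and s: "\<sigma> \<in> carrier (hyperoct r)"
  shows "\<sigma> \<circ> t \<in> bitableaux r l"
proof -
  have b: "bij_betw (\<lambda>b. \<bar>t b\<bar>) (diagram l) {1..int r}" and z: "\<And>b. b \<notin> diagram l \<Longrightarrow> t b = 0"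
    using t by (auto simp: bitableaux_def)
  have "bij_betw (perm_part r \<sigma> \<circ> (\<lambda>b. \<bar>t b\<bar>)) (diagram l) {1..int r}"
    by (rule bij_betw_trans[OF b permutes_imp_bij[OF perm_part_permutes[OF s]]])
  moreover have "(perm_part r \<sigma> \<circ> (\<lambda>b. \<bar>t b\<bar>)) b = \<bar>(\<sigma> \<circ> t) b\<bar>" if "b \<in> diagram l" for b
  proof -
    have "\<bar>t b\<bar> \<in> {1..int r}" using b that by (auto simp: bij_betw_def)
    then show ?thesis using hyperoct_abs[OF s, of "t b"] by (simp add: perm_part_def)
  qed
  ultimately have "bij_betw (\<lambda>b. \<bar>(\<sigma> \<circ> t) b\<bar>) (diagram l) {1..int r}"
    by (simp cong: bij_betw_cong)
  then show ?thesis using z hyperoct_zero[OF s] by (auto simp: bitableaux_def)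
qed

lemma finite_bitableaux: "finite (bitableaux r l)"
proof (rule finite_subset)
  let ?V = "{- int r..int r}"
  show "bitableaux r l \<subseteq> {t. \<forall>b. (b \<in> diagram l \<longrightarrow> t b \<in> ?V) \<and> (b \<notin> diagram l \<longrightarrow> t b = 0)}"
  proof safe
    fix t b assume t: "t \<in> bitableaux r l"
    { assume "b \<in> diagram l"
      then have "\<bar>t b\<bar> \<in> {1..int r}" using t by (auto simp: bitableaux_def bij_betw_def)
      then show "t b \<in> ?V" by auto }
    { assume "b \<notin> diagram l" then show "t b = 0" using t by (simp add: bitableaux_def) }
  qed
  show "finite {t :: bitab. \<forall>b. (b \<in> diagram l \<longrightarrow> t b \<in> ?V) \<and> (b \<notin> diagram l \<longrightarrow> t b = 0)}"
    using finite_diagram by (rule finite_set_of_finite_funs) simp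
qed

lemma row_col_act:
  "row1 l (\<sigma> \<circ> t) i = \<sigma> ` row1 l t i" "row2 l (\<sigma> \<circ> t) i = \<sigma> ` row2 l t i"
  "col1 l (\<sigma> \<circ> t) i = \<sigma> ` col1 l t i" "col2 l (\<sigma> \<circ> t) i = \<sigma> ` col2 l t i"
  by (auto simp: row1_def row2_def col1_def col2_def)

lemma signed_image: "\<sigma> \<in> carrier (hyperoct r) \<Longrightarrow> signed (\<sigma> ` A) = \<sigma> ` signed A"
  by (simp add: signed_def image_Un image_image hyperoct_carrier)

lemma conj_image:
  assumes s: "\<sigma> \<in> carrier (hyperoct r)" and e: "\<rho> ` A = A"
  shows "(\<sigma> \<circ> \<rho> \<circ> pinv \<sigma>) ` (\<sigma> ` A) = \<sigma> ` A"
proof -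
  have "pinv \<sigma> \<circ> \<sigma> = id" using hyperoct_cancel[OF s] by simp
  then have "(\<sigma> \<circ> \<rho> \<circ> pinv \<sigma>) ` (\<sigma> ` A) = \<sigma> ` (\<rho> ` A)"
    by (simp only: image_comp comp_assoc comp_id)
  then show ?thesis using e by simp
qed

lemma row_stab_W: "\<rho> \<in> row_stab r l t \<Longrightarrow> \<rho> \<in> carrier (hyperoct r)"
  and col_stab_W: "\<rho> \<in> col_stab r l t \<Longrightarrow> \<rho> \<in> carrier (hyperoct r)"
  by (simp_all add: row_stab_def col_stab_def)

lemma row_stab_image:
  assumes "\<rho> \<in> row_stab r l t" shows "\<rho> ` row1 l t i = row1 l t i" "\<rho> ` signed (row2 l t i) = signed (row2 l t i)"
  using assms by (simp_all only: row_stab_def mem_Collect_eq)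

lemma col_stab_image:
  assumes "\<rho> \<in> col_stab r l t" shows "\<rho> ` signed (col1 l t i) = signed (col1 l t i)" "\<rho> ` col2 l t i = col2 l t i"
  using assms by (simp_all only: col_stab_def mem_Collect_eq)

lemma row_stab_conj:
  assumes s: "\<sigma> \<in> carrier (hyperoct r)" and \<rho>: "\<rho> \<in> row_stab r l t"
  shows "\<sigma> \<circ> \<rho> \<circ> pinv \<sigma> \<in> row_stab r l (\<sigma> \<circ> t)"
  unfolding row_stab_def mem_Collect_eq row_col_act signed_image[OF s]
  by (intro conjI allI conj_image[OF s] row_stab_image[OF \<rho>] hyperoct_comp hyperoct_pinv s row_stab_W[OF \<rho>])

lemma col_stab_conj:
  assumes s: "\<sigma> \<in> carrier (hyperoct r)" and \<rho>: "\<rho> \<in> col_stab r l t"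
  shows "\<sigma> \<circ> \<rho> \<circ> pinv \<sigma> \<in> col_stab r l (\<sigma> \<circ> t)"
  unfolding col_stab_def mem_Collect_eq row_col_act signed_image[OF s]
  by (intro conjI allI conj_image[OF s] col_stab_image[OF \<rho>] hyperoct_comp hyperoct_pinv s col_stab_W[OF \<rho>])

lemma pinv_image:
  assumes "\<sigma> \<in> carrier (hyperoct r)" "\<sigma> ` A = A" shows "pinv \<sigma> ` A = A"
proof -
  have "pinv \<sigma> ` (\<sigma> ` A) = A" unfolding image_comp hyperoct_cancel(2)[OF assms(1)] by simp
  then show ?thesis using assms(2) by simp
qed

lemma row_stab_pinv:
  assumes "\<rho> \<in> row_stab r l t" shows "pinv \<rho> \<in> row_stab r l t"
  unfolding row_stab_def mem_Collect_eq
  by (intro conjI allI hyperoct_pinv pinv_image[OF row_stab_W[OF assms]] row_stab_image[OF assms] row_stab_W[OF assms])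

lemma col_stab_pinv:
  assumes "\<rho> \<in> col_stab r l t" shows "pinv \<rho> \<in> col_stab r l t"
  unfolding col_stab_def mem_Collect_eq
  by (intro conjI allI hyperoct_pinv pinv_image[OF col_stab_W[OF assms]] col_stab_image[OF assms] col_stab_W[OF assms])

lemma row_stab_comp:
  assumes "\<rho> \<in> row_stab r l t" "\<kappa> \<in> row_stab r l t" shows "\<rho> \<circ> \<kappa> \<in> row_stab r l t"
  using hyperoct_comp[OF row_stab_W[OF assms(2)] row_stab_W[OF assms(1)]]
  unfolding row_stab_def mem_Collect_eq image_comp[symmetric] row_stab_image[OF assms(1)] row_stab_image[OF assms(2)]
  by blast

lemma col_stab_comp:
  assumes "\<rho> \<in> col_stab r l t" "\<kappa> \<in> col_stab r l t" shows "\<rho> \<circ> \<kappa> \<in> col_stab r l t"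
  using hyperoct_comp[OF col_stab_W[OF assms(2)] col_stab_W[OF assms(1)]]
  unfolding col_stab_def mem_Collect_eq image_comp[symmetric] col_stab_image[OF assms(1)] col_stab_image[OF assms(2)]
  by blast

lemma tabloid_act_tabloid:
  assumes s: "\<sigma> \<in> carrier (hyperoct r)"
  shows "tabloid_act (tabloid r l t) \<sigma> = tabloid r l (\<sigma> \<circ> t)"
proof
  show "tabloid_act (tabloid r l t) \<sigma> \<subseteq> tabloid r l (\<sigma> \<circ> t)"
  proof
    fix u assume "u \<in> tabloid_act (tabloid r l t) \<sigma>"
    then obtain \<rho> where \<rho>: "\<rho> \<in> row_stab r l t" "u = \<sigma> \<circ> (\<rho> \<circ> t)"
      by (auto simp: tabloid_act_def tabloid_def tab_act_def)
    have "u = (\<sigma> \<circ> \<rho> \<circ> pinv \<sigma>) \<circ> (\<sigma> \<circ> t)" using \<rho> by (simp add: comp_assoc hyperoct_cancel[OF s])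
    then show "u \<in> tabloid r l (\<sigma> \<circ> t)"
      using row_stab_conj[OF s \<rho>(1)] unfolding tabloid_def tab_act_def by blast
  qed
  show "tabloid r l (\<sigma> \<circ> t) \<subseteq> tabloid_act (tabloid r l t) \<sigma>"
  proof
    fix u assume "u \<in> tabloid r l (\<sigma> \<circ> t)"
    then obtain \<rho> where \<rho>: "\<rho> \<in> row_stab r l (\<sigma> \<circ> t)" "u = \<rho> \<circ> (\<sigma> \<circ> t)"
      by (auto simp: tabloid_def tab_act_def)
    have "pinv \<sigma> \<circ> \<rho> \<circ> pinv (pinv \<sigma>) \<in> row_stab r l (pinv \<sigma> \<circ> (\<sigma> \<circ> t))"
      by (rule row_stab_conj[OF hyperoct_pinv[OF s] \<rho>(1)])
    then have k: "pinv \<sigma> \<circ> \<rho> \<circ> \<sigma> \<in> row_stab r l t" by (simp add: hyperoct_cancel[OF s])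
    have "u = \<sigma> \<circ> ((pinv \<sigma> \<circ> \<rho> \<circ> \<sigma>) \<circ> t)" using \<rho> by (simp add: comp_assoc hyperoct_cancel[OF s])
    then show "u \<in> tabloid_act (tabloid r l t) \<sigma>"
      using k unfolding tabloid_act_def tabloid_def tab_act_def by blast
  qed
qed

lemma tabloid_row_stab:
  assumes "\<rho> \<in> row_stab r l t" shows "tabloid r l (\<rho> \<circ> t) = tabloid r l t"
proof -
  have "tabloid r l (\<rho> \<circ> t) = tabloid_act (tabloid r l t) \<rho>"
    using tabloid_act_tabloid[OF row_stab_W[OF assms]] by simp
  also have "\<dots> = tabloid r l t"
  proof
    show "tabloid_act (tabloid r l t) \<rho> \<subseteq> tabloid r l t"
      using row_stab_comp[OF assms] by (force simp: tabloid_act_def tabloid_def tab_act_def comp_assoc[symmetric])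
    show "tabloid r l t \<subseteq> tabloid_act (tabloid r l t) \<rho>"
    proof
      fix u assume "u \<in> tabloid r l t"
      then obtain \<kappa> where k: "\<kappa> \<in> row_stab r l t" "u = \<kappa> \<circ> t" by (auto simp: tabloid_def tab_act_def)
      have "u = \<rho> \<circ> ((pinv \<rho> \<circ> \<kappa>) \<circ> t)"
        using k by (simp add: comp_assoc hyperoct_cancel[OF row_stab_W[OF assms]])
      then show "u \<in> tabloid_act (tabloid r l t) \<rho>"
        using row_stab_comp[OF row_stab_pinv[OF assms] k(1)]
        unfolding tabloid_act_def tabloid_def tab_act_def by blast
    qed
  qed
  finally show ?thesis .
qed

lemma tabloid_refl: "t \<in> tabloid r l t"
  unfolding tabloid_def tab_act_def
  by (auto simp: row_stab_def hyperoct_carrier permutes_id intro!: exI[of _ id])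

definition tabloids :: "nat \<Rightarrow> bipart \<Rightarrow> bitab set set"
  where "tabloids r l = tabloid r l ` bitableaux r l"

lemma finite_tabloids: "finite (tabloids r l)"
  by (simp add: tabloids_def finite_bitableaux)

lemma M_mod_eq: "M_mod r l = perm_mod (hyperoct r) (tabloids r l) tabloid_act"
  by (simp add: M_mod_def tabloids_def)

lemma tabloids_act: "T \<in> tabloids r l \<Longrightarrow> \<sigma> \<in> carrier (hyperoct r) \<Longrightarrow> tabloid_act T \<sigma> \<in> tabloids r l"
  by (auto simp: tabloids_def tabloid_act_tabloid bitableaux_act)

lemma right_module_M: "right_module (group_algebra (hyperoct r)) (M_mod r l :: (_ \<Rightarrow> 'k::field, _) module)"
proof -
  interpret finite_group "hyperoct r" by (rule finite_group_hyperoct)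
  show ?thesis
    unfolding M_mod_eq
    by (rule right_module_perm_mod[OF finite_tabloids tabloids_act])
      (simp_all add: hyperoct_simps tabloid_act_def tab_act_def image_image comp_assoc)
qed

lemma M_carrier: "v \<in> carrier (M_mod r l) \<longleftrightarrow> (\<forall>T. T \<notin> tabloids r l \<longrightarrow> v T = 0)"
proof -
  interpret finite_group "hyperoct r" by (rule finite_group_hyperoct)
  show ?thesis unfolding M_mod_eq by (rule perm_mod_carrier[OF finite_tabloids])
qed

lemma polytabloid_eq:
  assumes t: "t \<in> bitableaux r l"
  shows "polytabloid r l t T = (\<Sum>\<sigma>\<in>{\<sigma> \<in> col_stab r l t. tabloid r l (\<sigma> \<circ> t) = T}. of_int (hsgn r \<sigma>) :: 'k::field)"
proof -
  interpret finite_group "hyperoct r" by (rule finite_group_hyperoct)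
  let ?v = "\<lambda>T. if T = tabloid r l t then 1 else 0 :: 'k"
  have tB: "tabloid r l t \<in> tabloids r l" using t by (simp add: tabloids_def)
  have v: "?v \<in> carrier (perm_mod (hyperoct r) (tabloids r l) tabloid_act)"
    using tB by (auto simp: perm_mod_carrier[OF finite_tabloids])
  have c: "(col_sum r l t :: _ \<Rightarrow> 'k) \<in> carrier KG"
    by (auto simp: KG_carrier col_sum_def dest: col_stab_W)
  have "polytabloid r l t T = (\<Sum>x\<in>tabloids r l. \<Sum>g\<in>carrier (hyperoct r).
      if tabloid_act x g = T then ?v x * col_sum r l t g else 0)"
    unfolding polytabloid_def M_mod_eq perm_mod_smult[OF finite_tabloids c v] sum.cartesian_product ..
  also have "\<dots> = (\<Sum>x\<in>tabloids r l. if x = tabloid r l t then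
      (\<Sum>g\<in>carrier (hyperoct r). if tabloid_act (tabloid r l t) g = T then col_sum r l t g else 0) else 0)"
    by (rule sum.cong) (simp_all cong: if_cong)
  also have "\<dots> = (\<Sum>g\<in>carrier (hyperoct r). if tabloid_act (tabloid r l t) g = T then col_sum r l t g else 0)"
    using finite_tabloids tB by simp
  also have "\<dots> = (\<Sum>\<sigma>\<in>{\<sigma> \<in> col_stab r l t. tabloid r l (\<sigma> \<circ> t) = T}. of_int (hsgn r \<sigma>))"
    by (rule sum.mono_neutral_cong_right)
      (use fin in \<open>auto simp: col_sum_def tabloid_act_tabloid dest: col_stab_W\<close>)
  finally show ?thesis .
qed

lemma finite_col_stab: "finite (col_stab r l t)"
proof -
  interpret finite_group "hyperoct r" by (rule finite_group_hyperoct)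
  show ?thesis by (rule finite_subset[OF _ fin]) (auto dest: col_stab_W)
qed

text \<open>Conjugation by \<open>\<sigma>\<close> carries the column stabilizer of \<open>t\<close> to that of \<open>t \<sigma>\<close> and preserves
  signs.\<close>

lemma polytabloid_act_eq:
  assumes t: "t \<in> bitableaux r l" and s: "\<sigma> \<in> carrier (hyperoct r)"
  shows "polytabloid r l (\<sigma> \<circ> t) T = (\<Sum>\<kappa>\<in>{\<kappa> \<in> col_stab r l t. tabloid r l (\<sigma> \<circ> (\<kappa> \<circ> t)) = T}. of_int (hsgn r \<kappa>) :: 'k::field)"
  unfolding polytabloid_eq[OF bitableaux_act[OF t s]]
proof (rule sum.reindex_bij_witness[of _ "\<lambda>\<kappa>. \<sigma> \<circ> \<kappa> \<circ> pinv \<sigma>" "\<lambda>\<tau>. pinv \<sigma> \<circ> \<tau> \<circ> \<sigma>"])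
  fix \<tau> assume \<tau>: "\<tau> \<in> {\<tau> \<in> col_stab r l (\<sigma> \<circ> t). tabloid r l (\<tau> \<circ> (\<sigma> \<circ> t)) = T}"
  show "\<sigma> \<circ> (pinv \<sigma> \<circ> \<tau> \<circ> \<sigma>) \<circ> pinv \<sigma> = \<tau>" by (simp add: comp_assoc hyperoct_cancel[OF s])
  have "pinv \<sigma> \<circ> \<tau> \<circ> pinv (pinv \<sigma>) \<in> col_stab r l (pinv \<sigma> \<circ> (\<sigma> \<circ> t))"
    by (rule col_stab_conj[OF hyperoct_pinv[OF s]]) (use \<tau> in simp)
  then have k: "pinv \<sigma> \<circ> \<tau> \<circ> \<sigma> \<in> col_stab r l t" by (simp add: hyperoct_cancel[OF s])
  then show "pinv \<sigma> \<circ> \<tau> \<circ> \<sigma> \<in> {\<kappa> \<in> col_stab r l t. tabloid r l (\<sigma> \<circ> (\<kappa> \<circ> t)) = T}"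
    using \<tau> by (simp add: comp_assoc hyperoct_cancel[OF s])
  have "hsgn r (pinv \<sigma> \<circ> \<tau> \<circ> pinv (pinv \<sigma>)) = hsgn r \<tau>"
    using \<tau> by (intro hsgn_conj hyperoct_pinv[OF s]) (auto dest: col_stab_W)
  then show "of_int (hsgn r (pinv \<sigma> \<circ> \<tau> \<circ> \<sigma>)) = (of_int (hsgn r \<tau>) :: 'k)" by (simp add: hyperoct_cancel[OF s])
next
  fix \<kappa> assume k: "\<kappa> \<in> {\<kappa> \<in> col_stab r l t. tabloid r l (\<sigma> \<circ> (\<kappa> \<circ> t)) = T}"
  show "pinv \<sigma> \<circ> (\<sigma> \<circ> \<kappa> \<circ> pinv \<sigma>) \<circ> \<sigma> = \<kappa>" by (simp add: comp_assoc hyperoct_cancel[OF s])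
  show "\<sigma> \<circ> \<kappa> \<circ> pinv \<sigma> \<in> {\<tau> \<in> col_stab r l (\<sigma> \<circ> t). tabloid r l (\<tau> \<circ> (\<sigma> \<circ> t)) = T}"
    using k col_stab_conj[OF s, of \<kappa>] by (simp add: comp_assoc hyperoct_cancel[OF s])
qed

lemma polytabloid_col_stab:
  assumes t: "t \<in> bitableaux r l" and k: "\<kappa> \<in> col_stab r l t"
  shows "polytabloid r l (\<kappa> \<circ> t) T = (of_int (hsgn r \<kappa>) * polytabloid r l t T :: 'k::field)"
proof -
  note kW = col_stab_W[OF k]
  have "polytabloid r l t T = (\<Sum>\<tau>\<in>{\<tau> \<in> col_stab r l t. tabloid r l (\<kappa> \<circ> (\<tau> \<circ> t)) = T}. of_int (hsgn r (\<kappa> \<circ> \<tau>)) :: 'k)"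
    unfolding polytabloid_eq[OF t]
    by (rule sum.reindex_bij_witness[of _ "\<lambda>\<tau>. \<kappa> \<circ> \<tau>" "\<lambda>\<tau>. pinv \<kappa> \<circ> \<tau>"])
      (use k in \<open>auto simp: comp_assoc hyperoct_cancel[OF kW] intro: col_stab_comp col_stab_pinv\<close>)
  also have "\<dots> = (\<Sum>\<tau>\<in>{\<tau> \<in> col_stab r l t. tabloid r l (\<kappa> \<circ> (\<tau> \<circ> t)) = T}. of_int (hsgn r \<kappa>) * of_int (hsgn r \<tau>))"
    by (rule sum.cong) (auto simp: hsgn_comp kW mult_ac dest!: col_stab_W)
  finally have e: "polytabloid r l t T = (of_int (hsgn r \<kappa>) * polytabloid r l (\<kappa> \<circ> t) T :: 'k)"
    by (simp add: polytabloid_act_eq[OF t kW] sum_distrib_left)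
  have "\<bar>hsgn r \<kappa>\<bar> = 1" by (simp add: hsgn_def abs_mult power_abs)
  then have "hsgn r \<kappa> * hsgn r \<kappa> = 1" using abs_mult_self_eq[of "hsgn r \<kappa>"] by simp
  then have "of_int (hsgn r \<kappa>) * (of_int (hsgn r \<kappa>) :: 'k) = 1" by (metis of_int_1 of_int_mult)
  then show ?thesis unfolding e by (simp flip: mult.assoc)
qed

lemma polytabloid_carrier: "t \<in> bitableaux r l \<Longrightarrow> (polytabloid r l t :: _ \<Rightarrow> 'k::field) \<in> carrier (M_mod r l)"
  unfolding M_carrier
proof (intro allI impI)
  fix T assume t: "t \<in> bitableaux r l" and T: "T \<notin> tabloids r l"
  have e: "{\<sigma> \<in> col_stab r l t. tabloid r l (\<sigma> \<circ> t) = T} = {}"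
    using T bitableaux_act[OF t] by (auto simp: tabloids_def dest: col_stab_W)
  then show "polytabloid r l t T = 0" unfolding polytabloid_eq[OF t] e by simp
qed

lemma M_elem_polytabloid:
  assumes t: "t \<in> bitableaux r l" and s: "\<sigma> \<in> carrier (hyperoct r)"
  shows "grp_elem \<sigma> \<odot>\<^bsub>M_mod r l\<^esub> polytabloid r l t = (polytabloid r l (\<sigma> \<circ> t) :: _ \<Rightarrow> 'k::field)"
proof
  fix T
  interpret finite_group "hyperoct r" by (rule finite_group_hyperoct)
  have "(grp_elem \<sigma> \<odot>\<^bsub>M_mod r l\<^esub> polytabloid r l t) T =
      (\<Sum>x\<in>{x \<in> tabloids r l. tabloid_act x \<sigma> = T}. polytabloid r l t x :: 'k)"
    unfolding M_mod_eq by (rule perm_mod_elem[OF finite_tabloids polytabloid_carrier[OF t, unfolded M_mod_eq] s])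
  also have "\<dots> = (\<Sum>x\<in>{x \<in> tabloids r l. tabloid_act x \<sigma> = T}.
      \<Sum>\<kappa>\<in>{\<kappa> \<in> {\<kappa> \<in> col_stab r l t. tabloid r l (\<sigma> \<circ> (\<kappa> \<circ> t)) = T}. tabloid r l (\<kappa> \<circ> t) = x}. of_int (hsgn r \<kappa>))"
    unfolding polytabloid_eq[OF t]
    by (intro sum.cong) (use s in \<open>auto simp: tabloid_act_tabloid\<close>)
  also have "\<dots> = (\<Sum>\<kappa>\<in>{\<kappa> \<in> col_stab r l t. tabloid r l (\<sigma> \<circ> (\<kappa> \<circ> t)) = T}. of_int (hsgn r \<kappa>))"
    by (rule sum.group)
      (use finite_tabloids finite_col_stab s t in
        \<open>auto simp: tabloids_def tabloid_act_tabloid intro!: imageI bitableaux_act dest: col_stab_W\<close>)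
  also have "\<dots> = polytabloid r l (\<sigma> \<circ> t) T" by (rule polytabloid_act_eq[OF t s, symmetric])
  finally show "(grp_elem \<sigma> \<odot>\<^bsub>M_mod r l\<^esub> polytabloid r l t) T = (polytabloid r l (\<sigma> \<circ> t) T :: 'k)" .
qed
lemma S_carrier: "v \<in> carrier (S_mod r l) \<longleftrightarrow> (\<exists>c. v = (\<lambda>T. \<Sum>t\<in>bitableaux r l. c t * polytabloid r l t T))"
  by (auto simp: S_mod_def)

lemma S_sum:
  assumes "finite I" "\<And>i. i \<in> I \<Longrightarrow> f i \<in> carrier (S_mod r l)"
  shows "(\<lambda>T. \<Sum>i\<in>I. a i * (f i T :: 'k::field)) \<in> carrier (S_mod r l)"
proof -
  have "\<forall>i\<in>I. \<exists>c. f i = (\<lambda>T. \<Sum>t\<in>bitableaux r l. c t * polytabloid r l t T)"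
    using assms(2) by (simp add: S_carrier)
  then obtain c where c: "\<And>i. i \<in> I \<Longrightarrow> f i = (\<lambda>T. \<Sum>t\<in>bitableaux r l. c i t * polytabloid r l t T)"
    by (auto dest!: bchoice)
  have "(\<Sum>i\<in>I. a i * f i T) = (\<Sum>t\<in>bitableaux r l. (\<Sum>i\<in>I. a i * c i t) * polytabloid r l t T)" for T
  proof -
    have "(\<Sum>i\<in>I. a i * f i T) = (\<Sum>i\<in>I. \<Sum>t\<in>bitableaux r l. a i * c i t * polytabloid r l t T)"
      by (rule sum.cong) (simp_all add: c sum_distrib_left mult.assoc)
    then show ?thesis by (subst (asm) sum.swap) (simp add: sum_distrib_right)
  qed
  then show ?thesis unfolding S_carrier by (intro exI[of _ "\<lambda>t. \<Sum>i\<in>I. a i * c i t"]) (rule ext)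
qed

lemma polytabloid_S: "t \<in> bitableaux r l \<Longrightarrow> (polytabloid r l t :: _ \<Rightarrow> 'k::field) \<in> carrier (S_mod r l)"
proof -
  assume t: "t \<in> bitableaux r l"
  have "(\<Sum>s\<in>bitableaux r l. (if s = t then 1 else 0) * polytabloid r l s T) = (polytabloid r l t T :: 'k)" for T
    by (rule sum_delta_pair[OF finite_bitableaux t])
  then show ?thesis unfolding S_carrier by (intro exI[of _ "\<lambda>s. if s = t then 1 else 0"]) (rule ext, simp)
qed

lemma S_subset_M: "(carrier (S_mod r l) :: (_ \<Rightarrow> 'k::field) set) \<subseteq> carrier (M_mod r l)"
proof
  fix v :: "_ \<Rightarrow> 'k" assume "v \<in> carrier (S_mod r l)"
  then obtain c where v: "v = (\<lambda>T. \<Sum>t\<in>bitableaux r l. c t * polytabloid r l t T)" by (auto simp: S_carrier)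
  show "v \<in> carrier (M_mod r l)"
    unfolding M_carrier v
    by (auto intro!: sum.neutral simp: polytabloid_carrier[unfolded M_carrier, rule_format])
qed

lemma S_add: "v \<oplus>\<^bsub>S_mod r l\<^esub> w = (\<lambda>T. v T + w T)"
  and S_zero: "\<zero>\<^bsub>S_mod r l\<^esub> = (\<lambda>T. 0)"
  and S_smult: "a \<odot>\<^bsub>S_mod r l\<^esub> v = a \<odot>\<^bsub>M_mod r l\<^esub> v"
  by (simp_all add: S_mod_def M_mod_def perm_mod_def)

lemma M_elem_comb:
  assumes "finite I" "\<And>i. i \<in> I \<Longrightarrow> f i \<in> carrier (M_mod r l)" and s: "\<sigma> \<in> carrier (hyperoct r)"
  shows "grp_elem \<sigma> \<odot>\<^bsub>M_mod r l\<^esub> (\<lambda>T. \<Sum>i\<in>I. a i * (f i T :: 'k::field)) =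
    (\<lambda>T. \<Sum>i\<in>I. a i * (grp_elem \<sigma> \<odot>\<^bsub>M_mod r l\<^esub> f i) T)"
proof
  fix T
  interpret finite_group "hyperoct r" by (rule finite_group_hyperoct)
  have sm: "(\<lambda>T. \<Sum>i\<in>I. a i * f i T) \<in> carrier (M_mod r l)"
    unfolding M_carrier using assms(2)[unfolded M_carrier] by (auto intro!: sum.neutral)
  have e: "(grp_elem \<sigma> \<odot>\<^bsub>M_mod r l\<^esub> v) T = (\<Sum>x\<in>{x \<in> tabloids r l. tabloid_act x \<sigma> = T}. v x)"
    if "v \<in> carrier (M_mod r l)" for v :: "_ \<Rightarrow> 'k"
    using that unfolding M_mod_eq by (intro perm_mod_elem[OF finite_tabloids _ s])
  show "(grp_elem \<sigma> \<odot>\<^bsub>M_mod r l\<^esub> (\<lambda>T. \<Sum>i\<in>I. a i * f i T)) T =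
      (\<Sum>i\<in>I. a i * (grp_elem \<sigma> \<odot>\<^bsub>M_mod r l\<^esub> f i) T)"
    unfolding e[OF sm] by (subst sum.swap) (simp add: e assms(2) sum_distrib_left)
qed

lemma right_module_S: "right_module (group_algebra (hyperoct r)) (S_mod r l :: (_ \<Rightarrow> 'k::field, _) module)"
proof -
  interpret finite_group "hyperoct r" by (rule finite_group_hyperoct)
  let ?M = "M_mod r l :: (_ \<Rightarrow> 'k, _) module" and ?S = "S_mod r l :: (_ \<Rightarrow> 'k, _) module"
  have "right_module KG (?M\<lparr>carrier := carrier ?S\<rparr>)"
  proof (rule right_module_submodule[OF right_module_M S_subset_M])
    show "\<zero>\<^bsub>?M\<^esub> \<in> carrier ?S"
      using S_sum[of "{}"] by (simp add: M_mod_def perm_mod_def)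
    fix v w assume vw: "v \<in> carrier ?S" "w \<in> carrier ?S"
    have "(\<lambda>T. \<Sum>i\<in>{True, False}. 1 * (if i then v else w) T) \<in> carrier ?S"
      by (rule S_sum) (use vw in auto)
    then show "v \<oplus>\<^bsub>?M\<^esub> w \<in> carrier ?S" by (simp add: M_mod_def perm_mod_def)
  next
    fix a v assume a: "a \<in> carrier (KG :: (_ \<Rightarrow> 'k) ring)" and v: "v \<in> carrier ?S"
    obtain c where vc: "v = (\<lambda>T. \<Sum>t\<in>bitableaux r l. c t * polytabloid r l t T)" using v by (auto simp: S_carrier)
    have el: "grp_elem \<sigma> \<odot>\<^bsub>?M\<^esub> v \<in> carrier ?S" if s: "\<sigma> \<in> carrier (hyperoct r)" for \<sigma>
    proof -
      have "grp_elem \<sigma> \<odot>\<^bsub>?M\<^esub> v = (\<lambda>T. \<Sum>t\<in>bitableaux r l. c t * (grp_elem \<sigma> \<odot>\<^bsub>?M\<^esub> polytabloid r l t) T)"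
        unfolding vc by (rule M_elem_comb[OF finite_bitableaux polytabloid_carrier s])
      also have "\<dots> = (\<lambda>T. \<Sum>t\<in>bitableaux r l. c t * polytabloid r l (\<sigma> \<circ> t) T)"
        by (intro ext sum.cong) (simp_all add: M_elem_polytabloid s)
      also have "\<dots> \<in> carrier ?S"
        by (rule S_sum[OF finite_bitableaux]) (simp add: polytabloid_S bitableaux_act s)
      finally show ?thesis .
    qed
    have "a \<odot>\<^bsub>?M\<^esub> v = (\<lambda>y. \<Sum>g\<in>carrier (hyperoct r). a g * (grp_elem g \<odot>\<^bsub>?M\<^esub> v) y)"
      unfolding M_mod_eq
      by (rule perm_mod_smult_elems[OF finite_tabloids a]) (rule subsetD[OF S_subset_M v, unfolded M_mod_eq])
    also have "\<dots> \<in> carrier ?S" by (rule S_sum[OF fin el])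
    finally show "a \<odot>\<^bsub>?M\<^esub> v \<in> carrier ?S" .
  qed
  then show ?thesis by (simp add: S_mod_def)
qed

lemma S_scalar:
  assumes "v \<in> carrier (S_mod r l :: (_ \<Rightarrow> 'k::field, _) module)"
  shows "scalar (hyperoct r) c \<odot>\<^bsub>S_mod r l\<^esub> v = (\<lambda>T. c * v T)"
proof -
  interpret finite_group "hyperoct r" by (rule finite_group_hyperoct)
  have v: "v \<in> carrier (perm_mod (hyperoct r) (tabloids r l) tabloid_act)"
    using subsetD[OF S_subset_M assms] unfolding M_mod_eq .
  show ?thesis
    unfolding S_smult M_mod_eq
    by (rule perm_mod_scalar[OF finite_tabloids v]) (simp add: hyperoct_simps tabloid_act_def tab_act_def)
qed

section \<open>Derivations into the dual Specht module\<close>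

lemma right_module_dual_S: "right_module (group_algebra (hyperoct r)) (dual_S_mod r l :: (_ \<Rightarrow> 'k::field, _) module)"
proof -
  interpret finite_group "hyperoct r" by (rule finite_group_hyperoct)
  show ?thesis unfolding dual_S_mod_def by (rule right_module_dual_mod[OF right_module_S])
qed

lemma dual_S_I:
  assumes "\<And>v w. v \<in> carrier (S_mod r l) \<Longrightarrow> w \<in> carrier (S_mod r l) \<Longrightarrow> F (\<lambda>T. v T + w T) = F v + F w"
    and "\<And>c v. v \<in> carrier (S_mod r l) \<Longrightarrow> F (\<lambda>T. c * v T) = c * (F v :: 'k::field)"
  shows "restrict F (carrier (S_mod r l)) \<in> carrier (dual_S_mod r l)"
proof -
  interpret finite_group "hyperoct r" by (rule finite_group_hyperoct)
  interpret S: right_module "group_algebra (hyperoct r)" "S_mod r l :: (_ \<Rightarrow> 'k, _) module" by (rule right_module_S)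
  have 1: "(\<lambda>T. v T + w T) \<in> carrier (S_mod r l)"
    if "v \<in> carrier (S_mod r l)" "w \<in> carrier (S_mod r l)" for v w :: "_ \<Rightarrow> 'k"
    using S.M.a_closed[OF that] by (simp add: S_add)
  have 2: "(\<lambda>T. c * v T) \<in> carrier (S_mod r l)" if "v \<in> carrier (S_mod r l)" for c and v :: "_ \<Rightarrow> 'k"
    using S.smult_closed[OF scalar_closed that, of c] by (simp add: S_scalar[OF that])
  show ?thesis
    using assms 1 2 unfolding dual_S_mod_def dual_mod_simps by (simp add: S_add S_scalar)
qed

lemma dual_S_add: "\<phi> \<in> carrier (dual_S_mod r l) \<Longrightarrow> v \<in> carrier (S_mod r l) \<Longrightarrow> w \<in> carrier (S_mod r l) \<Longrightarrow>
    \<phi> (\<lambda>T. v T + w T) = \<phi> v + (\<phi> w :: 'k::field)"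
  and dual_S_scale: "\<phi> \<in> carrier (dual_S_mod r l) \<Longrightarrow> v \<in> carrier (S_mod r l) \<Longrightarrow> \<phi> (\<lambda>T. c * v T) = c * (\<phi> v :: 'k::field)"
proof -
  interpret finite_group "hyperoct r" by (rule finite_group_hyperoct)
  show "\<phi> \<in> carrier (dual_S_mod r l) \<Longrightarrow> v \<in> carrier (S_mod r l) \<Longrightarrow> w \<in> carrier (S_mod r l) \<Longrightarrow>
    \<phi> (\<lambda>T. v T + w T) = \<phi> v + (\<phi> w :: 'k::field)"
    unfolding dual_S_mod_def dual_mod_simps by (simp add: S_add)
  assume \<phi>: "\<phi> \<in> carrier (dual_S_mod r l)" and v: "v \<in> carrier (S_mod r l)"
  have "\<phi> (scalar (hyperoct r) c \<odot>\<^bsub>S_mod r l\<^esub> v) = c * \<phi> v"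
    using \<phi> v unfolding dual_S_mod_def dual_mod_simps by blast
  then show "\<phi> (\<lambda>T. c * v T) = c * \<phi> v" by (simp add: S_scalar[OF v])
qed

lemma dual_S_sum:
  assumes \<phi>: "\<phi> \<in> carrier (dual_S_mod r l)" and "finite I" "\<And>i. i \<in> I \<Longrightarrow> f i \<in> carrier (S_mod r l)"
  shows "\<phi> (\<lambda>T. \<Sum>i\<in>I. a i * f i T) = (\<Sum>i\<in>I. a i * (\<phi> (f i) :: 'k::field))"
  using assms(2,3)
proof (induction rule: finite_induct)
  case empty
  have "(\<lambda>T. 0) \<in> carrier (S_mod r l :: (_ \<Rightarrow> 'k, _) module)" using S_sum[of "{}"] by simp
  from dual_S_scale[OF \<phi> this, of 0] show ?case by simp
next
  case (insert x I)
  have 1: "(\<lambda>T. \<Sum>i\<in>I. a i * f i T) \<in> carrier (S_mod r l)" using insert by (intro S_sum) auto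
  have 2: "(\<lambda>T. a x * f x T) \<in> carrier (S_mod r l)" using S_sum[of "{x}" f r l a] insert by simp
  show ?case using dual_S_add[OF \<phi> 2 1] dual_S_scale[OF \<phi>, of "f x" "a x"] insert by simp
qed

text \<open>The polytabloids span the Specht module.\<close>

lemma dual_S_eqI:
  assumes \<phi>: "\<phi> \<in> carrier (dual_S_mod r l)" and \<psi>: "\<psi> \<in> carrier (dual_S_mod r l)"
    and eq: "\<And>t. t \<in> bitableaux r l \<Longrightarrow> \<phi> (polytabloid r l t) = (\<psi> (polytabloid r l t) :: 'k::field)"
  shows "\<phi> = \<psi>"
proof
  interpret finite_group "hyperoct r" by (rule finite_group_hyperoct)
  fix v
  show "\<phi> v = \<psi> v"
  proof (cases "v \<in> carrier (S_mod r l)")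
    case True
    then obtain c where v: "v = (\<lambda>T. \<Sum>t\<in>bitableaux r l. c t * polytabloid r l t T)" by (auto simp: S_carrier)
    have "\<chi> v = (\<Sum>t\<in>bitableaux r l. c t * \<chi> (polytabloid r l t))" if "\<chi> \<in> carrier (dual_S_mod r l)" for \<chi>
      unfolding v by (rule dual_S_sum[OF that finite_bitableaux polytabloid_S])
    from this[OF \<phi>] this[OF \<psi>] show ?thesis by (simp add: eq)
  next
    case False
    then show ?thesis using \<phi> \<psi> unfolding dual_S_mod_def dual_mod_simps by (auto simp: extensional_def)
  qed
qed

lemma dual_S_elem:
  assumes s: "\<sigma> \<in> carrier (hyperoct r)" and t: "t \<in> bitableaux r l"
  shows "(grp_elem \<sigma> \<odot>\<^bsub>dual_S_mod r l\<^esub> \<phi>) (polytabloid r l t) = (\<phi> (polytabloid r l (pinv \<sigma> \<circ> t)) :: 'k::field)"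
proof -
  interpret finite_group "hyperoct r" by (rule finite_group_hyperoct)
  show ?thesis
    unfolding dual_S_mod_def dual_mod_simps S_smult antipode_elem[OF s] hyperoct_inv[OF s]
    by (simp add: polytabloid_S[OF t] M_elem_polytabloid[OF t hyperoct_pinv[OF s]])
qed

lemma dual_S_add_apply:
  "t \<in> bitableaux r l \<Longrightarrow> (\<phi> \<oplus>\<^bsub>dual_S_mod r l\<^esub> \<psi>) (polytabloid r l t) = \<phi> (polytabloid r l t) + (\<psi> (polytabloid r l t) :: 'k::field)"
proof -
  interpret finite_group "hyperoct r" by (rule finite_group_hyperoct)
  assume t: "t \<in> bitableaux r l"
  show ?thesis unfolding dual_S_mod_def dual_mod_simps by (simp add: polytabloid_S[OF t])
qed

text \<open>The elements of the normal subgroup of sign changes.\<close>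

definition flips :: "int set \<Rightarrow> int \<Rightarrow> int"
  where "flips J i = (if \<bar>i\<bar> \<in> J then - i else i)"

lemma flips_abs [simp]: "\<bar>flips J i\<bar> = \<bar>i\<bar>"
  by (simp add: flips_def)

lemma flips_flips [simp]: "flips J (flips J i) = i"
  by (simp add: flips_def)

lemma flips_W: "J \<subseteq> {1..int r} \<Longrightarrow> flips J \<in> carrier (hyperoct r)"
proof -
  assume J: "J \<subseteq> {1..int r}"
  have "flips J permutes symbols r"
    unfolding permutes_def
  proof (intro conjI allI impI)
    show "flips J i = i" if "i \<notin> symbols r" for i
    proof -
      have "\<bar>i\<bar> \<notin> J" using J that by (auto simp: symbols_def abs_if split: if_splits)
      then show ?thesis by (simp add: flips_def)
    qed
    show "\<exists>!j. flips J j = i" for i by (metis flips_flips)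
  qed
  then show ?thesis by (auto simp: hyperoct_carrier flips_def)
qed

lemma flips_comp: "flips J \<circ> flips K = flips ((J - K) \<union> (K - J))"
  by (rule ext) (auto simp: flips_def)

lemma signed_sign_change:
  assumes "\<nu> \<in> carrier (hyperoct r)" "\<And>i. \<bar>\<nu> i\<bar> = \<bar>i\<bar>" shows "\<nu> ` signed B = signed B"
proof -
  have sg: "x \<in> signed B" if "y \<in> signed B" "\<bar>x\<bar> = \<bar>y\<bar>" for x y
  proof -
    have "x = y \<or> x = - y" using that(2) by (simp add: abs_eq_iff)
    then show ?thesis using that(1) unfolding signed_def by (auto simp: image_iff)
  qed
  show ?thesis
  proof
    show "\<nu> ` signed B \<subseteq> signed B" using sg assms(2) by blast
    show "signed B \<subseteq> \<nu> ` signed B"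
    proof
      fix y assume y: "y \<in> signed B"
      have p: "\<nu> permutes symbols r" using assms(1) by (simp add: hyperoct_carrier)
      have e: "\<nu> (pinv \<nu> y) = y" using permutes_inverses(1)[OF p] .
      have "\<bar>pinv \<nu> y\<bar> = \<bar>y\<bar>" using assms(2)[of "pinv \<nu> y"] e by simp
      then show "y \<in> \<nu> ` signed B" using sg[OF y] e by (metis imageI)
    qed
  qed
qed

text \<open>Conjugation carries the sign change of one symbol to the sign change of its image.\<close>

lemma hyperoct_flip:
  assumes s: "\<sigma> \<in> carrier (hyperoct r)" and x: "x \<ge> 0"
  shows "\<sigma> \<circ> flips {x} = flips {\<bar>\<sigma> x\<bar>} \<circ> \<sigma>"
proof
  fix i
  have p: "\<sigma> permutes symbols r" and odd: "\<sigma> (- i) = - \<sigma> i" for i using s by (auto simp: hyperoct_carrier)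
  have "\<bar>\<sigma> i\<bar> = \<bar>\<sigma> x\<bar> \<longleftrightarrow> \<bar>i\<bar> = x"
  proof
    assume "\<bar>\<sigma> i\<bar> = \<bar>\<sigma> x\<bar>"
    then have "\<sigma> i = \<sigma> x \<or> \<sigma> i = \<sigma> (- x)" by (simp add: abs_eq_iff odd)
    then have "i = x \<or> i = - x" using permutes_inj[OF p] by (auto dest: injD)
    then show "\<bar>i\<bar> = x" using x by auto
  next
    assume "\<bar>i\<bar> = x"
    then show "\<bar>\<sigma> i\<bar> = \<bar>\<sigma> x\<bar>" using odd by (auto simp: abs_if split: if_splits)
  qed
  then show "(\<sigma> \<circ> flips {x}) i = (flips {\<bar>\<sigma> x\<bar>} \<circ> \<sigma>) i" by (simp add: flips_def odd)
qed

lemma hsgn_flip: "x \<in> {1..int r} \<Longrightarrow> hsgn r (flips {x}) = - 1"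
proof -
  assume x: "x \<in> {1..int r}"
  have "{i \<in> {1..int r}. flips {x} i < 0} = {x}" using x by (auto simp: flips_def split: if_splits)
  moreover have "perm_part r (flips {x}) = id" by (auto simp: perm_part_def fun_eq_iff)
  ultimately show ?thesis by (simp add: hsgn_def del: id_apply)
qed

text \<open>The sign change of an entry of the first component is an odd element of the column
  stabilizer.\<close>

lemma polytabloid_flip:
  assumes t: "t \<in> bitableaux r l" and b: "Inl b \<in> diagram l"
  shows "polytabloid r l (flips {\<bar>t (Inl b)\<bar>} \<circ> t) T = (- polytabloid r l t T :: 'k::field)"
proof -
  let ?x = "\<bar>t (Inl b)\<bar>"
  have bij: "bij_betw (\<lambda>b. \<bar>t b\<bar>) (diagram l) {1..int r}" using t by (simp add: bitableaux_def)
  have x: "?x \<in> {1..int r}" using bij_betwE[OF bij] b by blast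
  then have W: "flips {?x} \<in> carrier (hyperoct r)" by (intro flips_W) simp
  have "flips {?x} y = y" if y: "y \<in> col2 l t j" for y j
  proof -
    obtain i where i: "y = t (Inr (i, j))" "(i, j) \<in> young (snd l)" using y by (auto simp: col2_def)
    then have "Inr (i, j) \<in> diagram l" by (auto simp: diagram_def)
    then have "\<bar>y\<bar> \<noteq> ?x" using bij b i(1) by (auto simp: bij_betw_def inj_on_def)
    then show ?thesis by (simp add: flips_def)
  qed
  then have "flips {?x} ` col2 l t j = col2 l t j" for j by force
  then have "flips {?x} \<in> col_stab r l t"
    unfolding col_stab_def using W signed_sign_change[OF W] by simp
  then show ?thesis using polytabloid_col_stab[OF t, of "flips {?x}"] hsgn_flip[OF x] by simp
qed

text \<open>Elements of the dual are compared at polytabloids. The inverse accounts for the inverse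
  in the contragredient action.\<close>

lemma derivation_inner_if_values:
  fixes c :: "(int \<Rightarrow> int) \<Rightarrow> (bitab set \<Rightarrow> 'k::field) \<Rightarrow> 'k"
  assumes c: "\<And>\<sigma>. \<sigma> \<in> carrier (hyperoct r) \<Longrightarrow> c \<sigma> \<in> carrier (dual_S_mod r l)" and m: "m \<in> carrier (dual_S_mod r l)"
    and val: "\<And>\<sigma> t. \<sigma> \<in> carrier (hyperoct r) \<Longrightarrow> t \<in> bitableaux r l \<Longrightarrow>
      c (pinv \<sigma>) (polytabloid r l t) = m (polytabloid r l (\<sigma> \<circ> t)) - m (polytabloid r l t)"
  shows "\<exists>m\<in>carrier (dual_S_mod r l). \<forall>\<sigma>\<in>carrier (hyperoct r). c \<sigma> = grp_elem \<sigma> \<odot>\<^bsub>dual_S_mod r l\<^esub> m \<ominus>\<^bsub>dual_S_mod r l\<^esub> m"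
proof (intro bexI[OF _ m] ballI)
  fix \<sigma> assume s: "\<sigma> \<in> carrier (hyperoct r)"
  interpret finite_group "hyperoct r" by (rule finite_group_hyperoct)
  interpret D: right_module "group_algebra (hyperoct r)" "dual_S_mod r l :: (_ \<Rightarrow> 'k, _) module" by (rule right_module_dual_S)
  have "c \<sigma> \<oplus>\<^bsub>dual_S_mod r l\<^esub> m = grp_elem \<sigma> \<odot>\<^bsub>dual_S_mod r l\<^esub> m"
  proof (rule dual_S_eqI)
    show "c \<sigma> \<oplus>\<^bsub>dual_S_mod r l\<^esub> m \<in> carrier (dual_S_mod r l)" using c[OF s] m by simp
    show "grp_elem \<sigma> \<odot>\<^bsub>dual_S_mod r l\<^esub> m \<in> carrier (dual_S_mod r l)" using s m by simp
    fix t assume t: "t \<in> bitableaux r l"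
    show "(c \<sigma> \<oplus>\<^bsub>dual_S_mod r l\<^esub> m) (polytabloid r l t) = (grp_elem \<sigma> \<odot>\<^bsub>dual_S_mod r l\<^esub> m) (polytabloid r l t)"
      using val[OF hyperoct_pinv[OF s] t] by (simp add: dual_S_add_apply[OF t] dual_S_elem[OF s t] hyperoct_cancel[OF s])
  qed
  then have "grp_elem \<sigma> \<odot>\<^bsub>dual_S_mod r l\<^esub> m \<ominus>\<^bsub>dual_S_mod r l\<^esub> m = c \<sigma> \<oplus>\<^bsub>dual_S_mod r l\<^esub> m \<ominus>\<^bsub>dual_S_mod r l\<^esub> m" by simp
  also have "\<dots> = c \<sigma>" using c[OF s] m by (simp add: a_minus_def D.M.a_assoc D.M.r_neg)
  finally show "c \<sigma> = grp_elem \<sigma> \<odot>\<^bsub>dual_S_mod r l\<^esub> m \<ominus>\<^bsub>dual_S_mod r l\<^esub> m" by simp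
qed

locale specht_derivation =
  fixes r :: nat and l :: bipart and c :: "(int \<Rightarrow> int) \<Rightarrow> (bitab set \<Rightarrow> 'k::field) \<Rightarrow> 'k"
  assumes c_closed: "\<And>\<sigma>. \<sigma> \<in> carrier (hyperoct r) \<Longrightarrow> c \<sigma> \<in> carrier (dual_S_mod r l)"
    and c_der: "\<And>\<sigma> \<tau>. \<sigma> \<in> carrier (hyperoct r) \<Longrightarrow> \<tau> \<in> carrier (hyperoct r) \<Longrightarrow>
      c (\<sigma> \<otimes>\<^bsub>hyperoct r\<^esub> \<tau>) = grp_elem \<tau> \<odot>\<^bsub>dual_S_mod r l\<^esub> c \<sigma> \<oplus>\<^bsub>dual_S_mod r l\<^esub> c \<tau>"
    and two: "(2::'k) \<noteq> 0" and three: "(3::'k) \<noteq> 0"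
begin

abbreviation W :: "(int \<Rightarrow> int) set" where "W \<equiv> carrier (hyperoct r)"
abbreviation BT :: "bitab set" where "BT \<equiv> bitableaux r l"
abbreviation e :: "bitab \<Rightarrow> bitab set \<Rightarrow> 'k" where "e \<equiv> polytabloid r l"

text \<open>The inverse turns the contragredient action on forms into the action on tableaux.\<close>

definition \<beta> :: "(int \<Rightarrow> int) \<Rightarrow> bitab \<Rightarrow> 'k" where "\<beta> \<sigma> t = c (pinv \<sigma>) (e t)"

lemma \<beta>_cocycle:
  assumes s: "\<sigma> \<in> W" and t: "\<tau> \<in> W" and b: "t \<in> BT"
  shows "\<beta> (\<tau> \<circ> \<sigma>) t = \<beta> \<tau> (\<sigma> \<circ> t) + \<beta> \<sigma> t"
proof -
  interpret finite_group "hyperoct r" by (rule finite_group_hyperoct)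
  have "pinv (\<tau> \<circ> \<sigma>) = inv\<^bsub>hyperoct r\<^esub> (\<sigma> \<otimes>\<^bsub>hyperoct r\<^esub> \<tau>)"
    using hyperoct_inv[OF hyperoct_comp[OF s t]] by (simp add: hyperoct_simps)
  also have "\<dots> = pinv \<tau> \<otimes>\<^bsub>hyperoct r\<^esub> pinv \<sigma>" unfolding inv_mult_group[OF s t] hyperoct_inv[OF s] hyperoct_inv[OF t] ..
  finally show ?thesis
    using c_der[OF hyperoct_pinv[OF t] hyperoct_pinv[OF s]]
    by (simp add: \<beta>_def dual_S_add_apply[OF b] dual_S_elem[OF hyperoct_pinv[OF s] b] hyperoct_cancel[OF s])
qed

text \<open>The values of \<open>\<beta> \<sigma>\<close> are those of a linear form on the Specht module.\<close>

lemma \<beta>_comb: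
  assumes "\<sigma> \<in> W" "finite I" "\<And>i. i \<in> I \<Longrightarrow> f i \<in> BT" "\<And>T. (\<Sum>i\<in>I. a i * e (f i) T) = 0"
  shows "(\<Sum>i\<in>I. a i * \<beta> \<sigma> (f i)) = 0"
proof -
  note C = c_closed[OF hyperoct_pinv[OF assms(1)]]
  have "(\<Sum>i\<in>I. a i * \<beta> \<sigma> (f i)) = c (pinv \<sigma>) (\<lambda>T. \<Sum>i\<in>I. a i * e (f i) T)"
    unfolding \<beta>_def by (rule dual_S_sum[OF C assms(2), symmetric]) (simp add: polytabloid_S assms(3))
  also have "\<dots> = c (pinv \<sigma>) (\<lambda>T. \<Sum>i\<in>{}. a i * e (f i) T)" by (simp add: assms(4))
  also have "\<dots> = 0" using dual_S_sum[OF C, of "{}" "\<lambda>i. e (f i)" a] by simp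
  finally show ?thesis .
qed

lemma \<beta>_scale:
  assumes "\<sigma> \<in> W" "t \<in> BT" "t' \<in> BT" "\<And>T. e t' T = a * e t T" shows "\<beta> \<sigma> t' = a * \<beta> \<sigma> t"
proof -
  have "e t' = (\<lambda>T. a * e t T)" using assms(4) by blast
  then show ?thesis
    using dual_S_scale[OF c_closed[OF hyperoct_pinv[OF assms(1)]] polytabloid_S[OF assms(2)], of a] by (simp add: \<beta>_def)
qed

text \<open>The form \<open>m\<close> is minus the average of \<open>\<beta>\<close> over the sign changes. The difference \<open>\<gamma>\<close> of
  \<open>\<beta>\<close> and the coboundary of \<open>m\<close> vanishes on sign changes, by a translation of the summation
  index. For a sign change \<open>\<xi>\<close> of an entry of the first component, \<open>\<xi> \<sigma> = \<sigma> \<xi>'\<close> with another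
  sign change \<open>\<xi>'\<close>, and the two ways to expand \<open>\<gamma>\<close> there give \<open>- \<gamma> \<sigma> t\<close> and \<open>\<gamma> \<sigma> t\<close>.\<close>

lemma derivation_inner_if_fst_nonempty:
  assumes b: "Inl b \<in> diagram l"
  shows "\<exists>m\<in>carrier (dual_S_mod r l). \<forall>\<sigma>\<in>W. c \<sigma> = grp_elem \<sigma> \<odot>\<^bsub>dual_S_mod r l\<^esub> m \<ominus>\<^bsub>dual_S_mod r l\<^esub> m"
proof -
  let ?A = "{1..int r}"
  let ?N = "(2::'k) ^ r"
  have N0: "?N \<noteq> 0" using two by simp
  have fl: "flips J \<in> W" if "J \<subseteq> ?A" for J using flips_W[OF that] .
  define F where "F v = - inverse ?N * (\<Sum>J\<in>Pow ?A. c (pinv (flips J)) v)" for v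
  define m where "m = restrict F (carrier (S_mod r l))"
  have cD: "c (pinv (flips J)) \<in> carrier (dual_S_mod r l)" if "J \<in> Pow ?A" for J
    using that by (intro c_closed hyperoct_pinv fl) simp
  have m: "m \<in> carrier (dual_S_mod r l)"
    unfolding m_def
  proof (rule dual_S_I)
    fix v w :: "bitab set \<Rightarrow> 'k" assume "v \<in> carrier (S_mod r l)" "w \<in> carrier (S_mod r l)"
    then have "(\<Sum>J\<in>Pow ?A. c (pinv (flips J)) (\<lambda>T. v T + w T)) =
        (\<Sum>J\<in>Pow ?A. c (pinv (flips J)) v + c (pinv (flips J)) w)"
      by (intro sum.cong refl dual_S_add[OF cD])
    then show "F (\<lambda>T. v T + w T) = F v + F w" by (simp add: F_def sum.distrib distrib_left)
  next
    fix a and v :: "bitab set \<Rightarrow> 'k" assume "v \<in> carrier (S_mod r l)"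
    then have "(\<Sum>J\<in>Pow ?A. c (pinv (flips J)) (\<lambda>T. a * v T)) = (\<Sum>J\<in>Pow ?A. a * c (pinv (flips J)) v)"
      by (intro sum.cong refl dual_S_scale[OF cD])
    then show "F (\<lambda>T. a * v T) = a * F v" by (simp add: F_def sum_distrib_left mult_ac)
  qed
  have m_e: "?N * m (e t) = - (\<Sum>J\<in>Pow ?A. \<beta> (flips J) t)" if "t \<in> BT" for t
    using N0 by (simp add: m_def F_def polytabloid_S[OF that] \<beta>_def)
  define \<gamma> where "\<gamma> \<sigma> t = \<beta> \<sigma> t - (m (e (\<sigma> \<circ> t)) - m (e t))" for \<sigma> t
  have \<gamma>_cocycle: "\<gamma> (\<tau> \<circ> \<sigma>) t = \<gamma> \<tau> (\<sigma> \<circ> t) + \<gamma> \<sigma> t" if "\<sigma> \<in> W" "\<tau> \<in> W" "t \<in> BT" for \<sigma> \<tau> t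
    by (simp add: \<gamma>_def \<beta>_cocycle[OF that] comp_assoc)
  have \<gamma>_flips: "\<gamma> (flips K) t = 0" if K: "K \<subseteq> ?A" and t: "t \<in> BT" for K t
  proof -
    have "(\<Sum>J\<in>Pow ?A. \<beta> (flips J) t) = (\<Sum>J\<in>Pow ?A. \<beta> (flips J \<circ> flips K) t)"
      unfolding flips_comp
      by (rule sum.reindex_bij_witness[of _ "\<lambda>J. (J - K) \<union> (K - J)" "\<lambda>J. (J - K) \<union> (K - J)"])
        (use K in \<open>auto intro!: arg_cong[where f = "\<lambda>J. \<beta> (flips J) t"]\<close>)
    also have "\<dots> = (\<Sum>J\<in>Pow ?A. \<beta> (flips J) (flips K \<circ> t) + \<beta> (flips K) t)"
      by (rule sum.cong) (use fl K t in \<open>auto simp: \<beta>_cocycle\<close>)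
    also have "\<dots> = (\<Sum>J\<in>Pow ?A. \<beta> (flips J) (flips K \<circ> t)) + ?N * \<beta> (flips K) t"
      by (simp add: sum.distrib card_Pow)
    finally have sum_eq: "(\<Sum>J\<in>Pow ?A. \<beta> (flips J) t) =
      (\<Sum>J\<in>Pow ?A. \<beta> (flips J) (flips K \<circ> t)) + ?N * \<beta> (flips K) t" .
    have "?N * (\<beta> (flips K) t - (m (e (flips K \<circ> t)) - m (e t))) =
        ?N * \<beta> (flips K) t - ?N * m (e (flips K \<circ> t)) + ?N * m (e t)"
      by (simp add: algebra_simps)
    also have "\<dots> = 0" unfolding m_e[OF t] m_e[OF bitableaux_act[OF t fl[OF K]]] sum_eq by simp
    finally have "?N * (\<beta> (flips K) t - (m (e (flips K \<circ> t)) - m (e t))) = 0" .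
    then have "\<beta> (flips K) t - (m (e (flips K \<circ> t)) - m (e t)) = 0" using N0 mult_eq_0_iff by blast
    then show ?thesis by (simp add: \<gamma>_def)
  qed
  have \<gamma>_0: "\<gamma> \<sigma> t = 0" if s: "\<sigma> \<in> W" and t: "t \<in> BT" for \<sigma> t
  proof -
    let ?x = "\<bar>t (Inl b)\<bar>" and ?y = "\<bar>(\<sigma> \<circ> t) (Inl b)\<bar>"
    have st: "\<sigma> \<circ> t \<in> BT" by (rule bitableaux_act[OF t s])
    have mem: "\<bar>u (Inl b)\<bar> \<in> ?A" if "u \<in> BT" for u
      using that b by (auto simp: bitableaux_def dest!: bij_betwE)
    have x: "{?x} \<subseteq> ?A" and y: "{?y} \<subseteq> ?A" using mem[OF t] mem[OF st] by auto
    have xt: "flips {?x} \<circ> t \<in> BT" by (rule bitableaux_act[OF t fl[OF x]])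
    have yst: "flips {?y} \<circ> (\<sigma> \<circ> t) \<in> BT" by (rule bitableaux_act[OF st fl[OF y]])
    have comm: "\<sigma> \<circ> flips {?x} = flips {?y} \<circ> \<sigma>"
      using hyperoct_flip[OF s, of ?x] hyperoct_abs[OF s, of "t (Inl b)"] by simp
    have neg: "e (flips {?x} \<circ> t) T = - 1 * e t T" "e (flips {?y} \<circ> (\<sigma> \<circ> t)) T = - 1 * e (\<sigma> \<circ> t) T" for T
      using polytabloid_flip[OF t b] polytabloid_flip[OF st b] by simp_all
    have mneg: "m (e u') = - m (e u)" if "u \<in> BT" "\<And>T. e u' T = - 1 * e u T" for u u'
    proof -
      have "e u' = (\<lambda>T. - 1 * e u T)" using that(2) by blast
      then show ?thesis using dual_S_scale[OF m polytabloid_S[OF that(1)], of "- 1"] by simp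
    qed
    have "\<gamma> \<sigma> (flips {?x} \<circ> t) = - \<gamma> \<sigma> t"
      using \<beta>_scale[OF s t xt neg(1)] mneg[OF t neg(1)] mneg[OF st neg(2)] comm
      by (simp add: \<gamma>_def comp_assoc[symmetric])
    then have "- \<gamma> \<sigma> t = \<gamma> (\<sigma> \<circ> flips {?x}) t"
      using \<gamma>_cocycle[OF fl[OF x] s t] \<gamma>_flips[OF x t] by simp
    also have "\<dots> = \<gamma> \<sigma> t"
      unfolding comm using \<gamma>_cocycle[OF s fl[OF y] t] \<gamma>_flips[OF y st] by simp
    finally have "\<gamma> \<sigma> t = - \<gamma> \<sigma> t" by simp
    then show ?thesis by (rule eq_neg_self_imp_zero[OF two])
  qed
  show ?thesis
    by (rule derivation_inner_if_values[OF c_closed m]) (use \<gamma>_0 in \<open>simp_all add: \<gamma>_def \<beta>_def\<close>)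
qed

end

section \<open>Bi-partitions with empty first component\<close>

lemma hyperoct_eqI:
  assumes s: "\<sigma> \<in> carrier (hyperoct r)" and t: "\<tau> \<in> carrier (hyperoct r)"
    and eq: "\<And>i. i \<in> {1..int r} \<Longrightarrow> \<sigma> i = \<tau> i"
  shows "\<sigma> = \<tau>"
proof
  fix i
  have "i \<in> {1..int r} \<or> - i \<in> {1..int r} \<or> i \<notin> symbols r" by (auto simp: symbols_def)
  then consider "i \<in> {1..int r}" | "- i \<in> {1..int r}" | "i \<notin> symbols r" by blast
  then show "\<sigma> i = \<tau> i"
  proof cases
    case 2
    then have "\<sigma> (- i) = \<tau> (- i)" by (rule eq)
    then show ?thesis using s t by (simp add: hyperoct_carrier)
  next
    case 3
    then show ?thesis using s t permutes_not_in unfolding hyperoct_carrier by metis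
  qed (rule eq)
qed

text \<open>The embedding of the symmetric group into the hyperoctahedral group.\<close>

definition odd_ext :: "(int \<Rightarrow> int) \<Rightarrow> int \<Rightarrow> int"
  where "odd_ext \<sigma> i = (if i < 0 then - \<sigma> (- i) else \<sigma> i)"

lemma permutes_pos:
  assumes s: "\<sigma> permutes {1..int r}" and x: "0 \<le> x"
  shows "0 \<le> \<sigma> x" "\<sigma> x = 0 \<longleftrightarrow> x = 0"
proof -
  have 0: "\<sigma> 0 = 0" using permutes_not_in[OF s] by simp
  show "0 \<le> \<sigma> x" using permutes_in_image[OF s, of x] permutes_not_in[OF s, of x] x by (cases "x \<in> {1..int r}") auto
  show "\<sigma> x = 0 \<longleftrightarrow> x = 0" using permutes_inj[OF s] 0 by (metis injD)
qed

lemma odd_ext_comp: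
  assumes s: "\<sigma> permutes {1..int r}" shows "odd_ext (\<tau> \<circ> \<sigma>) = odd_ext \<tau> \<circ> odd_ext \<sigma>"
proof
  fix i
  show "odd_ext (\<tau> \<circ> \<sigma>) i = (odd_ext \<tau> \<circ> odd_ext \<sigma>) i"
    using permutes_pos[OF s, of i] permutes_pos[OF s, of "- i"] by (auto simp: odd_ext_def)
qed

lemma odd_ext_W: "\<sigma> permutes {1..int r} \<Longrightarrow> odd_ext \<sigma> \<in> carrier (hyperoct r)"
proof -
  assume s: "\<sigma> permutes {1..int r}"
  have 0: "\<sigma> 0 = 0" using permutes_not_in[OF s] by simp
  have id: "odd_ext id = id" by (auto simp: odd_ext_def)
  have inv: "odd_ext (pinv \<sigma>) (odd_ext \<sigma> i) = i" "odd_ext \<sigma> (odd_ext (pinv \<sigma>) i) = i" for i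
    using fun_cong[OF odd_ext_comp[OF s, of "pinv \<sigma>"], of i] fun_cong[OF odd_ext_comp[OF permutes_inv[OF s], of \<sigma>], of i]
    by (simp_all add: permutes_inv_o[OF s] id)
  have "odd_ext \<sigma> permutes symbols r"
    unfolding permutes_def
  proof (intro conjI allI impI)
    show "odd_ext \<sigma> i = i" if "i \<notin> symbols r" for i
      using that permutes_not_in[OF s, of i] permutes_not_in[OF s, of "- i"] by (auto simp: odd_ext_def symbols_def)
    show "\<exists>!j. odd_ext \<sigma> j = i" for i using inv by metis
  qed
  then show ?thesis using 0 by (auto simp: hyperoct_carrier odd_ext_def)
qed

lemma hsgn_odd_ext:
  assumes s: "\<sigma> permutes {1..int r}" shows "hsgn r (odd_ext \<sigma>) = sign \<sigma>"
proof -
  have e: "{i \<in> {1..int r}. odd_ext \<sigma> i < 0} = {}"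
    using permutes_pos(1)[OF s] by (auto simp: odd_ext_def not_less)
  have "perm_part r (odd_ext \<sigma>) = \<sigma>"
  proof
    fix i show "perm_part r (odd_ext \<sigma>) i = \<sigma> i"
      using permutes_pos(1)[OF s, of i] permutes_not_in[OF s, of i] by (auto simp: perm_part_def odd_ext_def)
  qed
  then show ?thesis unfolding hsgn_def e by simp
qed

lemma abs_odd_ext_perm_part:
  assumes s: "\<sigma> \<in> carrier (hyperoct r)" shows "\<bar>odd_ext (perm_part r \<sigma>) i\<bar> = \<bar>\<sigma> i\<bar>"
proof -
  have p: "\<sigma> permutes symbols r" and odd: "\<sigma> (- i) = - \<sigma> i" for i using s by (auto simp: hyperoct_carrier)
  have *: "\<bar>perm_part r \<sigma> k\<bar> = \<bar>\<sigma> k\<bar>" if "0 \<le> k" for k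
  proof (cases "k \<in> {1..int r}")
    case False
    then have "k \<notin> symbols r" using that by (auto simp: symbols_def)
    then have "\<sigma> k = k" by (rule permutes_not_in[OF p])
    then show ?thesis using False by (simp only: perm_part_def if_False)
  qed (simp add: perm_part_def)
  show ?thesis using *[of i] *[of "- i"] odd[of i] by (auto simp: odd_ext_def)
qed

text \<open>If the first diagram is empty, then the bi-tableaux are, up to sign changes, the
  tableaux of the second diagram with positive entries.\<close>

locale second_component =
  fixes r :: nat and l :: bipart
  assumes fst_empty: "young (fst l) = {}" and part: "is_partition (snd l)"

sublocale second_component \<subseteq> young_shape "young (snd l)" "{1..int r}"
proof
  show "(i', j') \<in> young (snd l)" if "(i, j) \<in> young (snd l)" "i' \<le> i" "j' \<le> j" for i j i' j'
  proof -
    have ij: "i < length (snd l)" "j < snd l ! i" using that by (auto simp: young_def)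
    have "snd l ! i \<le> snd l ! i'"
      using part ij that(2) sorted_wrt_nth_less[of "(\<ge>)" "snd l" i' i] by (cases "i' = i") (auto simp: is_partition_def)
    then show ?thesis using ij that by (auto simp: young_def)
  qed
qed (auto simp: finite_young)

context second_component
begin

abbreviation D :: "(nat \<times> nat) set" where "D \<equiv> young (snd l)"
abbreviation W :: "(int \<Rightarrow> int) set" where "W \<equiv> carrier (hyperoct r)"

definition lift :: "tab \<Rightarrow> bitab" where "lift t = case_sum (\<lambda>_. 0) t"

lemma lift_simps [simp]: "lift t (Inl b) = 0" "lift t (Inr b) = t b"
  by (simp_all add: lift_def)

lemma diagram_eq: "diagram l = Inr ` D"
  using fst_empty by (auto simp: diagram_def)

lemma rows_cols: "row1 l t i = {}" "col1 l t i = {}"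
  "row2 l (lift u) i = {u (i, j) |j. (i, j) \<in> D}" "col2 l (lift u) j = {u (i, j) |i. (i, j) \<in> D}"
  by (simp_all add: row1_def col1_def row2_def col2_def fst_empty)

lemma Tab_nonneg: "t \<in> Tab \<Longrightarrow> 0 \<le> t b"
  using Tab_in[of t b] by (cases "b \<in> D") (auto simp: Tab_def)

lemma lift_act:
  assumes "t \<in> Tab" "\<sigma> permutes {1..int r}" shows "odd_ext \<sigma> \<circ> lift t = lift (\<sigma> \<circ> t)"
proof
  fix b
  have 0: "\<sigma> 0 = 0" using permutes_not_in[OF assms(2)] by simp
  have "0 \<le> lift t b" using Tab_nonneg[OF assms(1)] by (cases b) simp_all
  then have "odd_ext \<sigma> (lift t b) = \<sigma> (lift t b)" by (simp add: odd_ext_def)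
  then show "(odd_ext \<sigma> \<circ> lift t) b = lift (\<sigma> \<circ> t) b" using 0 by (cases b) simp_all
qed

lemma lift_bitableau: "t \<in> Tab \<Longrightarrow> lift t \<in> bitableaux r l"
proof -
  assume t: "t \<in> Tab"
  have "bij_betw (lift t) (Inr ` D) {1..int r}"
    using t by (auto simp: Tab_def bij_betw_def inj_on_def image_image)
  moreover have "\<bar>lift t b\<bar> = lift t b" for b using Tab_nonneg[OF t] by (cases b) auto
  ultimately show ?thesis using t by (auto simp: bitableaux_def diagram_eq lift_def Tab_def split: sum.splits)
qed

text \<open>The element that moves the entries of \<open>t\<close> as \<open>\<pi>\<close> moves its boxes.\<close>

definition entry_perm :: "tab \<Rightarrow> (nat \<times> nat \<Rightarrow> nat \<times> nat) \<Rightarrow> int \<Rightarrow> int"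
  where "entry_perm t \<pi> = odd_ext (map_permutation D t \<pi>)"

lemma entry_perm:
  assumes t: "t \<in> Tab" and p: "\<pi> permutes D"
  shows "entry_perm t \<pi> \<in> W" "entry_perm t \<pi> \<circ> lift t = lift (t \<circ> \<pi>)" "hsgn r (entry_perm t \<pi>) = sign \<pi>"
  using Tab_map_permutation[OF t p] odd_ext_W lift_act[OF t] hsgn_odd_ext by (auto simp: entry_perm_def)

lemma entry_perm_apply:
  assumes t: "t \<in> Tab" and p: "\<pi> permutes D" shows "entry_perm t \<pi> (t b) = t (\<pi> b)"
  using fun_cong[OF entry_perm(2)[OF t p], of "Inr b"] by simp

lemma entry_perm_image:
  assumes t: "t \<in> Tab" and p: "\<pi> permutes D" and B: "B \<subseteq> D" "\<pi> ` B \<subseteq> B"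
  shows "entry_perm t \<pi> ` (t ` B) = t ` B"
proof (rule endo_inj_surj)
  show "finite (t ` B)" using finD B finite_subset by blast
  show "entry_perm t \<pi> ` (t ` B) \<subseteq> t ` B" using B by (auto simp: entry_perm_apply[OF t p])
  show "inj_on (entry_perm t \<pi>) (t ` B)"
    using entry_perm(1)[OF t p] by (auto simp: hyperoct_carrier intro: permutes_inj_on)
qed

lemma entry_perm_col_stab:
  assumes t: "t \<in> Tab" and p: "\<pi> \<in> col_perms" shows "entry_perm t \<pi> \<in> col_stab r l (lift t)"
proof -
  have "entry_perm t \<pi> ` (t ` {b \<in> D. snd b = j}) = t ` {b \<in> D. snd b = j}" for j
    by (rule entry_perm_image[OF t col_perms_permutes[OF p]])
      (use p permutes_in_image[OF col_perms_permutes[OF p]] in \<open>auto simp: col_perms_def\<close>)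
  moreover have "t ` {b \<in> D. snd b = j} = col2 l (lift t) j" for j by (force simp: rows_cols)
  ultimately show ?thesis
    using entry_perm(1)[OF t col_perms_permutes[OF p]] by (simp add: col_stab_def rows_cols(2) signed_def)
qed

lemma entry_perm_row_stab:
  assumes t: "t \<in> Tab" and p: "\<rho> \<in> row_perms" shows "entry_perm t \<rho> \<in> row_stab r l (lift t)"
proof -
  have pD: "\<rho> permutes D" using p by (simp add: row_perms_def)
  have "entry_perm t \<rho> ` (t ` {b \<in> D. fst b = i}) = t ` {b \<in> D. fst b = i}" for i
    by (rule entry_perm_image[OF t pD]) (use p permutes_in_image[OF pD] in \<open>auto simp: row_perms_def\<close>)
  moreover have "t ` {b \<in> D. fst b = i} = row2 l (lift t) i" for i by (force simp: rows_cols)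
  ultimately have "entry_perm t \<rho> ` row2 l (lift t) i = row2 l (lift t) i" for i by simp
  then have "entry_perm t \<rho> ` signed (row2 l (lift t) i) = signed (row2 l (lift t) i)" for i
    using signed_image[OF entry_perm(1)[OF t pD], of "row2 l (lift t) i"] by simp
  then show ?thesis
    using entry_perm(1)[OF t pD] by (simp add: row_stab_def rows_cols(1))
qed

text \<open>The entries of a column are positive and a column stabilizer permutes them without sign
  changes, so it comes from a permutation of the boxes.\<close>

lemma col_stab_entry_perm:
  assumes t: "t \<in> Tab" and s: "\<sigma> \<in> col_stab r l (lift t)"
  obtains \<pi> where "\<pi> \<in> col_perms" "\<sigma> = entry_perm t \<pi>"
proof -
  have sW: "\<sigma> \<in> W" using s by (rule col_stab_W)
  then have sp: "\<sigma> permutes symbols r" by (simp add: hyperoct_carrier)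
  have col: "\<exists>i'. (i', snd b) \<in> D \<and> \<sigma> (t b) = t (i', snd b)" if b: "b \<in> D" for b
  proof -
    have "t b \<in> col2 l (lift t) (snd b)" using b by (auto simp: rows_cols intro!: exI[of _ "fst b"])
    then have "\<sigma> (t b) \<in> col2 l (lift t) (snd b)" using col_stab_image(2)[OF s] by blast
    then show ?thesis by (auto simp: rows_cols)
  qed
  have bt: "bij_betw t D {1..int r}" using t by (simp add: Tab_def)
  have img: "(\<sigma> \<circ> t) ` D \<subseteq> {1..int r}" using col Tab_in[OF t] by fastforce
  have inj: "inj_on (\<sigma> \<circ> t) D"
    using bt permutes_inj_on[OF sp] by (auto simp: bij_betw_def intro: comp_inj_on)
  have "(\<sigma> \<circ> t) ` D = {1..int r}"
    by (rule card_subset_eq[OF _ img]) (use card_image[OF inj] bij_betw_same_card[OF bt] in auto)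
  then have "\<sigma> \<circ> t \<in> Tab"
    using inj t hyperoct_zero[OF sW] by (auto simp: Tab_def bij_betw_def)
  then obtain \<pi> where p: "\<pi> permutes D" "\<sigma> \<circ> t = t \<circ> \<pi>" using Tab_transition[OF t] by metis
  have "snd (\<pi> b) = snd b" for b
  proof (cases "b \<in> D")
    case True
    obtain i' where i': "(i', snd b) \<in> D" "\<sigma> (t b) = t (i', snd b)" using col[OF True] by blast
    then have "t (\<pi> b) = t (i', snd b)" using fun_cong[OF p(2), of b] by simp
    then have "\<pi> b = (i', snd b)" using Tab_eqD[OF t _ i'(1)] permutes_in_image[OF p(1)] True by blast
    then show ?thesis by simp
  qed (use permutes_not_in[OF p(1)] in simp)
  then have "\<pi> \<in> col_perms" using p by (simp add: col_perms_def)
  moreover have "\<sigma> = entry_perm t \<pi>"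
  proof (rule hyperoct_eqI[OF sW entry_perm(1)[OF t p(1)]])
    fix i assume "i \<in> {1..int r}"
    then have "i \<in> t ` D" using bt by (simp add: bij_betw_def)
    then obtain b where "i = t b" by blast
    then show "\<sigma> i = entry_perm t \<pi> i" using fun_cong[OF p(2), of b] by (simp add: entry_perm_apply[OF t p(1)])
  qed
  ultimately show thesis by (rule that)
qed

text \<open>A row stabilizer may change signs, but both tableaux have positive entries, so it
  matches the rows of \<open>t\<close> with those of \<open>u\<close> as they are.\<close>

lemma tabloid_lift_iff:
  assumes t: "t \<in> Tab" and u: "u \<in> Tab"
  shows "tabloid r l (lift t) = tabloid r l (lift u) \<longleftrightarrow> roweq t u"
proof
  assume "roweq t u"
  then obtain \<rho> where \<rho>: "\<rho> \<in> row_perms" "u = t \<circ> \<rho>" by (auto simp: roweq_def)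
  then have pD: "\<rho> permutes D" by (simp add: row_perms_def)
  show "tabloid r l (lift t) = tabloid r l (lift u)"
    using tabloid_row_stab[OF entry_perm_row_stab[OF t \<rho>(1)]] entry_perm(2)[OF t pD] \<rho>(2) by simp
next
  assume "tabloid r l (lift t) = tabloid r l (lift u)"
  then have "lift u \<in> tabloid r l (lift t)" using tabloid_refl by simp
  then obtain \<sigma> where s: "\<sigma> \<in> row_stab r l (lift t)" "lift u = \<sigma> \<circ> lift t"
    by (auto simp: tabloid_def tab_act_def)
  obtain \<rho> where p: "\<rho> permutes D" "u = t \<circ> \<rho>" using Tab_transition[OF t u] .
  have "fst (\<rho> b) = fst b" for b
  proof (cases "b \<in> D")
    case True
    have "t b \<in> row2 l (lift t) (fst b)" using True by (auto simp: rows_cols intro!: exI[of _ "snd b"])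
    then have "\<sigma> (t b) \<in> signed (row2 l (lift t) (fst b))"
      using row_stab_image(2)[OF s(1)] by (auto simp: signed_def)
    moreover have "\<sigma> (t b) = u b" using fun_cong[OF s(2), of "Inr b"] by simp
    ultimately obtain j' where j': "(fst b, j') \<in> D" "u b = t (fst b, j') \<or> u b = - t (fst b, j')"
      by (auto simp: signed_def rows_cols)
    moreover have "u b > 0" "t (fst b, j') > 0" using Tab_in[OF u True] Tab_in[OF t j'(1)] by auto
    ultimately have "t (\<rho> b) = t (fst b, j')" using p(2) by auto
    then have "\<rho> b = (fst b, j')" using Tab_eqD[OF t _ j'(1)] permutes_in_image[OF p(1)] True by blast
    then show ?thesis by simp
  qed (use permutes_not_in[OF p(1)] in simp)
  then have "\<rho> \<in> row_perms" using p by (simp add: row_perms_def)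
  then show "roweq t u" using p(2) by (auto simp: roweq_def)
qed

text \<open>This identifies the polytabloids of the hyperoctahedral group with the classical ones.\<close>

lemma polytabloid_lift:
  assumes t: "t \<in> Tab" and u: "u \<in> Tab"
  shows "polytabloid r l (lift t) (tabloid r l (lift u)) = (pt_coeff t u :: 'k::field)"
proof -
  let ?S = "{\<sigma> \<in> col_stab r l (lift t). tabloid r l (\<sigma> \<circ> lift t) = tabloid r l (lift u)}"
  let ?P = "{\<pi> \<in> col_perms. roweq (t \<circ> \<pi>) u}"
  have tab: "tabloid r l (entry_perm t \<pi> \<circ> lift t) = tabloid r l (lift u) \<longleftrightarrow> roweq (t \<circ> \<pi>) u" if "\<pi> \<in> col_perms" for \<pi>
    using tabloid_lift_iff[OF Tab_comp[OF t col_perms_permutes[OF that]] u] entry_perm(2)[OF t col_perms_permutes[OF that]] by simp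
  have S: "?S = entry_perm t ` ?P"
  proof
    show "?S \<subseteq> entry_perm t ` ?P"
    proof
      fix \<sigma> assume s: "\<sigma> \<in> ?S"
      then obtain \<pi> where p: "\<pi> \<in> col_perms" "\<sigma> = entry_perm t \<pi>" using col_stab_entry_perm[OF t] by blast
      then show "\<sigma> \<in> entry_perm t ` ?P" using s tab[OF p(1)] by simp
    qed
    show "entry_perm t ` ?P \<subseteq> ?S" using tab entry_perm_col_stab[OF t] by blast
  qed
  have inj: "inj_on (entry_perm t) ?P"
  proof (rule inj_onI)
    fix \<pi> \<kappa> assume *: "\<pi> \<in> ?P" "\<kappa> \<in> ?P" "entry_perm t \<pi> = entry_perm t \<kappa>"
    then have p: "\<pi> permutes D" "\<kappa> permutes D" by (auto dest: col_perms_permutes)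
    show "\<pi> = \<kappa>"
    proof
      fix b
      have "t (\<pi> b) = t (\<kappa> b)" using *(3) entry_perm_apply[OF t] p by metis
      then show "\<pi> b = \<kappa> b"
        using Tab_eqD[OF t, of "\<pi> b" "\<kappa> b"] permutes_in_image[OF p(1), of b] permutes_in_image[OF p(2), of b]
          permutes_not_in[OF p(1), of b] permutes_not_in[OF p(2), of b] by (cases "b \<in> D") auto
    qed
  qed
  show ?thesis
    unfolding polytabloid_eq[OF lift_bitableau[OF t]] S sum.reindex[OF inj] pt_coeff_def
    by (rule sum.cong) (auto simp: entry_perm(3)[OF t col_perms_permutes])
qed

lemma sign_change_row_stab:
  assumes "\<nu> \<in> W" "\<And>i. \<bar>\<nu> i\<bar> = \<bar>i\<bar>" shows "\<nu> \<in> row_stab r l s"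
  using assms(1) signed_sign_change[OF assms] by (simp add: row_stab_def rows_cols(1))

text \<open>Sign changes stabilize the rows of the second component, so they act trivially on
  tabloids.\<close>

lemma polytabloid_sign_change:
  assumes s: "s \<in> bitableaux r l" and \<nu>: "\<nu> \<in> W" "\<And>i. \<bar>\<nu> i\<bar> = \<bar>i\<bar>"
  shows "polytabloid r l (\<nu> \<circ> s) = (polytabloid r l s :: _ \<Rightarrow> 'k::field)"
  by (rule ext) (simp add: polytabloid_act_eq[OF s \<nu>(1)] polytabloid_eq[OF s]
      tabloid_row_stab[OF sign_change_row_stab[OF \<nu>]])

text \<open>Changing the signs of the negative entries makes all entries positive.\<close>

lemma bitableau_lift:
  assumes s: "s \<in> bitableaux r l"
  obtains u \<nu> where "u \<in> Tab" "\<nu> \<in> W" "\<And>i. \<bar>\<nu> i\<bar> = \<bar>i\<bar>" "\<nu> \<circ> s = lift u"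
proof -
  have bij: "bij_betw (\<lambda>b. \<bar>s b\<bar>) (Inr ` D) {1..int r}" and z: "\<And>b. b \<notin> Inr ` D \<Longrightarrow> s b = 0"
    using s by (auto simp: bitableaux_def diagram_eq)
  define u where "u b = \<bar>s (Inr b)\<bar>" for b
  define J where "J = {x \<in> {1..int r}. \<exists>b\<in>Inr ` D. s b = - x}"
  have "bij_betw ((\<lambda>b. \<bar>s b\<bar>) \<circ> Inr) D {1..int r}"
    by (rule bij_betw_trans[OF _ bij]) (simp add: bij_betw_def)
  then have "u \<in> Tab" using z by (auto simp: Tab_def u_def[abs_def] o_def)
  moreover have "flips J \<in> W" by (rule flips_W) (auto simp: J_def)
  moreover have "flips J \<circ> s = lift u"
  proof
    fix b
    show "(flips J \<circ> s) b = lift u b"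
    proof (cases "b \<in> Inr ` D")
      case True
      then have A: "\<bar>s b\<bar> \<in> {1..int r}" using bij by (auto simp: bij_betw_def)
      have "\<bar>s b\<bar> \<in> J \<longleftrightarrow> s b < 0"
      proof
        assume "\<bar>s b\<bar> \<in> J"
        then obtain b' where b': "b' \<in> Inr ` D" "s b' = - \<bar>s b\<bar>" by (auto simp: J_def)
        then have "\<bar>s b'\<bar> = \<bar>s b\<bar>" by simp
        then have "b' = b" using inj_onD[OF bij_betw_imp_inj_on[OF bij] _ b'(1) True] by blast
        then show "s b < 0" using b' A by auto
      next
        assume neg: "s b < 0"
        then have "s b = - \<bar>s b\<bar>" by simp
        then show "\<bar>s b\<bar> \<in> J" unfolding J_def using A True by blast
      qed
      then show ?thesis using True by (auto simp: flips_def u_def)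
    next
      case False
      then show ?thesis using z[OF False] by (cases b) (auto simp: flips_def u_def)
    qed
  qed
  ultimately show thesis by (intro that[of u "flips J"]) auto
qed

end
context specht_derivation
begin

text \<open>Each element of the group is a sign change times the odd extension of a permutation. As
  \<open>\<beta>\<close> vanishes on sign changes and these act trivially on polytabloids, the linear form that
  is found for the permutations works for all elements.\<close>

lemma derivation_inner_if_fst_empty:
  assumes "young (fst l) = {}" "is_partition (snd l)"
  shows "\<exists>m\<in>carrier (dual_S_mod r l). \<forall>\<sigma>\<in>W. c \<sigma> = grp_elem \<sigma> \<odot>\<^bsub>dual_S_mod r l\<^esub> m \<ominus>\<^bsub>dual_S_mod r l\<^esub> m"
proof -
  interpret Y: second_component r l by unfold_locales (use assms in auto)
  have \<beta>_eq: "\<beta> \<sigma> t' = \<beta> \<sigma> t" if "\<sigma> \<in> W" "t \<in> BT" "t' \<in> BT" "e t' = e t" for \<sigma> t t'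
    using \<beta>_scale[OF that(1-3), of 1] that(4) by simp
  have \<beta>_id: "\<beta> id t = 0" if "t \<in> BT" for t
  proof -
    have "id \<in> W" by (simp add: hyperoct_carrier permutes_id)
    then have "\<beta> id t = \<beta> id t + \<beta> id t" using \<beta>_cocycle[of id id t] that by (simp only: comp_id id_comp)
    then show ?thesis by (metis add.right_neutral add_left_cancel)
  qed
  have \<beta>_sign_change: "\<beta> \<nu> t = 0" if \<nu>: "\<nu> \<in> W" "\<And>i. \<bar>\<nu> i\<bar> = \<bar>i\<bar>" and t: "t \<in> BT" for \<nu> t
  proof -
    have "\<nu> (\<nu> i) = i" for i
    proof -
      have "\<nu> i = i \<or> \<nu> i = - i" using \<nu>(2)[of i] by (simp add: abs_eq_iff)
      then show ?thesis using \<nu>(1) by (auto simp: hyperoct_carrier)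
    qed
    then have "\<nu> \<circ> \<nu> = id" by (simp add: fun_eq_iff)
    then have "\<beta> \<nu> (\<nu> \<circ> t) + \<beta> \<nu> t = 0" using \<beta>_cocycle[OF \<nu>(1) \<nu>(1) t] \<beta>_id[OF t] by simp
    moreover have "\<beta> \<nu> (\<nu> \<circ> t) = \<beta> \<nu> t"
      by (rule \<beta>_eq[OF \<nu>(1) t bitableaux_act[OF t \<nu>(1)] Y.polytabloid_sign_change[OF t \<nu>]])
    ultimately have "2 * \<beta> \<nu> t = 0" by simp
    then show ?thesis using two by simp
  qed
  note liftB = Y.lift_bitableau
  have "\<exists>y. \<forall>\<sigma> t. \<sigma> permutes {1..int r} \<longrightarrow> t \<in> Y.Tab \<longrightarrow>
    \<beta> (odd_ext \<sigma>) (Y.lift t) = (\<Sum>u\<in>Y.Tab. y u * (Y.pt_coeff (\<sigma> \<circ> t) u - Y.pt_coeff t u))"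
  proof (rule Y.symmetric_group_cocycle_inner[OF two three])
    fix \<sigma> \<tau> t assume *: "\<sigma> permutes {1..int r}" "\<tau> permutes {1..int r}" "t \<in> Y.Tab"
    show "\<beta> (odd_ext (\<tau> \<circ> \<sigma>)) (Y.lift t) = \<beta> (odd_ext \<tau>) (Y.lift (\<sigma> \<circ> t)) + \<beta> (odd_ext \<sigma>) (Y.lift t)"
      unfolding odd_ext_comp[OF *(1)] Y.lift_act[OF *(3,1), symmetric]
      by (rule \<beta>_cocycle[OF odd_ext_W[OF *(1)] odd_ext_W[OF *(2)] liftB[OF *(3)]])
  next
    fix \<sigma> and I :: "(nat \<times> nat) set set" and a f
    assume *: "\<sigma> permutes {1..int r}" "finite I" "f ` I \<subseteq> Y.Tab"
      and rel: "\<And>u. u \<in> Y.Tab \<Longrightarrow> (\<Sum>i\<in>I. a i * Y.pt_coeff (f i) u) = (0::'k)"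
    have fI: "f i \<in> Y.Tab" if "i \<in> I" for i using *(3) that by blast
    show "(\<Sum>i\<in>I. a i * \<beta> (odd_ext \<sigma>) (Y.lift (f i))) = 0"
    proof (rule \<beta>_comb[OF odd_ext_W[OF *(1)] *(2)])
      show "Y.lift (f i) \<in> BT" if "i \<in> I" for i using liftB[OF fI[OF that]] .
      fix T
      show "(\<Sum>i\<in>I. a i * e (Y.lift (f i)) T) = 0"
      proof (cases "T \<in> tabloids r l")
        case True
        then obtain s where s: "s \<in> BT" "T = tabloid r l s" by (auto simp: tabloids_def)
        obtain u \<nu> where u: "u \<in> Y.Tab" "\<nu> \<in> W" "\<And>i. \<bar>\<nu> i\<bar> = \<bar>i\<bar>" "\<nu> \<circ> s = Y.lift u"
          using Y.bitableau_lift[OF s(1)] by blast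
        have T: "T = tabloid r l (Y.lift u)"
          using tabloid_row_stab[OF Y.sign_change_row_stab[OF u(2,3)], of s] u(4) s(2) by simp
        have "(\<Sum>i\<in>I. a i * e (Y.lift (f i)) T) = (\<Sum>i\<in>I. a i * Y.pt_coeff (f i) u)"
          unfolding T by (rule sum.cong) (simp_all add: Y.polytabloid_lift[OF fI u(1)])
        then show ?thesis using rel[OF u(1)] by simp
      next
        case False
        have "e (Y.lift (f i)) T = 0" if "i \<in> I" for i
          using polytabloid_carrier[OF liftB[OF fI[OF that]]] False unfolding M_carrier by blast
        then show ?thesis by simp
      qed
    qed
  qed
  then obtain y where y: "\<And>\<sigma> t. \<sigma> permutes {1..int r} \<Longrightarrow> t \<in> Y.Tab \<Longrightarrow>
    \<beta> (odd_ext \<sigma>) (Y.lift t) = (\<Sum>u\<in>Y.Tab. y u * (Y.pt_coeff (\<sigma> \<circ> t) u - Y.pt_coeff t u))" by blast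
  define m where "m = restrict (\<lambda>v. \<Sum>u\<in>Y.Tab. y u * v (tabloid r l (Y.lift u))) (carrier (S_mod r l))"
  have m: "m \<in> carrier (dual_S_mod r l)"
    unfolding m_def by (rule dual_S_I) (simp_all add: sum.distrib distrib_left sum_distrib_left mult_ac)
  have m_lift: "m (e (Y.lift t)) = (\<Sum>u\<in>Y.Tab. y u * Y.pt_coeff t u)" if t: "t \<in> Y.Tab" for t
  proof -
    have "e (Y.lift t) \<in> carrier (S_mod r l)" by (rule polytabloid_S[OF liftB[OF t]])
    then show ?thesis by (simp add: m_def Y.polytabloid_lift[OF t])
  qed
  show ?thesis
  proof (rule derivation_inner_if_values[OF c_closed m])
    fix \<sigma> s assume \<sigma>: "\<sigma> \<in> W" and s: "s \<in> BT"
    obtain t \<nu> where t: "t \<in> Y.Tab" and \<nu>: "\<nu> \<in> W" "\<And>i. \<bar>\<nu> i\<bar> = \<bar>i\<bar>" and \<nu>s: "\<nu> \<circ> s = Y.lift t"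
      using Y.bitableau_lift[OF s] by blast
    have es: "e (Y.lift t) = e s" using Y.polytabloid_sign_change[OF s \<nu>] \<nu>s by simp
    let ?\<pi> = "perm_part r \<sigma>"
    have \<pi>: "?\<pi> permutes {1..int r}" by (rule perm_part_permutes[OF \<sigma>])
    note \<pi>W = odd_ext_W[OF \<pi>]
    (* the sign change part of the group element *)
    define \<mu> where "\<mu> = \<sigma> \<circ> pinv (odd_ext ?\<pi>)"
    have \<mu>: "\<mu> \<in> W" unfolding \<mu>_def by (rule hyperoct_comp[OF hyperoct_pinv[OF \<pi>W] \<sigma>])
    have \<sigma>_eq: "\<sigma> = \<mu> \<circ> odd_ext ?\<pi>" by (simp add: \<mu>_def comp_assoc hyperoct_cancel[OF \<pi>W])
    have \<mu>_abs: "\<bar>\<mu> i\<bar> = \<bar>i\<bar>" for i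
      using abs_odd_ext_perm_part[OF \<sigma>, of "pinv (odd_ext ?\<pi>) i"] fun_cong[OF hyperoct_cancel(1)[OF \<pi>W], of i]
      by (simp add: \<mu>_def)
    have \<pi>t: "odd_ext ?\<pi> \<circ> Y.lift t = Y.lift (?\<pi> \<circ> t)" by (rule Y.lift_act[OF t \<pi>])
    have \<pi>tT: "?\<pi> \<circ> t \<in> Y.Tab" by (rule Y.Tab_act[OF t \<pi>])
    have "\<beta> \<sigma> s = \<beta> \<sigma> (Y.lift t)" by (rule \<beta>_eq[OF \<sigma> liftB[OF t] s es[symmetric]])
    also have "\<dots> = \<beta> \<mu> (odd_ext ?\<pi> \<circ> Y.lift t) + \<beta> (odd_ext ?\<pi>) (Y.lift t)"
      using \<beta>_cocycle[OF \<pi>W \<mu> liftB[OF t]] \<sigma>_eq by simp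
    also have "\<dots> = \<beta> (odd_ext ?\<pi>) (Y.lift t)"
      using \<beta>_sign_change[OF \<mu> \<mu>_abs liftB[OF \<pi>tT]] \<pi>t by simp
    also have "\<dots> = m (e (Y.lift (?\<pi> \<circ> t))) - m (e (Y.lift t))"
      by (simp add: y[OF \<pi> t] m_lift[OF t] m_lift[OF \<pi>tT] right_diff_distrib sum_subtractf)
    also have "e (Y.lift (?\<pi> \<circ> t)) = e (\<mu> \<circ> Y.lift (?\<pi> \<circ> t))"
      by (rule Y.polytabloid_sign_change[OF liftB[OF \<pi>tT] \<mu> \<mu>_abs, symmetric])
    also have "\<mu> \<circ> Y.lift (?\<pi> \<circ> t) = \<sigma> \<circ> Y.lift t" unfolding \<pi>t[symmetric] by (subst (2) \<sigma>_eq) (simp add: comp_assoc)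
    also have "e (\<sigma> \<circ> Y.lift t) = e (\<sigma> \<circ> s)"
      using M_elem_polytabloid[OF liftB[OF t] \<sigma>] M_elem_polytabloid[OF s \<sigma>] es by metis
    also have "e (Y.lift t) = e s" by (rule es)
    finally show "c (pinv \<sigma>) (e s) = m (e (\<sigma> \<circ> s)) - m (e s)" unfolding \<beta>_def .
  qed
qed

end

theorem theorem2p7:
  fixes r :: nat and l :: "nat list \<times> nat list"
  assumes "r \<ge> 1"
    and "CHAR('k::alg_closed_field) \<noteq> 2" and "CHAR('k) \<noteq> 3"
    and "bipartition r l"
  shows "trivial_group
    (Ext1 (group_algebra (hyperoct r) :: ((int \<Rightarrow> int) \<Rightarrow> 'k) ring)
      trivial_mod (dual_S_mod r l))"
proof (rule finite_group.trivial_Ext1_if_derivations_inner[OF finite_group_hyperoct right_module_dual_S])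
  fix c :: "(int \<Rightarrow> int) \<Rightarrow> (bitab set \<Rightarrow> 'k) \<Rightarrow> 'k"
  assume c: "\<And>\<sigma>. \<sigma> \<in> carrier (hyperoct r) \<Longrightarrow> c \<sigma> \<in> carrier (dual_S_mod r l)"
    "\<And>\<sigma> \<tau>. \<sigma> \<in> carrier (hyperoct r) \<Longrightarrow> \<tau> \<in> carrier (hyperoct r) \<Longrightarrow>
      c (\<sigma> \<otimes>\<^bsub>hyperoct r\<^esub> \<tau>) = grp_elem \<tau> \<odot>\<^bsub>dual_S_mod r l\<^esub> c \<sigma> \<oplus>\<^bsub>dual_S_mod r l\<^esub> c \<tau>"
  have prime_ne: "of_nat p \<noteq> (0::'k)" if "Factorial_Ring.prime p" "CHAR('k) \<noteq> p" for p
  proof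
    assume "of_nat p = (0::'k)"
    then have "CHAR('k) dvd p" by (simp add: of_nat_eq_0_iff_char_dvd)
    then have "CHAR('k) = 1" using that by (auto simp: prime_nat_iff)
    then show False by (simp add: CHAR_not_1')
  qed
  have two: "(2::'k) \<noteq> 0" and three: "(3::'k) \<noteq> 0"
    using prime_ne[of 2] prime_ne[of 3] assms(2,3) by simp_all
  interpret specht_derivation r l c
    by unfold_locales (use c two three in auto)
  show "\<exists>m\<in>carrier (dual_S_mod r l). \<forall>\<sigma>\<in>carrier (hyperoct r).
      c \<sigma> = grp_elem \<sigma> \<odot>\<^bsub>dual_S_mod r l\<^esub> m \<ominus>\<^bsub>dual_S_mod r l\<^esub> m"
  proof (cases "\<exists>b. Inl b \<in> diagram l")
    case True
    then show ?thesis using derivation_inner_if_fst_nonempty by blast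
  next
    case False
    then have "young (fst l) = {}" by (auto simp: diagram_def)
    then show ?thesis using derivation_inner_if_fst_empty assms(4) by (simp add: bipartition_def)
  qed
qed

end
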